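(* Let $\lambda>0$, and let $X_{\nu'_\lambda}(t)$ be the position at time $t$ of the tagged first-class particle that starts at $0$ in the Hammersley process with initial configuration $\nu'_\lambda=\nu_\lambda+\delta_0$, where $\nu_\lambda$ is a Poisson process on $\mathbb{R}$ of intensity $\lambda$. Set $\mu_1:=-\frac{1}{\lambda^2}$ and $\sigma_1:=\sqrt{\frac{2}{\lambda^3}}$. Then, for all $t\ge 0$, $$\mathbb{E}\,X_{\nu'_\lambda}(t)=\mu_1 t\qquad\text{and}\qquad \mathrm{Var}\,X_{\nu'_\lambda}(t)=\sigma_1^2\, t.$$
   Context: Hammersley process. Let $\nu$ be a (locally finite, simple) counting measure on $\mathbb{R}$ with a positive density of particles; write $z\in\nu$ if $\nu(\{z\})=1$; the atoms are called particles. Let $\mathbf{P}$ be a homogeneous Poisson point set of intensity one in $\mathbb{R}\times(0,\infty)$ (second coordinate is time), independent of $\nu$ if $\nu$ is random. The process $(M^t_\nu)_{t\ge 0}$ starts from $M^0_\nu=\nu$, and at each $(x,s)\in\mathbf{P}$, at time $s$ the nearest particle strictly to the right of $x$ is moved to $x$ (all other particles stay put). Equivalently, $M^t_\nu((x,y])=L_\nu(y,t)-L_\nu(x,t)$ for $x<y$, where $L_\nu(x,t)=\sup_{z\le x}\{\nu(z)+L((z,0),(x,t))\}$, with $\nu(x)=\nu((0,x])$ for $x>0$, $\nu(0)=0$, $\nu(x)=-\nu((x,0])$ for $x<0$, and $L((z,0),(x,t))$ the maximal number of points of $\mathbf{P}$ in $(z,x]\times(0,t]$ that form a sequence increasing in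 both coordinates. For $z\in\nu$, $X^z_\nu(t)$ is the position at time $t$ of the particle initially at $z$ (so particles move only to the left and keep their order). For $\nu'_\lambda=\nu_\lambda+\delta_0$, $X_{\nu'_\lambda}(t):=X^{0}_{\nu'_\lambda}(t)$. *)

theory Defs
  imports "HOL-Probability.Probability"
begin

section \<open>Poisson processes\<close>

text \<open>
  A simple point process is represented by its random set of atoms, so that the number of points
  in \<open>B\<close> is \<open>card (\<eta> \<omega> \<inter> B)\<close>. Local finiteness of \<open>\<eta>\<close> is required with respect to all bounded
  subsets of the ambient space; for \<open>S = UNIV \<times> {0<..}\<close> this includes boxes that touch the
  line of time \<open>0\<close>.
\<close>

definition poisson_point_process ::
  "'a measure \<Rightarrow> real \<Rightarrow> 'b::euclidean_space set \<Rightarrow> ('a \<Rightarrow> 'b set) \<Rightarrow> bool" where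
  "poisson_point_process M r S \<eta> \<longleftrightarrow>
     (AE \<omega> in M. \<eta> \<omega> \<subseteq> S \<and> (\<forall>B. bounded B \<longrightarrow> finite (\<eta> \<omega> \<inter> B))) \<and>
     (\<forall>B\<in>sets borel. bounded B \<and> B \<subseteq> S \<longrightarrow>
        (\<lambda>\<omega>. card (\<eta> \<omega> \<inter> B)) \<in> measurable M (count_space UNIV) \<and>
        (\<forall>k. measure M {\<omega> \<in> space M. card (\<eta> \<omega> \<inter> B) = k} =
               (r * measure lborel B) ^ k / fact k * exp (- (r * measure lborel B)))) \<and>
     (\<forall>(n::nat) A. (\<forall>i<n. A i \<in> sets borel \<and> bounded (A i) \<and> A i \<subseteq> S) \<and>
        disjoint_family_on A {..<n} \<longrightarrow>
        prob_space.indep_vars M (\<lambda>_. count_space UNIV) (\<lambda>i \<omega>. card (\<eta> \<omega> \<inter> A i)) {..<n})"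

definition point_process_events ::
  "'a measure \<Rightarrow> 'b::euclidean_space set \<Rightarrow> ('a \<Rightarrow> 'b set) \<Rightarrow> 'a set set" where
  "point_process_events M S \<eta> =
     sigma_sets (space M)
       {{\<omega> \<in> space M. card (\<eta> \<omega> \<inter> B) = k} | B k. B \<in> sets borel \<and> bounded B \<and> B \<subseteq> S}"

definition indep_point_processes ::
  "'a measure \<Rightarrow> 'b::euclidean_space set \<Rightarrow> ('a \<Rightarrow> 'b set) \<Rightarrow>
     'c::euclidean_space set \<Rightarrow> ('a \<Rightarrow> 'c set) \<Rightarrow> bool" where
  "indep_point_processes M S \<eta> T \<xi> \<longleftrightarrow>
     prob_space.indep_set M (point_process_events M S \<eta>) (point_process_events M T \<xi>)"

section \<open>Last passage percolation\<close>

definition increasing_chain :: "(real \<times> real) set \<Rightarrow> bool" where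
  "increasing_chain C \<longleftrightarrow>
     (\<forall>p\<in>C. \<forall>q\<in>C. p \<noteq> q \<longrightarrow>
        (fst p < fst q \<and> snd p < snd q) \<or> (fst q < fst p \<and> snd q < snd p))"

text \<open>\<open>last_passage P z x t\<close> is $L((z,0),(x,t))$.\<close>

definition last_passage :: "(real \<times> real) set \<Rightarrow> real \<Rightarrow> real \<Rightarrow> real \<Rightarrow> nat" where
  "last_passage P z x t =
     Max {card C | C. finite C \<and> C \<subseteq> P \<inter> ({z<..x} \<times> {0<..t}) \<and> increasing_chain C}"

definition signed_count :: "real set \<Rightarrow> real \<Rightarrow> int" where
  "signed_count \<nu> x =
     (if 0 \<le> x then int (card (\<nu> \<inter> {0<..x})) else - int (card (\<nu> \<inter> {x<..0})))"

text \<open>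
  The supremum is taken in the extended reals, so that an infinite value is not conflated with a
  finite one.
\<close>

definition last_passage_from ::
  "real set \<Rightarrow> (real \<times> real) set \<Rightarrow> real \<Rightarrow> real \<Rightarrow> ereal" where
  "last_passage_from \<nu> P x t =
     (SUP z\<in>{..x}. ereal (of_int (signed_count \<nu> z) + of_nat (last_passage P z x t)))"

section \<open>The Hammersley process\<close>

text \<open>
  \<open>X z t\<close> is the position at time \<open>t\<close> of the particle that is at \<open>z \<in> \<nu>\<close> at time \<open>0\<close>;
  the values for \<open>z \<notin> \<nu>\<close> are irrelevant. Trajectories are locally constant on either side
  of each time, and \<open>position_before X z s\<close> is the position just before time \<open>s\<close>.
\<close>

definition position_before :: "(real \<Rightarrow> real \<Rightarrow> real) \<Rightarrow> real \<Rightarrow> real \<Rightarrow> real" where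
  "position_before X z s = Lim (at_left s) (X z)"

definition nearest_right_before ::
  "real set \<Rightarrow> (real \<Rightarrow> real \<Rightarrow> real) \<Rightarrow> real \<Rightarrow> real \<Rightarrow> real \<Rightarrow> bool" where
  "nearest_right_before \<nu> X x s z \<longleftrightarrow>
     z \<in> \<nu> \<and> x < position_before X z s \<and>
     (\<forall>w\<in>\<nu>. x < position_before X w s \<longrightarrow> position_before X z s \<le> position_before X w s)"

text \<open>
  The last clause is the variational description of the configuration,
  $M^t_\nu((x,y]) = L_\nu(y,t) - L_\nu(x,t)$. On an infinite configuration it makes precise which
  evolution is meant by the local jump rule, since it excludes any influence entering from
  infinity.
\<close>

definition hammersley_process ::
  "real set \<Rightarrow> (real \<times> real) set \<Rightarrow> (real \<Rightarrow> real \<Rightarrow> real) \<Rightarrow> bool" where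
  "hammersley_process \<nu> P X \<longleftrightarrow>
     (\<forall>z\<in>\<nu>. X z 0 = z) \<and>
     (\<forall>z\<in>\<nu>. \<forall>s\<ge>0. eventually (\<lambda>u. X z u = X z s) (at_right s)) \<and>
     (\<forall>z\<in>\<nu>. \<forall>s>0. \<exists>a. eventually (\<lambda>u. X z u = a) (at_left s)) \<and>
     (\<forall>z\<in>\<nu>. \<forall>s>0. \<forall>x. (x, s) \<in> P \<and> nearest_right_before \<nu> X x s z \<longrightarrow> X z s = x) \<and>
     (\<forall>z\<in>\<nu>. \<forall>s>0. (\<nexists>x. (x, s) \<in> P \<and> nearest_right_before \<nu> X x s z) \<longrightarrow>
        X z s = position_before X z s) \<and>
     (\<forall>t\<ge>0. \<forall>x y. x < y \<longrightarrow>
        finite {z \<in> \<nu>. X z t \<in> {x<..y}} \<and>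
        ereal (of_nat (card {z \<in> \<nu>. X z t \<in> {x<..y}})) =
          last_passage_from \<nu> P y t - last_passage_from \<nu> P x t)"

end

theory Submission
  imports Defs
begin

text \<open>
  For \<open>y < 0\<close> let \<open>F\<close> be the supremum over \<open>z \<le> y\<close> of \<open>L((z,0),(y,t)) - N(z,y]\<close>: the number of
  particles that would cross \<open>y\<close> from right to left during \<open>(0,t]\<close>. Particles keep their order, so
  the tagged particle has passed \<open>y\<close> at time \<open>t\<close> exactly when \<open>F\<close> exceeds the number \<open>A\<close> of
  initial particles in \<open>(y,0)\<close> (\<open>tagged_position_iff\<close>). Since \<open>F\<close> depends only on the points to
  the left of \<open>y\<close>, it is independent of \<open>A\<close>. Moreover \<open>F\<close> is Poisson with mean \<open>t / lam\<close>, which is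
  Burke's theorem for the stationary Hammersley process, and \<open>A\<close> is Poisson with mean \<open>lam * (- y)\<close>.
  Hence \<open>P(- X \<ge> u) = P(A < F)\<close> is the tail of a sum of \<open>F\<close> independent exponential variables of
  rate \<open>lam\<close> (\<open>tagged_position_cdf\<close>). Integrating this tail against \<open>1\<close> and \<open>2 * u\<close> gives
  \<open>E(- X) = E F / lam\<close> and \<open>E(X\<^sup>2) = E(F * (F + 1)) / lam\<^sup>2\<close> (\<open>tagged_moments\<close>), and the claimed
  variance \<open>2 * t / lam ^ 3\<close> is what remains.

  To find the law of \<open>F\<close>, read space from left to right as if it were time. The set of times in
  \<open>(0,t]\<close> at which a particle crosses \<open>x\<close> is a Markov chain in \<open>x\<close>: a point \<open>(x,s)\<close> of \<open>P\<close> inserts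
  \<open>s\<close> and deletes the next larger element, and a point of \<open>N\<close> deletes the smallest element. On a
  grid of small cells this is a chain on the subsets of \<open>{1..m}\<close>, whose steps are given by \<open>hop\<close>;
  if no two points share a column or a row, it computes the supremum over the window exactly
  (\<open>excess_level_grid\<close>). The chain has an explicit stationary law, under which the \<open>m\<close> sites are
  occupied independently: a step together with the site that it frees is a weight-preserving
  bijection (\<open>hop_balance\<close>). The number of occupied sites is then binomial and becomes Poisson as the
  mesh tends to zero (\<open>tendsto_binomial_poisson\<close>).

  The supremum is over an unbounded range, while the chain starts from the empty set at \<open>y - K\<close>.
  Two facts bridge the gap, and both come from one coupling (\<open>coupling_mass\<close>): a stretch of
  columns with at least \<open>d\<close> deletions and no insertion empties every state of size at most \<open>d\<close>, and
  its probability is bounded below uniformly in the mesh. Thus the chain forgets its initial state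
  (\<open>coupling_empty_start\<close>), and almost surely there is an \<open>x \<le> y\<close> that no particle crosses up to
  time \<open>t\<close> (\<open>AE_quiet\<close>). To the right of such an \<open>x\<close> the dynamics involves finitely many particles
  before the tagged one, nothing enters from infinity, and counting particles identifies the
  tagged trajectory with the variational formula.
\<close>

section \<open>Removing and inserting points\<close>

text \<open>
  Sites are positive integers, and \<open>0\<close> is a virtual site below all of them. A step at \<open>j\<close> occupies
  \<open>j\<close> and frees the next occupied site above it; a step at \<open>0\<close> thus only frees the lowest occupied
  site. A step at an occupied site has no effect, which agrees with the rule that occupies \<open>j\<close> and
  frees the next occupied site at or above \<open>j\<close>.
\<close>

definition hop :: "nat \<Rightarrow> nat set \<Rightarrow> nat set" where
  "hop j s = (if j \<in> s then s
     else insert j s - {k \<in> s. j < k \<and> (\<forall>i\<in>s. j < i \<longrightarrow> k \<le> i)} - {0})"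

definition chain_step :: "nat option \<Rightarrow> nat set \<Rightarrow> nat set" where
  "chain_step a s = (case a of None \<Rightarrow> s | Some j \<Rightarrow> hop j s)"

definition run :: "nat option list \<Rightarrow> nat set \<Rightarrow> nat set" where
  "run xs s = fold chain_step xs s"

abbreviation cnt :: "nat set \<Rightarrow> nat \<Rightarrow> nat" where
  "cnt s r \<equiv> card (s \<inter> {..r})"

lemma run_append: "run (xs @ ys) s = run ys (run xs s)"
  by (simp add: run_def)

lemma run_simps [simp]: "run [] s = s" "run (a # xs) s = run xs (chain_step a s)"
  by (simp_all add: run_def)

lemma chain_step_simps [simp]: "chain_step None s = s" "chain_step (Some j) s = hop j s"
  by (simp_all add: chain_step_def)

lemma hop_zero_notin: "0 \<notin> s \<Longrightarrow> 0 \<notin> hop j s"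
  by (auto simp: hop_def)

lemma hop_next:
  assumes "finite s" "j \<notin> s" "\<exists>k\<in>s. j < k"
  obtains k where "k \<in> s" "j < k" "\<And>i. i \<in> s \<Longrightarrow> j < i \<Longrightarrow> k \<le> i" "hop j s = insert j s - {k} - {0}"
proof -
  define k where "k = Min {k \<in> s. j < k}"
  have f: "finite {k \<in> s. j < k}" using assms by auto
  have k: "k \<in> {k \<in> s. j < k}" unfolding k_def using assms by (intro Min_in) auto
  have le: "k \<le> i" if "i \<in> s" "j < i" for i
    unfolding k_def using that f by (intro Min_le) auto
  have "{k \<in> s. j < k \<and> (\<forall>i\<in>s. j < i \<longrightarrow> k \<le> i)} = {k}"
    using k le by (auto intro!: antisym)
  then show thesis using that[of k] k le assms by (auto simp: hop_def)
qed

lemma hop_no_next: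
  assumes "j \<notin> s" "\<not> (\<exists>k\<in>s. j < k)"
  shows "hop j s = insert j s - {0}"
  using assms by (auto simp: hop_def)

text \<open>
  The effect of a step on the counting function of the state is the recursion of a last passage
  time: a deletion lowers the count by one but not below zero.
\<close>

lemma cnt_hop_zero:
  assumes "finite s" "0 \<notin> s"
  shows "cnt (hop 0 s) r = cnt s r - 1"
proof (cases "s = {}")
  case True
  then show ?thesis by (simp add: hop_def)
next
  case False
  then have "\<exists>k\<in>s. 0 < k" using assms by (metis ex_in_conv gr0I)
  note next0 = hop_next[OF assms this]
  obtain k where k: "k \<in> s" "0 < k" "\<And>i. i \<in> s \<Longrightarrow> 0 < i \<Longrightarrow> k \<le> i"
      "hop 0 s = insert 0 s - {k} - {0}"
    by (rule next0, rule that)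
  then have h: "hop 0 s = s - {k}" using assms by auto
  show ?thesis
  proof (cases "k \<le> r")
    case True
    then have "hop 0 s \<inter> {..r} = (s \<inter> {..r}) - {k}" using h by auto
    then show ?thesis using True k(1) by simp
  next
    case False
    have "r < i" if "i \<in> s" for i
      using False k(3)[OF that] that assms(2) by (cases "i = 0") auto
    then have "s \<inter> {..r} = {}" by (force simp: not_le[symmetric])
    moreover then have "hop 0 s \<inter> {..r} = {}" using h by auto
    ultimately show ?thesis by simp
  qed
qed

text \<open>
  An insertion at \<open>j\<close> offers every \<open>r \<ge> j\<close> the alternative of one more point than up to \<open>j - 1\<close>.
  It changes the count only if \<open>{j..r}\<close> contains no occupied site; otherwise the freed site
  compensates for it, or \<open>j\<close> is occupied already.
\<close>

lemma cnt_hop_pos: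
  assumes "finite s" "0 \<notin> s" "0 < j"
  shows "cnt (hop j s) r = (if r < j then cnt s r else max (cnt s r) (Suc (cnt s (j - 1))))"
proof -
  have split: "cnt s r = cnt s (j - 1) + card (s \<inter> {j..r})" if "j \<le> r" for r
  proof -
    have "s \<inter> {..r} = (s \<inter> {..j - 1}) \<union> (s \<inter> {j..r})" using that assms(3) by auto
    moreover have "(s \<inter> {..j - 1}) \<inter> (s \<inter> {j..r}) = {}" using assms(3) by auto
    ultimately show ?thesis using assms(1) by (simp add: card_Un_disjoint)
  qed
  consider "j \<in> s" | "j \<notin> s" "\<exists>k\<in>s. j < k" | "j \<notin> s" "\<not> (\<exists>k\<in>s. j < k)" by blast
  then show ?thesis
  proof cases
    case 1
    then have "hop j s = s" by (simp add: hop_def)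
    moreover have "card (s \<inter> {j..r}) \<ge> 1" if "j \<le> r"
    proof -
      have "j \<in> s \<inter> {j..r}" using 1 that by auto
      then show ?thesis using assms(1)
        by (metis One_nat_def Suc_leI card_gt_0_iff empty_iff finite_Int)
    qed
    ultimately show ?thesis using split[of r] by auto
  next
    case 2
    obtain k where k: "k \<in> s" "j < k" "\<And>i. i \<in> s \<Longrightarrow> j < i \<Longrightarrow> k \<le> i"
      "hop j s = insert j s - {k} - {0}"
      by (rule hop_next[OF assms(1) 2], rule that)
    have h: "hop j s = insert j (s - {k})" using k(1,2,4) assms(2,3) by auto
    show ?thesis
    proof (cases "r < j")
      case True
      then have "hop j s \<inter> {..r} = s \<inter> {..r}" using h k(1,2) by auto
      then show ?thesis using True by simp
    next
      case jr: False
      show ?thesis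
      proof (cases "k \<le> r")
        case True
        have "hop j s \<inter> {..r} = insert j (s \<inter> {..r} - {k})" using h jr k(1,2) by auto
        then have "cnt (hop j s) r = Suc (card (s \<inter> {..r} - {k}))"
          using 2(1) assms(1) by simp
        also have "\<dots> = cnt s r" using True k(1) assms(1)
          by (intro card_Suc_Diff1) auto
        finally have a: "cnt (hop j s) r = cnt s r" .
        have "k \<in> s \<inter> {j..r}" using k(1,2) True by auto
        then have "card (s \<inter> {j..r}) \<ge> 1" using assms(1)
          by (metis One_nat_def Suc_leI card_gt_0_iff empty_iff finite_Int)
        then show ?thesis using a split[of r] jr by auto
      next
        case False
        have "hop j s \<inter> {..r} = insert j (s \<inter> {..r})" using h jr False by auto
        moreover have "s \<inter> {j..r} = {}"
        proof -
          have False if "i \<in> s" "j \<le> i" "i \<le> r" for i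
            using k(3)[of i] that False 2(1) by (cases "i = j") auto
          then show ?thesis by auto
        qed
        ultimately show ?thesis using split[of r] jr 2(1) assms(1) by simp
      qed
    qed
  next
    case 3
    then have h: "hop j s = insert j s" using assms by (auto simp: hop_no_next)
    show ?thesis
    proof (cases "r < j")
      case True
      then show ?thesis using h by simp
    next
      case False
      then have "s \<inter> {j..r} = {}" using 3 by (auto simp: order.order_iff_strict)
      then show ?thesis using split[of r] False h 3(1) assms(1) by simp
    qed
  qed
qed

lemma hop_in_Pow:
  assumes "s \<subseteq> {1..m}" "j \<le> m"
  shows "hop j s \<subseteq> {1..m}"
  using assms by (auto simp: hop_def Suc_le_eq subset_iff split: if_splits)

lemma hop_mono: "s \<subseteq> s' \<Longrightarrow> hop j s \<subseteq> hop j s'"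
  unfolding hop_def by (auto split: if_splits)

lemma finite_hop: "finite s \<Longrightarrow> finite (hop j s)"
  by (simp add: hop_def)

lemma run_finite_zero:
  assumes "finite s" "0 \<notin> s"
  shows "finite (run xs s) \<and> 0 \<notin> run xs s"
  using assms
proof (induction xs arbitrary: s)
  case (Cons a xs)
  then show ?case by (cases a) (auto simp: finite_hop hop_zero_notin)
qed auto

lemma run_mono: "s \<subseteq> s' \<Longrightarrow> run xs s \<subseteq> run xs s'"
proof (induction xs arbitrary: s s')
  case (Cons a xs)
  then show ?case by (cases a) (auto simp: hop_mono)
qed simp

lemma run_empty_card_le:
  assumes "finite s" "0 \<notin> s"
  shows "card (run xs {}) \<le> card (run xs s)"
  using run_mono[of "{}" s xs] run_finite_zero[OF assms] by (auto intro: card_mono)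

lemma run_in_Pow:
  assumes "s \<subseteq> {1..m}" "set xs \<subseteq> insert None (Some ` {..m})"
  shows "run xs s \<subseteq> {1..m}"
  using assms
proof (induction xs arbitrary: s)
  case (Cons a xs)
  show ?case
  proof (cases a)
    case None
    then show ?thesis using Cons by simp
  next
    case (Some j)
    then have "hop j s \<subseteq> {1..m}" using Cons.prems by (intro hop_in_Pow) auto
    then show ?thesis using Cons Some by simp
  qed
qed auto

text \<open>
  The site freed by a step at \<open>j\<close>, with \<open>Suc m\<close> recording that no occupied site is above \<open>j\<close>. It is
  the place at which the time-reversed chain steps; the virtual site of that chain lies above all
  others.
\<close>

definition removed :: "nat \<Rightarrow> nat \<Rightarrow> nat set \<Rightarrow> nat" where
  "removed m j s = (if j \<in> s then j else Min (insert (Suc m) {k \<in> s. j < k}))"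

text \<open>
  Reflecting the order of the sites turns the chain into its reversal: the step is undone by
  occupying \<open>k\<close> again and freeing the next occupied site below it.
\<close>

definition unhop :: "nat \<Rightarrow> nat \<Rightarrow> nat set \<Rightarrow> nat \<times> nat set" where
  "unhop m k s = (if k \<in> s then (k, s)
     else let j = Max (insert 0 {i \<in> s. i < k}) in (j, insert k (s - {j}) - {Suc m}))"

lemma removed_cases:
  assumes s: "s \<subseteq> {1..m}" and j: "j \<le> m"
  obtains "j \<in> s" "removed m j s = j" "hop j s = s"
  | k where "j \<notin> s" "removed m j s = k" "j < k" "k \<le> m" "k \<in> s" "\<And>i. i \<in> s \<Longrightarrow> j < i \<Longrightarrow> k \<le> i"
     "hop j s = insert j (s - {k}) - {0}"
  | "j \<notin> s" "removed m j s = Suc m" "\<And>i. i \<in> s \<Longrightarrow> i < j" "hop j s = insert j s - {0}"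
proof -
  have fin: "finite s" using s finite_subset by auto
  consider "j \<in> s" | "j \<notin> s" "\<exists>k\<in>s. j < k" | "j \<notin> s" "\<not> (\<exists>k\<in>s. j < k)" by blast
  then show thesis
  proof cases
    case 1
    then show ?thesis using that(1) by (simp add: removed_def hop_def)
  next
    case 2
    obtain k where k: "k \<in> s" "j < k" "\<And>i. i \<in> s \<Longrightarrow> j < i \<Longrightarrow> k \<le> i"
      "hop j s = insert j s - {k} - {0}"
      by (rule hop_next[OF fin 2], rule that)
    have "Min (insert (Suc m) {k \<in> s. j < k}) = k"
      using k s fin by (intro Min_eqI) auto
    then have "removed m j s = k" using 2 by (simp add: removed_def)
    moreover have "hop j s = insert j (s - {k}) - {0}" using k by auto
    ultimately show ?thesis using that(2)[of k] 2 k s by auto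
  next
    case 3
    then have "{k \<in> s. j < k} = {}" by auto
    then have "removed m j s = Suc m" using 3 by (simp add: removed_def del: Collect_empty_eq)
    moreover have "i < j" if "i \<in> s" for i using 3 that by (metis linorder_neqE_nat)
    ultimately show ?thesis using that(3) 3 hop_no_next by blast
  qed
qed

lemma unhop_hop:
  assumes s: "s \<subseteq> {1..m}" and j: "j \<le> m"
  shows "unhop m (removed m j s) (hop j s) = (j, s)"
proof -
  have fin: "finite s" using s finite_subset by auto
  show ?thesis
    using s j
  proof (cases rule: removed_cases)
    case 1
    then show ?thesis by (simp add: unhop_def)
  next
    case (2 k)
    have "Max (insert 0 {i \<in> insert j (s - {k}) - {0}. i < k}) = j"
    proof (rule Max_eqI)
      have "i \<le> j" if "i \<in> s" "i < k" for i using 2(6)[of i] that by force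
      then show "y \<le> j" if "y \<in> insert 0 {i \<in> insert j (s - {k}) - {0}. i < k}" for y
        using that by auto
    qed (use 2(3) fin in auto)
    moreover have "insert k (insert j (s - {k}) - {0} - {j}) - {Suc m} = s"
      using 2(1,3-5) s by auto
    moreover have "k \<notin> hop j s" using 2(3,7) by auto
    ultimately show ?thesis using 2(2,3,7) by (simp add: unhop_def Let_def)
  next
    case 3
    have "Max (insert 0 {i \<in> insert j s - {0}. i < Suc m}) = j"
      using 3(3) fin j by (intro Max_eqI) (auto dest: less_imp_le)
    moreover have "insert (Suc m) (insert j s - {0} - {j}) - {Suc m} = s"
      using 3(1) s by auto
    moreover have "Suc m \<notin> hop j s" using 3(4) s j by auto
    ultimately show ?thesis using 3(2,4) by (simp add: unhop_def Let_def)
  qed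
qed

lemma removed_range:
  assumes s: "s \<subseteq> {1..m}" and j: "j \<le> m"
  shows "removed m j s \<in> {1..Suc m}"
  using s j by (cases rule: removed_cases) (use s in auto)

text \<open>
  A step moves a particle from the freed site to \<open>j\<close>, where the virtual sites \<open>0\<close> and \<open>Suc m\<close> serve
  as sink and source. Occupied sites of \<open>{1..m}\<close> carry a factor \<open>r\<close>, and so does a step at or a
  removal from such a site; thus both sides count the particle once before and once after its move.
\<close>

lemma hop_weight:
  fixes r :: real
  assumes s: "s \<subseteq> {1..m}" and j: "j \<le> m"
  shows "(if j = 0 then 1 else r) * r ^ card s =
    (if removed m j s = Suc m then 1 else r) * r ^ card (hop j s)"
proof -
  have fin: "finite s" using s finite_subset by auto
  show ?thesis
    using s j
  proof (cases rule: removed_cases)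
    case 1
    then show ?thesis using s j by auto
  next
    case (2 k)
    have c: "card s = Suc (card (s - {k}))"
      using card_Suc_Diff1[OF fin 2(5)] by simp
    show ?thesis
    proof (cases "j = 0")
      case True
      then have "hop j s = s - {k}" using 2(7) s by auto
      moreover have "removed m j s \<noteq> Suc m" using 2(2,4) by simp
      ultimately show ?thesis using True unfolding c by simp
    next
      case False
      then have "hop j s = insert j (s - {k})" using 2(7) s by auto
      then have "card (hop j s) = card s" using c fin 2(1) by simp
      then show ?thesis using 2(2,4) False by auto
    qed
  next
    case 3
    show ?thesis
    proof (cases "j = 0")
      case True
      then have "s = {}" using 3(3) by auto
      then show ?thesis using True 3(2,4) by simp
    next
      case False
      then have "hop j s = insert j s" using 3(4) s by auto
      then show ?thesis using 3(1,2) False fin by simp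
    qed
  qed
qed

text \<open>
  Stationarity of the weights \<open>r ^ card s\<close>. Steps and states are permuted by the reversal bijection
  without changing the weights, so averaging \<open>h\<close> after the step is averaging \<open>h\<close> over the pairs
  \<open>(freed site, new state)\<close>.
\<close>

lemma hop_balance:
  fixes r :: real and h :: "nat set \<Rightarrow> real"
  shows "(\<Sum>j\<le>m. \<Sum>s\<in>Pow {1..m}. (if j = 0 then 1 else r) * r ^ card s * h (hop j s)) =
    (1 + m * r) * (\<Sum>s\<in>Pow {1..m}. r ^ card s * h s)"
proof -
  let ?A = "{..m} \<times> Pow {1..m}" and ?B = "{1..Suc m} \<times> Pow {1..m}"
  let ?f = "\<lambda>(j, s). (removed m j s, hop j s)"
  let ?g = "\<lambda>(k, s). (if k = Suc m then 1 else r) * r ^ card s * h s"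
  have inj: "inj_on ?f ?A"
    by (rule inj_on_inverseI[where g = "\<lambda>(k, s). unhop m k s"]) (auto simp: unhop_hop)
  have "?f x \<in> ?B" if "x \<in> ?A" for x
  proof -
    obtain j s where js: "x = (j, s)" "s \<subseteq> {1..m}" "j \<le> m" using \<open>x \<in> ?A\<close> by auto
    show ?thesis using removed_range[OF js(2,3)] hop_in_Pow[OF js(2,3)] js(1) by simp
  qed
  then have "?f ` ?A \<subseteq> ?B" by (rule image_subsetI)
  moreover have "card ?A = card ?B" by (simp add: card_cartesian_product)
  \<comment> \<open>an injection between finite sets of equal size is onto\<close>
  ultimately have img: "?f ` ?A = ?B"
    using card_image[OF inj] by (intro card_subset_eq) auto
  have "(\<Sum>j\<le>m. \<Sum>s\<in>Pow {1..m}. (if j = 0 then 1 else r) * r ^ card s * h (hop j s)) =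
      (\<Sum>(j, s)\<in>?A. (if j = 0 then 1 else r) * r ^ card s * h (hop j s))"
    by (rule sum.cartesian_product)
  also have "\<dots> = (\<Sum>x\<in>?A. ?g (?f x))"
    by (rule sum.cong) (auto simp: hop_weight)
  also have "\<dots> = (\<Sum>x\<in>?B. ?g x)"
    using sum.reindex[OF inj, of ?g] img by simp
  also have "\<dots> = (\<Sum>k\<in>{1..Suc m}. \<Sum>s\<in>Pow {1..m}. (if k = Suc m then 1 else r) * r ^ card s * h s)"
    by (rule sum.cartesian_product[symmetric])
  also have "\<dots> = (\<Sum>k\<in>{1..Suc m}. if k = Suc m then 1 else r) * (\<Sum>s\<in>Pow {1..m}. r ^ card s * h s)"
    by (simp only: sum_product mult.assoc)
  also have "(\<Sum>k\<in>{1..Suc m}. if k = Suc m then 1 else r) = 1 + m * r"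
    by (simp add: sum.If_cases)
  finally show ?thesis .
qed

section \<open>A stationary chain and its coupling\<close>

text \<open>
  The mean of \<open>f\<close> over lists of \<open>n\<close> independent letters from the alphabet \<open>V\<close> with weights \<open>w\<close>.
  The recursive form turns a concatenation of lists into an iterated mean.
\<close>

primrec iid_mean :: "'b set \<Rightarrow> ('b \<Rightarrow> real) \<Rightarrow> nat \<Rightarrow> ('b list \<Rightarrow> real) \<Rightarrow> real" where
  "iid_mean V w 0 f = f []"
| "iid_mean V w (Suc n) f = (\<Sum>a\<in>V. w a * iid_mean V w n (\<lambda>xs. f (a # xs)))"

lemma iid_mean_add:
  "iid_mean V w (k + n) f = iid_mean V w k (\<lambda>xs. iid_mean V w n (\<lambda>ys. f (xs @ ys)))"
  by (induction k arbitrary: f) auto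

lemma iid_mean_mono:
  assumes "\<And>a. a \<in> V \<Longrightarrow> 0 \<le> w a"
    and "\<And>xs. length xs = n \<Longrightarrow> set xs \<subseteq> V \<Longrightarrow> f xs \<le> g xs"
  shows "iid_mean V w n f \<le> iid_mean V w n g"
  using assms(2)
proof (induction n arbitrary: f g)
  case (Suc n)
  have "iid_mean V w n (\<lambda>xs. f (a # xs)) \<le> iid_mean V w n (\<lambda>xs. g (a # xs))" if "a \<in> V" for a
    using that by (intro Suc.IH Suc.prems) auto
  then show ?case using assms(1) by (simp add: sum_mono mult_left_mono)
qed auto

lemma iid_mean_cmult: "iid_mean V w n (\<lambda>xs. c * f xs) = c * iid_mean V w n f"
  by (induction n arbitrary: f) (auto simp: sum_distrib_left mult.left_commute)

lemma iid_mean_plus: "iid_mean V w n (\<lambda>xs. f xs + g xs) = iid_mean V w n f + iid_mean V w n g"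
  by (induction n arbitrary: f g) (auto simp: sum.distrib distrib_left)

lemma iid_mean_minus: "iid_mean V w n (\<lambda>xs. f xs - g xs) = iid_mean V w n f - iid_mean V w n g"
  by (induction n arbitrary: f g) (auto simp: sum_subtractf right_diff_distrib)

lemma iid_mean_const:
  assumes "(\<Sum>a\<in>V. w a) = 1" shows "iid_mean V w n (\<lambda>xs. c) = c"
  by (induction n) (use assms in \<open>auto simp: sum_distrib_right[symmetric]\<close>)

lemma iid_mean_nonneg:
  assumes "\<And>a. a \<in> V \<Longrightarrow> 0 \<le> w a" "\<And>xs. 0 \<le> f xs"
  shows "0 \<le> iid_mean V w n f"
  using assms(2) by (induction n arbitrary: f) (auto intro!: sum_nonneg mult_nonneg_nonneg assms(1))

lemma iid_mean_sum_lists: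
  assumes "finite V"
  shows "iid_mean V w n f = (\<Sum>xs\<in>{xs. set xs \<subseteq> V \<and> length xs = n}. prod_list (map w xs) * f xs)"
proof (induction n arbitrary: f)
  case 0
  have "{xs. set xs \<subseteq> V \<and> length xs = 0} = {[]}" by auto
  then show ?case by simp
next
  case (Suc n)
  let ?L = "{xs. set xs \<subseteq> V \<and> length xs = n}"
  have eq: "{xs. set xs \<subseteq> V \<and> length xs = Suc n} = (\<lambda>(a, xs). a # xs) ` (V \<times> ?L)"
    by (auto simp: length_Suc_conv image_iff)
  have inj: "inj_on (\<lambda>(a, xs). a # xs) (V \<times> ?L)" by (auto simp: inj_on_def)
  have "iid_mean V w (Suc n) f = (\<Sum>a\<in>V. \<Sum>xs\<in>?L. w a * (prod_list (map w xs) * f (a # xs)))"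
    by (simp add: Suc.IH sum_distrib_left)
  also have "\<dots> = (\<Sum>(a, xs)\<in>V \<times> ?L. w a * (prod_list (map w xs) * f (a # xs)))"
    by (rule sum.cartesian_product)
  also have "\<dots> = (\<Sum>xs\<in>{xs. set xs \<subseteq> V \<and> length xs = Suc n}. prod_list (map w xs) * f xs)"
    unfolding eq sum.reindex[OF inj] by (rule sum.cong) (auto simp: mult.assoc)
  finally show ?case .
qed

lemma sum_Pow_card:
  fixes g :: "nat \<Rightarrow> real"
  assumes "finite A"
  shows "(\<Sum>s\<in>Pow A. g (card s)) = (\<Sum>k\<le>card A. real (card A choose k) * g k)"
proof -
  have "(\<Sum>s\<in>Pow A. g (card s)) = (\<Sum>k\<le>card A. \<Sum>s\<in>{s\<in>Pow A. card s = k}. g (card s))"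
    by (rule sum.group[symmetric]) (use assms in \<open>auto intro: card_mono\<close>)
  also have "\<dots> = (\<Sum>k\<le>card A. real (card A choose k) * g k)"
  proof (rule sum.cong[OF refl])
    fix k
    have "(\<Sum>s\<in>{s\<in>Pow A. card s = k}. g (card s)) = real (card {s. s \<subseteq> A \<and> card s = k}) * g k"
      by simp
    then show "(\<Sum>s\<in>{s\<in>Pow A. card s = k}. g (card s)) = real (card A choose k) * g k"
      using n_subsets[OF assms] by simp
  qed
  finally show ?thesis .
qed

text \<open>
  One column of the grid contains a single point of \<open>N\<close> with probability \<open>q\<close>, a single point of \<open>P\<close>
  in row \<open>j\<close> with probability \<open>q * r\<close> for each \<open>j\<close>, and otherwise it is skipped. The ratio \<open>r\<close> is
  also the weight of an occupied site in the stationary law.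
\<close>

locale iid_columns =
  fixes m :: nat and q r :: real
  assumes q_pos: "0 < q" and r_pos: "0 < r" and q_le: "q * (1 + m * r) \<le> 1"
begin

definition moves :: "nat option set" where "moves = insert None (Some ` {..m})"

definition move_prob :: "nat option \<Rightarrow> real" where
  "move_prob a = (case a of None \<Rightarrow> 1 - q * (1 + m * r) | Some j \<Rightarrow> if j = 0 then q else q * r)"

abbreviation mean :: "nat \<Rightarrow> (nat option list \<Rightarrow> real) \<Rightarrow> real" where
  "mean \<equiv> iid_mean moves move_prob"

definition stat :: "(nat set \<Rightarrow> real) \<Rightarrow> real" where
  "stat h = (\<Sum>s\<in>Pow {1..m}. r ^ card s * h s) / (1 + r) ^ m"

lemma move_prob_nonneg: "0 \<le> move_prob a"
  using q_pos r_pos q_le by (auto simp: move_prob_def split: option.split)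

lemma sum_moves: "(\<Sum>a\<in>moves. g a) = g None + (\<Sum>j\<le>m. g (Some j))"
  unfolding moves_def by (subst sum.insert) (auto simp: sum.reindex)

lemma sum_atMost_if: "(\<Sum>j\<le>m. if j = 0 then a else b) = a + real m * (b::real)"
proof -
  have "(\<Sum>j\<le>m. if j = 0 then a else b) = a + (\<Sum>j\<in>{..m} - {0}. if j = 0 then a else b)"
    by (subst sum.remove[of _ 0]) auto
  also have "(\<Sum>j\<in>{..m} - {0}. if j = 0 then a else b) = (\<Sum>j\<in>{..m} - {0}. b)"
    by (rule sum.cong) auto
  finally show ?thesis by simp
qed

lemma sum_move_prob: "(\<Sum>a\<in>moves. move_prob a) = 1"
  unfolding sum_moves by (simp add: move_prob_def sum_atMost_if algebra_simps)

lemmas mean_const = iid_mean_const[OF sum_move_prob]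

lemma finite_moves: "finite moves" by (simp add: moves_def)

lemma mean_mono:
  assumes "\<And>xs. length xs = n \<Longrightarrow> set xs \<subseteq> moves \<Longrightarrow> f xs \<le> g xs"
  shows "mean n f \<le> mean n g"
  using move_prob_nonneg assms by (rule iid_mean_mono)

lemma stat_mono:
  assumes "\<And>s. s \<subseteq> {1..m} \<Longrightarrow> f s \<le> g s"
  shows "stat f \<le> stat g"
  unfolding stat_def using assms r_pos
  by (intro divide_right_mono sum_mono mult_left_mono) auto

lemma stat_cmult: "stat (\<lambda>s. c * f s) = c * stat f"
  unfolding stat_def by (simp add: sum_distrib_left sum_divide_distrib algebra_simps)

lemma stat_plus: "stat (\<lambda>s. f s + g s) = stat f + stat g"
  unfolding stat_def by (simp add: sum.distrib distrib_left add_divide_distrib)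

lemma stat_minus: "stat (\<lambda>s. f s - g s) = stat f - stat g"
  unfolding stat_def by (simp add: sum_subtractf right_diff_distrib diff_divide_distrib)

lemma stat_card:
  "stat (\<lambda>s. h (card s)) = (\<Sum>k\<le>m. real (m choose k) * (r ^ k * h k)) / (1 + r) ^ m"
  unfolding stat_def using sum_Pow_card[of "{1..m}" "\<lambda>k. r ^ k * h k"] by simp

lemma stat_const: "stat (\<lambda>s. c) = c"
proof -
  have "(\<Sum>k\<le>m. real (m choose k) * r ^ k) = (r + 1) ^ m"
    by (subst binomial_ring) simp
  then have "(\<Sum>k\<le>m. real (m choose k) * (r ^ k * c)) = (1 + r) ^ m * c"
    by (simp add: sum_distrib_right[symmetric] mult.assoc[symmetric] add.commute)
  moreover have "(1 + r) ^ m \<noteq> 0" using r_pos by auto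
  ultimately show ?thesis using stat_card[of "\<lambda>_. c"] by simp
qed

lemma stat_step: "stat (\<lambda>s. \<Sum>a\<in>moves. move_prob a * h (chain_step a s)) = stat h"
proof -
  let ?S = "\<Sum>s\<in>Pow {1..m}. r ^ card s * h s"
  have "(\<Sum>s\<in>Pow {1..m}. r ^ card s * (\<Sum>a\<in>moves. move_prob a * h (chain_step a s))) =
    (1 - q * (1 + m * r)) * ?S +
    (\<Sum>s\<in>Pow {1..m}. \<Sum>j\<le>m. q * ((if j = 0 then 1 else r) * r ^ card s * h (hop j s)))"
  proof -
    have "r ^ card s * (\<Sum>a\<in>moves. move_prob a * h (chain_step a s)) =
       (1 - q * (1 + m * r)) * (r ^ card s * h s) +
       (\<Sum>j\<le>m. q * ((if j = 0 then 1 else r) * r ^ card s * h (hop j s)))" for s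
    proof -
      have A: "r ^ card s * (move_prob None * h (chain_step None s)) = (1 - q * (1 + m * r)) * (r ^ card s * h s)"
        by (simp only: move_prob_def option.case chain_step_simps mult.left_commute)
      have B: "r ^ card s * (move_prob (Some j) * h (chain_step (Some j) s)) =
         q * ((if j = 0 then 1 else r) * r ^ card s * h (hop j s))" for j
        by (cases "j = 0") (auto simp: move_prob_def)
      show ?thesis unfolding sum_moves distrib_left sum_distrib_left A B ..
    qed
    then show ?thesis by (simp add: sum.distrib sum_distrib_left)
  qed
  also have "(\<Sum>s\<in>Pow {1..m}. \<Sum>j\<le>m. q * ((if j = 0 then 1 else r) * r ^ card s * h (hop j s)))
    = q * (\<Sum>j\<le>m. \<Sum>s\<in>Pow {1..m}. (if j = 0 then 1 else r) * r ^ card s * h (hop j s))"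
    by (subst sum.swap) (simp add: sum_distrib_left)
  also have "\<dots> = q * ((1 + m * r) * ?S)" by (simp only: hop_balance)
  also have "(1 - q * (1 + m * r)) * ?S + q * ((1 + m * r) * ?S) = ?S"
    by (simp only: mult.assoc[symmetric] distrib_right[symmetric]) simp
  finally show ?thesis unfolding stat_def by simp
qed

lemma stat_run: "stat (\<lambda>s. mean n (\<lambda>xs. h (run xs s))) = stat h"
proof (induction n)
  case (Suc n)
  have "stat (\<lambda>s. mean (Suc n) (\<lambda>xs. h (run xs s))) =
     stat (\<lambda>s. \<Sum>a\<in>moves. move_prob a * (\<lambda>s. mean n (\<lambda>xs. h (run xs s))) (chain_step a s))"
    by simp
  then show ?case using Suc stat_step[of "\<lambda>s. mean n (\<lambda>xs. h (run xs s))"] by simp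
qed simp

text \<open>
  Suppose that a property \<open>Q\<close> of the trajectory can only survive a block of columns if the block is
  not good or if the stationary chain had more than \<open>n0\<close> occupied sites before it. The block is
  independent of the past, and by stationarity crowded states have mass at most \<open>\<theta>\<close> at every time.
  The mass \<open>F k\<close> of \<open>Q\<close> after \<open>k\<close> blocks therefore satisfies \<open>F (k + 1) \<le> (1 - c) * F k + c * \<theta>\<close>.
\<close>

lemma coupling_mass:
  fixes Q :: "nat \<Rightarrow> nat set \<Rightarrow> nat option list \<Rightarrow> bool"
  assumes good: "c \<le> mean b (\<lambda>ys. of_bool (good ys))" and c: "0 \<le> c"
    and tail: "stat (\<lambda>s. of_bool (n0 < card s)) \<le> \<theta>"
    and Q: "\<And>k s xs ys. \<lbrakk>s \<subseteq> {1..m}; length xs = n + k * b; length ys = b; set xs \<subseteq> moves; set ys \<subseteq> moves;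
        Q (Suc k) s (xs @ ys)\<rbrakk> \<Longrightarrow> Q k s xs \<and> \<not> (card (run xs s) \<le> n0 \<and> good ys)"
  shows "stat (\<lambda>s. mean (n + k * b) (\<lambda>xs. of_bool (Q k s xs))) \<le> (1 - c) ^ k + \<theta>"
proof -
  define c' where "c' = mean b (\<lambda>ys. of_bool (good ys))"
  have c'1: "c' \<le> 1"
    using mean_mono[of b "\<lambda>ys. of_bool (good ys)" "\<lambda>_. 1"] mean_const[of b 1]
    by (simp add: c'_def)
  have c'0: "0 \<le> c'" using good c by (simp add: c'_def)
  define F where "F k = stat (\<lambda>s. mean (n + k * b) (\<lambda>xs. of_bool (Q k s xs)))" for k
  have th: "stat (\<lambda>s. mean l (\<lambda>xs. of_bool (n0 < card (run xs s)))) \<le> \<theta>" for l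
    using stat_run[of l "\<lambda>s. of_bool (n0 < card s)"] tail by simp
  have th0: "0 \<le> \<theta>"
    using tail stat_mono[of "\<lambda>_. 0" "\<lambda>s. of_bool (n0 < card s)"] stat_const[of 0] by simp
  have step: "F (Suc k) \<le> (1 - c') * F k + c' * \<theta>" for k
  proof -
    have inner: "mean b (\<lambda>ys. of_bool (Q (Suc k) s (xs @ ys))) \<le>
        (1 - c') * of_bool (Q k s xs) + c' * of_bool (n0 < card (run xs s))"
      if s: "s \<subseteq> {1..m}" and xs: "length xs = n + k * b" "set xs \<subseteq> moves" for s xs
    proof -
      have "mean b (\<lambda>ys. of_bool (Q (Suc k) s (xs @ ys))) \<le>
         mean b (\<lambda>ys. of_bool (Q k s xs) - of_bool (Q k s xs) * of_bool (card (run xs s) \<le> n0) * of_bool (good ys))"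
        by (rule mean_mono) (use Q[OF s xs(1) _ xs(2)] in \<open>auto split: if_splits\<close>)
      also have "\<dots> = of_bool (Q k s xs) - of_bool (Q k s xs) * of_bool (card (run xs s) \<le> n0) * c'"
        by (simp only: iid_mean_minus mean_const iid_mean_cmult c'_def)
      also have "\<dots> \<le> (1 - c') * of_bool (Q k s xs) + c' * of_bool (n0 < card (run xs s))"
        using c'0 by auto
      finally show ?thesis .
    qed
    have "F (Suc k) = stat (\<lambda>s. mean ((n + k * b) + b) (\<lambda>xs. of_bool (Q (Suc k) s xs)))"
      unfolding F_def by (simp add: add_ac)
    also have "\<dots> = stat (\<lambda>s. mean (n + k * b) (\<lambda>xs. mean b (\<lambda>ys. of_bool (Q (Suc k) s (xs @ ys)))))"
      by (simp only: iid_mean_add)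
    also have "\<dots> \<le> stat (\<lambda>s. mean (n + k * b) (\<lambda>xs.
        (1 - c') * of_bool (Q k s xs) + c' * of_bool (n0 < card (run xs s))))"
      by (intro stat_mono mean_mono inner)
    also have "\<dots> = (1 - c') * F k + c' * stat (\<lambda>s. mean (n + k * b) (\<lambda>xs. of_bool (n0 < card (run xs s))))"
      by (simp only: iid_mean_plus iid_mean_cmult stat_plus stat_cmult F_def)
    also have "\<dots> \<le> (1 - c') * F k + c' * \<theta>"
      using th c'0 by (intro add_left_mono mult_left_mono) auto
    finally show ?thesis .
  qed
  have "F k \<le> (1 - c') ^ k + \<theta>"
  proof (induction k)
    case 0
    have "F 0 \<le> stat (\<lambda>s. mean n (\<lambda>xs. 1))"
      unfolding F_def by (intro stat_mono) (simp, intro mean_mono, simp)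
    then show ?case using th0 by (simp add: mean_const stat_const)
  next
    case (Suc k)
    have "F (Suc k) \<le> (1 - c') * ((1 - c') ^ k + \<theta>) + c' * \<theta>"
      using step[of k] mult_left_mono[OF Suc, of "1 - c'"] c'1 by simp
    then show ?case by (simp add: algebra_simps)
  qed
  moreover have "(1 - c') ^ k \<le> (1 - c) ^ k"
    using good c'1 by (intro power_mono) (auto simp: c'_def)
  ultimately show ?thesis unfolding F_def by linarith
qed

text \<open>
  The bound is required for all initial states at once, so that the event depends on the moves only.
\<close>

definition drains :: "nat \<Rightarrow> nat option list \<Rightarrow> bool" where
  "drains d ys \<longleftrightarrow> (\<forall>s. finite s \<longrightarrow> 0 \<notin> s \<longrightarrow> card (run ys s) \<le> card s - d)"

lemma drains_append: "drains a xs \<Longrightarrow> drains b ys \<Longrightarrow> drains (a + b) (xs @ ys)"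
  unfolding drains_def run_append
proof (intro allI impI)
  fix s :: "nat set"
  assume *: "\<forall>s. finite s \<longrightarrow> 0 \<notin> s \<longrightarrow> card (run xs s) \<le> card s - a"
    "\<forall>s. finite s \<longrightarrow> 0 \<notin> s \<longrightarrow> card (run ys s) \<le> card s - b" "finite s" "0 \<notin> s"
  then have "card (run ys (run xs s)) \<le> card (run xs s) - b"
    using run_finite_zero[of s xs] by blast
  also have "\<dots> \<le> card s - a - b" using *(1,3,4) by (intro diff_le_mono) blast
  finally show "card (run ys (run xs s)) \<le> card s - (a + b)" by simp
qed

lemma card_hop_zero:
  assumes "finite s" "0 \<notin> s" shows "card (hop 0 s) = card s - 1"
proof -
  obtain r where r: "s \<subseteq> {..r}" using assms(1) finite_nat_iff_bounded_le by blast
  then have "hop 0 s \<subseteq> {..r}" by (auto simp: hop_def split: if_splits)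
  then show ?thesis using cnt_hop_zero[OF assms, of r] r by (simp add: Int_absorb2)
qed

lemma run_replicate_None: "set xs \<subseteq> {None} \<Longrightarrow> run xs s = s"
  by (induction xs) auto

lemma mean_all_None: "mean n (\<lambda>xs. of_bool (set xs \<subseteq> {None})) \<ge> (move_prob None) ^ n"
proof (induction n)
  case (Suc n)
  have "mean (Suc n) (\<lambda>xs. of_bool (set xs \<subseteq> {None})) \<ge>
     move_prob None * mean n (\<lambda>xs. of_bool (set xs \<subseteq> {None}))"
    unfolding iid_mean.simps sum_moves
    by (simp add: sum_nonneg mult_nonneg_nonneg move_prob_nonneg iid_mean_nonneg)
  moreover have "move_prob None * mean n (\<lambda>xs. of_bool (set xs \<subseteq> {None})) \<ge> move_prob None * move_prob None ^ n"
    using Suc by (intro mult_left_mono move_prob_nonneg)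
  ultimately show ?case by simp
qed simp

lemma mean_drains_one: "mean n (\<lambda>ys. of_bool (drains 1 ys)) \<ge> n * q * (move_prob None) ^ (n - 1)"
proof (induction n)
  case (Suc n)
  let ?w = "move_prob None"
  have "mean (Suc n) (\<lambda>ys. of_bool (drains 1 ys)) \<ge>
     ?w * mean n (\<lambda>xs. of_bool (drains 1 (None # xs))) + q * mean n (\<lambda>xs. of_bool (drains 1 (Some 0 # xs)))"
  proof -
    have "q * mean n (\<lambda>xs. of_bool (drains 1 (Some 0 # xs))) \<le>
       (\<Sum>j\<le>m. move_prob (Some j) * mean n (\<lambda>xs. of_bool (drains 1 (Some j # xs))))"
      using member_le_sum[of 0 "{..m}" "\<lambda>j. move_prob (Some j) * mean n (\<lambda>xs. of_bool (drains 1 (Some j # xs)))"]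
      by (simp add: mult_nonneg_nonneg move_prob_nonneg iid_mean_nonneg) (simp add: move_prob_def)
    then show ?thesis unfolding iid_mean.simps sum_moves by simp
  qed
  moreover have "mean n (\<lambda>xs. of_bool (drains 1 (None # xs))) = mean n (\<lambda>xs. of_bool (drains 1 xs))"
    by (simp add: drains_def)
  moreover have "mean n (\<lambda>xs. of_bool (set xs \<subseteq> {None})) \<le> mean n (\<lambda>xs. of_bool (drains 1 (Some 0 # xs)))"
    by (intro mean_mono) (auto simp: drains_def run_replicate_None card_hop_zero)
  then have "q * ?w ^ n \<le> q * mean n (\<lambda>xs. of_bool (drains 1 (Some 0 # xs)))"
    using mean_all_None[of n] q_pos by (intro mult_left_mono) auto
  moreover have "?w * (n * q * ?w ^ (n - 1)) \<le> ?w * mean n (\<lambda>xs. of_bool (drains 1 xs))"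
    using Suc by (intro mult_left_mono move_prob_nonneg)
  moreover have "?w * (n * q * ?w ^ (n - 1)) + q * ?w ^ n = real (Suc n) * q * ?w ^ n"
    by (cases n) (auto simp: algebra_simps)
  ultimately show ?case by simp
qed simp

lemma mean_drains:
  assumes "c \<le> mean b (\<lambda>ys. of_bool (drains 1 ys))" "0 \<le> c"
  shows "c ^ d \<le> mean (d * b) (\<lambda>ys. of_bool (drains d ys))"
proof (induction d)
  case 0
  have "drains 0 []" by (simp add: drains_def)
  then show ?case by simp
next
  case (Suc d)
  have "c ^ Suc d \<le> mean b (\<lambda>ys. of_bool (drains 1 ys)) * mean (d * b) (\<lambda>ys. of_bool (drains d ys))"
    using assms Suc by (simp add: mult_mono)
  also have "\<dots> = mean b (\<lambda>xs. mean (d * b) (\<lambda>ys. of_bool (drains d ys)) * of_bool (drains 1 xs))"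
    by (subst iid_mean_cmult) (rule mult.commute)
  also have "\<dots> = mean b (\<lambda>xs. mean (d * b) (\<lambda>ys. of_bool (drains 1 xs) * of_bool (drains d ys)))"
    by (simp only: iid_mean_cmult[of moves move_prob "d * b"]) (simp only: mult.commute)
  also have "\<dots> \<le> mean b (\<lambda>xs. mean (d * b) (\<lambda>ys. of_bool (drains (Suc d) (xs @ ys))))"
    by (intro mean_mono) (use drains_append[of 1 _ d] in auto)
  also have "\<dots> = mean (Suc d * b) (\<lambda>ys. of_bool (drains (Suc d) ys))"
    using iid_mean_add[of moves move_prob b "d * b" "\<lambda>ys. of_bool (drains (Suc d) ys)"] by simp
  finally show ?case .
qed

lemma drains_empty:
  assumes "drains d ys" "finite s" "0 \<notin> s" "card s \<le> d"
  shows "run ys s = {}"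
proof -
  have "card (run ys s) = 0" using assms unfolding drains_def by fastforce
  then show ?thesis using run_finite_zero[OF assms(2,3)] by simp
qed

lemma finite_state: "s \<subseteq> {1..m} \<Longrightarrow> finite s \<and> 0 \<notin> s"
  using finite_subset[of s "{1..m}"] by auto

lemma coupling_empty_start:
  fixes h :: "nat \<Rightarrow> real"
  assumes c: "c \<le> mean b (\<lambda>ys. of_bool (drains 1 ys))" "0 \<le> c"
    and tail: "stat (\<lambda>s. of_bool (d < card s)) \<le> \<theta>"
    and h: "\<And>k. 0 \<le> h k" "\<And>k. h k \<le> 1"
  shows "\<bar>mean (n + k * (d * b)) (\<lambda>xs. h (card (run xs {}))) - stat (\<lambda>s. h (card s))\<bar> \<le> (1 - c ^ d) ^ k + \<theta>"
proof -
  let ?N = "n + k * (d * b)"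
  have "stat (\<lambda>s. mean (n + k * (d * b)) (\<lambda>xs. of_bool (run xs s \<noteq> run xs {}))) \<le> (1 - c ^ d) ^ k + \<theta>"
  proof (rule coupling_mass[OF mean_drains[OF c] _ tail, where Q = "\<lambda>_ s xs. run xs s \<noteq> run xs {}"])
    fix s xs ys
    assume s: "s \<subseteq> {1..m}" and ne: "run (xs @ ys) s \<noteq> run (xs @ ys) {}"
    have f: "finite s" "0 \<notin> s" using finite_state[OF s] by auto
    have "run xs s \<noteq> run xs {}" using ne by (auto simp: run_append)
    moreover have False if "card (run xs s) \<le> d" "drains d ys"
      using ne drains_empty[OF that(2), of "run xs s"] drains_empty[OF that(2), of "run xs {}"]
        that(1) run_empty_card_le[OF f, of xs] run_finite_zero[OF f, of xs] run_finite_zero[of "{}" xs]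
      by (auto simp: run_append)
    ultimately show "run xs s \<noteq> run xs {} \<and> \<not> (card (run xs s) \<le> d \<and> drains d ys)" by blast
  qed (use c in auto)
  moreover have eq: "mean ?N (\<lambda>xs. h (card (run xs {}))) - stat (\<lambda>s. h (card s)) =
     stat (\<lambda>s. mean ?N (\<lambda>xs. h (card (run xs {})) - h (card (run xs s))))"
    by (simp only: iid_mean_minus stat_minus stat_const) (simp only: stat_run[of ?N "\<lambda>s. h (card s)"])
  moreover have "stat (\<lambda>s. mean ?N (\<lambda>xs. h (card (run xs {})) - h (card (run xs s)))) \<le>
      stat (\<lambda>s. mean ?N (\<lambda>xs. of_bool (run xs s \<noteq> run xs {})))"
  proof (intro stat_mono mean_mono)
    fix s xs show "h (card (run xs {})) - h (card (run xs s)) \<le> of_bool (run xs s \<noteq> run xs {})"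
      using h(2)[of "card (run xs {})"] h(1)[of "card (run xs s)"] by (cases "run xs s = run xs {}") auto
  qed
  moreover have "stat (\<lambda>s. mean ?N (\<lambda>xs. (-1) * of_bool (run xs s \<noteq> run xs {}))) \<le>
      stat (\<lambda>s. mean ?N (\<lambda>xs. h (card (run xs {})) - h (card (run xs s))))"
  proof (intro stat_mono mean_mono)
    fix s xs show "(-1) * of_bool (run xs s \<noteq> run xs {}) \<le> h (card (run xs {})) - h (card (run xs s))"
      using h(1)[of "card (run xs {})"] h(2)[of "card (run xs s)"] by (cases "run xs s = run xs {}") auto
  qed
  then have "- stat (\<lambda>s. mean ?N (\<lambda>xs. of_bool (run xs s \<noteq> run xs {}))) \<le>
      stat (\<lambda>s. mean ?N (\<lambda>xs. h (card (run xs {})) - h (card (run xs s))))"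
    by (simp only: iid_mean_cmult stat_cmult)
  ultimately show ?thesis by linarith
qed

lemma nonempty_persistent:
  assumes c: "c \<le> mean b (\<lambda>ys. of_bool (drains 1 ys))" "0 \<le> c"
    and tail: "stat (\<lambda>s. of_bool (d < card s)) \<le> \<theta>"
  shows "mean (n + k * (d * b)) (\<lambda>xs. of_bool (\<forall>j\<le>k. run (take (n + j * (d * b)) xs) {} \<noteq> {}))
     \<le> (1 - c ^ d) ^ k + \<theta>"
proof -
  let ?Q = "\<lambda>k (s::nat set) xs. \<forall>j\<le>k. run (take (n + j * (d * b)) xs) {} \<noteq> {}"
  have "stat (\<lambda>s. mean (n + k * (d * b)) (\<lambda>xs. of_bool (?Q k s xs))) \<le> (1 - c ^ d) ^ k + \<theta>"
  proof (rule coupling_mass[OF mean_drains[OF c] _ tail, where Q = ?Q])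
    fix k s and xs ys :: "nat option list"
    assume s: "s \<subseteq> {1..m}" and len: "length xs = n + k * (d * b)" "length ys = d * b"
      and Q: "?Q (Suc k) s (xs @ ys)"
    have f: "finite s" "0 \<notin> s" using finite_state[OF s] by auto
    have "run (take (n + j * (d * b)) xs) {} \<noteq> {}" if "j \<le> k" for j
    proof -
      have "n + j * (d * b) \<le> length xs" using that len by simp
      then show ?thesis using Q[rule_format, of j] that by simp
    qed
    moreover have False if "card (run xs s) \<le> d" "drains d ys"
    proof -
      have "take (n + Suc k * (d * b)) (xs @ ys) = xs @ ys" using len by simp
      then have "run ys (run xs {}) \<noteq> {}" using Q[rule_format, of "Suc k"] by (simp add: run_append)
      then show False using drains_empty[OF that(2), of "run xs {}"] that(1)
          run_empty_card_le[OF f, of xs] run_finite_zero[of "{}" xs] by auto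
    qed
    ultimately show "?Q k s xs \<and> \<not> (card (run xs s) \<le> d \<and> drains d ys)" by blast
  qed (use c in auto)
  then show ?thesis by (simp only: stat_const)
qed

end

section \<open>Last passage times on a fine grid\<close>

lemma last_passage_finite:
  assumes "finite (P \<inter> ({z<..x} \<times> {0<..t}))"
  shows "finite {card C | C. finite C \<and> C \<subseteq> P \<inter> ({z<..x} \<times> {0<..t}) \<and> increasing_chain C}"
proof -
  have "{card C | C. finite C \<and> C \<subseteq> P \<inter> ({z<..x} \<times> {0<..t}) \<and> increasing_chain C}
      \<subseteq> card ` Pow (P \<inter> ({z<..x} \<times> {0<..t}))" by auto
  then show ?thesis using assms finite_subset by blast
qed

lemma last_passage_ge:
  assumes "finite (P \<inter> ({z<..x} \<times> {0<..t}))"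
    and "C \<subseteq> P \<inter> ({z<..x} \<times> {0<..t})" "increasing_chain C"
  shows "card C \<le> last_passage P z x t"
proof -
  have "finite C" using assms(1,2) finite_subset by blast
  then have "card C \<in> {card C | C. finite C \<and> C \<subseteq> P \<inter> ({z<..x} \<times> {0<..t}) \<and> increasing_chain C}"
    using assms(2,3) by blast
  then show ?thesis
    unfolding last_passage_def by (intro Max_ge last_passage_finite[OF assms(1)])
qed

lemma last_passage_witness:
  assumes "finite (P \<inter> ({z<..x} \<times> {0<..t}))"
  obtains C where "finite C" "C \<subseteq> P \<inter> ({z<..x} \<times> {0<..t})" "increasing_chain C"
    "card C = last_passage P z x t"
proof -
  have "card {} \<in> {card C | C. finite C \<and> C \<subseteq> P \<inter> ({z<..x} \<times> {0<..t}) \<and> increasing_chain C}"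
    by (intro CollectI exI[of _ "{}"]) (auto simp: increasing_chain_def)
  then have "last_passage P z x t \<in>
      {card C | C. finite C \<and> C \<subseteq> P \<inter> ({z<..x} \<times> {0<..t}) \<and> increasing_chain C}"
    unfolding last_passage_def using last_passage_finite[OF assms] by (intro Max_in) auto
  then obtain C where "finite C" "C \<subseteq> P \<inter> ({z<..x} \<times> {0<..t})" "increasing_chain C"
    "last_passage P z x t = card C" by blast
  then show thesis using that[of C] by simp
qed

lemma last_passage_le:
  assumes "finite (P \<inter> ({z<..x} \<times> {0<..t}))"
    and "\<And>C. \<lbrakk>finite C; C \<subseteq> P \<inter> ({z<..x} \<times> {0<..t}); increasing_chain C\<rbrakk> \<Longrightarrow> card C \<le> k"
  shows "last_passage P z x t \<le> k"
  using last_passage_witness[OF assms(1)] assms(2) by metis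

lemma last_passage_mono:
  assumes "finite (P' \<inter> ({z'<..x'} \<times> {0<..t'}))"
    and "P \<inter> ({z<..x} \<times> {0<..t}) \<subseteq> P' \<inter> ({z'<..x'} \<times> {0<..t'})"
  shows "last_passage P z x t \<le> last_passage P' z' x' t'"
proof (rule last_passage_le)
  show "finite (P \<inter> ({z<..x} \<times> {0<..t}))" using assms(2,1) by (rule finite_subset)
  fix C assume "C \<subseteq> P \<inter> ({z<..x} \<times> {0<..t})" "increasing_chain C"
  then show "card C \<le> last_passage P' z' x' t'"
    using assms(2) by (intro last_passage_ge[OF assms(1)]) blast+
qed

lemma last_passage_empty:
  "P \<inter> ({z<..x} \<times> {0<..t}) = {} \<Longrightarrow> last_passage P z x t = 0"
  using last_passage_le[of P z x t 0] by auto

lemma last_passage_cong: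
  "P \<inter> ({z<..x} \<times> {0<..t}) = P' \<inter> ({z'<..x'} \<times> {0<..t'}) \<Longrightarrow>
   last_passage P z x t = last_passage P' z' x' t'"
  unfolding last_passage_def by simp

lemma increasing_chain_subset: "increasing_chain C \<Longrightarrow> D \<subseteq> C \<Longrightarrow> increasing_chain D"
  unfolding increasing_chain_def by blast

text \<open>
  A single point \<open>(u, v)\<close> in the strip to the right of \<open>x\<close> can only be the last point of a chain.
  The points before it lie below \<open>v\<close>, hence below \<open>t0\<close>, because there is no other point in the time
  slab that contains \<open>v\<close>.
\<close>

lemma last_passage_extend:
  assumes zx: "z \<le> x" "x \<le> x'"
    and fin: "finite (P \<inter> ({z<..x'} \<times> {0<..t}))"
    and new: "P \<inter> ({x<..x'} \<times> {0<..t}) = {(u, v)}"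
    and gap: "P \<inter> ({z<..x} \<times> {t0<..t1}) = {}" "0 \<le> t0" "t0 < v" "v \<le> t1" "t1 \<le> t"
  shows "last_passage P z x' t = max (last_passage P z x t) (Suc (last_passage P z x t0))"
proof (rule antisym)
  have "(u, v) \<in> P \<inter> ({x<..x'} \<times> {0<..t})" unfolding new by simp
  then have uv: "(u, v) \<in> P" "x < u" "u \<le> x'" "0 < v" "v \<le> t" by auto
  have fin1: "finite (P \<inter> ({z<..x} \<times> {0<..t}))" and fin0: "finite (P \<inter> ({z<..x} \<times> {0<..t0}))"
    by (rule finite_subset[OF _ fin]; use zx gap in auto)+
  show "last_passage P z x' t \<le> max (last_passage P z x t) (Suc (last_passage P z x t0))"
  proof (rule last_passage_le[OF fin])
    fix C assume C: "finite C" "C \<subseteq> P \<inter> ({z<..x'} \<times> {0<..t})" "increasing_chain C"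
    have old: "p \<in> P \<inter> ({z<..x} \<times> {0<..t})" if "p \<in> C" "p \<noteq> (u, v)" for p
    proof -
      have "p \<in> P \<inter> ({z<..x'} \<times> {0<..t})" using that C by auto
      moreover have "p \<notin> P \<inter> ({x<..x'} \<times> {0<..t})" using that new by auto
      ultimately show ?thesis by (cases p) auto
    qed
    show "card C \<le> max (last_passage P z x t) (Suc (last_passage P z x t0))"
    proof (cases "(u, v) \<in> C")
      case False
      have "C \<subseteq> P \<inter> ({z<..x} \<times> {0<..t})"
      proof
        fix p assume "p \<in> C"
        then show "p \<in> P \<inter> ({z<..x} \<times> {0<..t})" using old[of p] False by blast
      qed
      then show ?thesis using last_passage_ge[OF fin1 _ C(3)] by (simp add: max.coboundedI1)
    next
      case True
      have "p \<in> P \<inter> ({z<..x} \<times> {0<..t0})" if p: "p \<in> C - {(u, v)}" for p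
      proof -
        have o: "p \<in> P \<inter> ({z<..x} \<times> {0<..t})" using old p by auto
        have "(fst p < u \<and> snd p < v) \<or> (u < fst p \<and> v < snd p)"
          using C(3)[unfolded increasing_chain_def, rule_format, of p "(u, v)"] True p by auto
        then have "snd p < v" using o uv by auto
        moreover have "p \<notin> P \<inter> ({z<..x} \<times> {t0<..t1})" using gap by simp
        ultimately show ?thesis using o gap by (cases p) auto
      qed
      then have "card (C - {(u, v)}) \<le> last_passage P z x t0"
        by (intro last_passage_ge[OF fin0] increasing_chain_subset[OF C(3)]) auto
      moreover have "card C = Suc (card (C - {(u, v)}))" using True C(1) by (metis card_Suc_Diff1)
      ultimately show ?thesis by simp
    qed
  qed
  obtain C where C: "finite C" "C \<subseteq> P \<inter> ({z<..x} \<times> {0<..t0})" "increasing_chain C"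
    "card C = last_passage P z x t0" using last_passage_witness[OF fin0] by metis
  have before: "fst p < u \<and> snd p < v" if "p \<in> C" for p
  proof -
    have "p \<in> {z<..x} \<times> {0<..t0}" using C(2) that by auto
    then show ?thesis using uv gap by (cases p) auto
  qed
  have "insert (u, v) C \<subseteq> P \<inter> ({z<..x'} \<times> {0<..t})"
  proof -
    have "C \<subseteq> P \<inter> ({z<..x'} \<times> {0<..t})" using C(2) zx gap by fastforce
    then show ?thesis using uv zx by auto
  qed
  moreover have "increasing_chain (insert (u, v) C)"
    unfolding increasing_chain_def
  proof (intro ballI impI)
    fix p q assume "p \<in> insert (u, v) C" "q \<in> insert (u, v) C" "p \<noteq> q"
    then consider "p = (u, v)" "q \<in> C" | "q = (u, v)" "p \<in> C" | "p \<in> C" "q \<in> C" by auto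
    then show "(fst p < fst q \<and> snd p < snd q) \<or> (fst q < fst p \<and> snd q < snd p)"
    proof cases
      case 3
      then show ?thesis using C(3) \<open>p \<noteq> q\<close> unfolding increasing_chain_def by blast
    qed (use before in auto)
  qed
  ultimately have "card (insert (u, v) C) \<le> last_passage P z x' t" by (rule last_passage_ge[OF fin])
  moreover have "(u, v) \<notin> C" using before[of "(u, v)"] by auto
  ultimately have "Suc (last_passage P z x t0) \<le> last_passage P z x' t" using C by simp
  moreover have "last_passage P z x t \<le> last_passage P z x' t"
    using fin by (rule last_passage_mono) (use zx in auto)
  ultimately show "max (last_passage P z x t) (Suc (last_passage P z x t0)) \<le> last_passage P z x' t"
    by simp
qed

text \<open>
  The level \<open>k\<close> is the maximum over \<open>z \<in> {a..x}\<close> of \<open>L((z,0),(x,t)) - N(z,x]\<close>. It is at least \<open>0\<close>,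
  the value at \<open>z = x\<close>, and is stated without subtraction of natural numbers.
\<close>

definition excess_level :: "real set \<Rightarrow> (real \<times> real) set \<Rightarrow> real \<Rightarrow> real \<Rightarrow> real \<Rightarrow> nat \<Rightarrow> bool" where
  "excess_level N P a x t k \<longleftrightarrow>
     (\<forall>z\<in>{a..x}. last_passage P z x t \<le> card (N \<inter> {z<..x}) + k) \<and>
     (\<exists>z\<in>{a..x}. last_passage P z x t = card (N \<inter> {z<..x}) + k)"

lemma excess_level_start: "excess_level N P a a t 0"
  unfolding excess_level_def by (simp add: last_passage_empty)

lemma Int_extend_empty:
  fixes z :: real
  shows "z \<le> x \<Longrightarrow> x \<le> x' \<Longrightarrow> N \<inter> {x<..x'} = {} \<Longrightarrow> N \<inter> {z<..x'} = N \<inter> {z<..x}"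
  by (auto simp: disjoint_iff)

lemma last_passage_extend_empty:
  assumes "x \<le> x'" "P \<inter> ({x<..x'} \<times> {0<..t}) = {}"
  shows "z \<le> x \<Longrightarrow> last_passage P z x' t = last_passage P z x t"
    and "x < z \<Longrightarrow> last_passage P z x' t = 0"
proof -
  assume z: "z \<le> x"
  have "{z<..x'} \<times> {0<..t} = {z<..x} \<times> {0<..t} \<union> {x<..x'} \<times> {0<..t}" using z assms(1) by auto
  then show "last_passage P z x' t = last_passage P z x t"
    using assms(2) by (intro last_passage_cong) blast
qed (use assms in \<open>auto intro!: last_passage_empty simp: disjoint_iff\<close>)

lemma excess_level_idle:
  assumes "excess_level N P a x t k" "x \<le> x'"
    and "N \<inter> {x<..x'} = {}" "P \<inter> ({x<..x'} \<times> {0<..t}) = {}"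
  shows "excess_level N P a x' t k"
proof -
  note N = Int_extend_empty[OF _ assms(2,3)]
  note L = last_passage_extend_empty(1)[OF assms(2,4)] and L0 = last_passage_extend_empty(2)[OF assms(2,4)]
  show ?thesis
    unfolding excess_level_def
  proof (intro conjI ballI)
    fix z assume z: "z \<in> {a..x'}"
    show "last_passage P z x' t \<le> card (N \<inter> {z<..x'}) + k"
      using assms(1) z N L L0 unfolding excess_level_def by (cases "z \<le> x") auto
  next
    obtain z where "z \<in> {a..x}" "last_passage P z x t = card (N \<inter> {z<..x}) + k"
      using assms(1) unfolding excess_level_def by blast
    then show "\<exists>z\<in>{a..x'}. last_passage P z x' t = card (N \<inter> {z<..x'}) + k"
      using assms(2) N[of z] L[of z] by (intro bexI[of _ z]) auto
  qed
qed

text \<open>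
  A point of \<open>N\<close> lowers all competitors with \<open>z \<le> x\<close> by one, but the new competitor \<open>z = x'\<close> keeps
  the maximum nonnegative; natural subtraction expresses this.
\<close>

lemma excess_level_service:
  assumes "excess_level N P a x t k" "a \<le> x" "x \<le> x'" "finite (N \<inter> {a<..x'})"
    and "N \<inter> {x<..x'} = {p}" "P \<inter> ({x<..x'} \<times> {0<..t}) = {}"
  shows "excess_level N P a x' t (k - 1)"
proof -
  have N: "card (N \<inter> {z<..x'}) = Suc (card (N \<inter> {z<..x}))" if "z \<le> x" "a \<le> z" for z
  proof -
    have "N \<inter> {z<..x'} = (N \<inter> {z<..x}) \<union> (N \<inter> {x<..x'})" using that assms(3) by auto
    also have "\<dots> = insert p (N \<inter> {z<..x})" using assms(5) by auto
    finally have eq: "N \<inter> {z<..x'} = insert p (N \<inter> {z<..x})" .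
    have "finite (N \<inter> {z<..x})" by (rule finite_subset[OF _ assms(4)]) (use that assms in auto)
    moreover have "p \<in> N \<inter> {x<..x'}" unfolding assms(5) by simp
    then have "p \<notin> N \<inter> {z<..x}" by auto
    ultimately show ?thesis unfolding eq by simp
  qed
  note L = last_passage_extend_empty(1)[OF assms(3,6)] and L0 = last_passage_extend_empty(2)[OF assms(3,6)]
  have up: "last_passage P z x' t \<le> card (N \<inter> {z<..x'}) + (k - 1)" if z: "z \<in> {a..x'}" for z
  proof (cases "z \<le> x")
    case True
    then have "last_passage P z x t \<le> card (N \<inter> {z<..x}) + k"
      using assms(1) z unfolding excess_level_def by auto
    then show ?thesis using N[OF True] L[OF True] z by auto
  qed (use L0 in auto)
  obtain z where z: "z \<in> {a..x}" "last_passage P z x t = card (N \<inter> {z<..x}) + k"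
    using assms(1) unfolding excess_level_def by blast
  have "\<exists>z\<in>{a..x'}. last_passage P z x' t = card (N \<inter> {z<..x'}) + (k - 1)"
  proof (cases k)
    case 0
    then show ?thesis using assms(2,3) by (intro bexI[of _ x']) (auto simp: last_passage_empty)
  next
    case (Suc k')
    then show ?thesis using z N[of z] L[of z] assms(3) by (intro bexI[of _ z]) auto
  qed
  then show ?thesis unfolding excess_level_def using up by blast
qed

lemma excess_level_arrival:
  assumes lev: "excess_level N P a x t k" "excess_level N P a x t0 k0"
    and ax: "a \<le> x" "x \<le> x'"
    and fin: "finite (P \<inter> ({a<..x'} \<times> {0<..t}))"
    and N: "N \<inter> {x<..x'} = {}" and new: "P \<inter> ({x<..x'} \<times> {0<..t}) = {(u, v)}"
    and gap: "P \<inter> ({a<..x} \<times> {t0<..t1}) = {}" "0 \<le> t0" "t0 < v" "v \<le> t1" "t1 \<le> t"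
  shows "excess_level N P a x' t (max k (Suc k0))"
proof -
  note N' = Int_extend_empty[OF _ ax(2) N]
  have L: "last_passage P z x' t = max (last_passage P z x t) (Suc (last_passage P z x t0))"
    if "z \<le> x" "a \<le> z" for z
  proof (rule last_passage_extend[OF that(1) ax(2) _ new _ gap(2-5)])
    show "finite (P \<inter> ({z<..x'} \<times> {0<..t}))"
      by (rule finite_subset[OF _ fin]) (use that in auto)
    show "P \<inter> ({z<..x} \<times> {t0<..t1}) = {}" using gap(1) that by (auto simp: disjoint_iff)
  qed
  have L1: "last_passage P z x' t \<le> 1" if "x < z" for z
  proof -
    have sub: "P \<inter> ({z<..x'} \<times> {0<..t}) \<subseteq> {(u, v)}" using that unfolding new[symmetric] by auto
    then have "finite (P \<inter> ({z<..x'} \<times> {0<..t}))" using finite_subset by blast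
    then show ?thesis
    proof (rule last_passage_le)
      fix C assume "C \<subseteq> P \<inter> ({z<..x'} \<times> {0<..t})"
      then have "C \<subseteq> {(u, v)}" using sub by blast
      then show "card C \<le> 1" using card_mono[of "{(u, v)}" C] by simp
    qed
  qed
  have U: "last_passage P z x t \<le> card (N \<inter> {z<..x}) + k"
     "last_passage P z x t0 \<le> card (N \<inter> {z<..x}) + k0" if "z \<in> {a..x}" for z
    using lev that unfolding excess_level_def by auto
  have up: "last_passage P z x' t \<le> card (N \<inter> {z<..x'}) + max k (Suc k0)" if z: "z \<in> {a..x'}" for z
  proof (cases "z \<le> x")
    case True
    then show ?thesis using L[OF True] N'[OF True] U[of z] z by auto
  next
    case False
    then show ?thesis using L1[of z] by simp
  qed
  have "\<exists>z\<in>{a..x'}. last_passage P z x' t = card (N \<inter> {z<..x'}) + max k (Suc k0)"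
  proof (cases "Suc k0 \<le> k")
    case True
    obtain z where z: "z \<in> {a..x}" "last_passage P z x t = card (N \<inter> {z<..x}) + k"
      using lev(1) unfolding excess_level_def by blast
    then show ?thesis using L[of z] N'[of z] U[of z] True ax by (intro bexI[of _ z]) auto
  next
    case False
    obtain z where z: "z \<in> {a..x}" "last_passage P z x t0 = card (N \<inter> {z<..x}) + k0"
      using lev(2) unfolding excess_level_def by blast
    then show ?thesis using L[of z] N'[of z] U[of z] False ax by (intro bexI[of _ z]) auto
  qed
  then show ?thesis unfolding excess_level_def using up by blast
qed

definition strip :: "real \<Rightarrow> real \<Rightarrow> nat \<Rightarrow> real set" where
  "strip a d i = {a + d * real i<..a + d * real (Suc i)}"

text \<open>
  Rows are numbered from \<open>1\<close>, since site \<open>0\<close> of the chain is reserved for deletions.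
\<close>

definition slab :: "real \<Rightarrow> nat \<Rightarrow> real set" where
  "slab e j = {e * real (j - 1)<..e * real j}"

definition cell_count :: "real set \<Rightarrow> (real \<times> real) set \<Rightarrow> real \<Rightarrow> real \<Rightarrow> real \<Rightarrow> nat \<Rightarrow> nat \<Rightarrow> nat" where
  "cell_count N P a d e i j =
     (if j = 0 then card (N \<inter> strip a d i) else card (P \<inter> (strip a d i \<times> slab e j)))"

text \<open>
  Row \<open>0\<close> stands for the points of \<open>N\<close> in the column. A column with more than one point is read
  as empty; this keeps the law of the reading explicit, and such columns are excluded by
  \<open>grid_good\<close>.
\<close>

definition column_move :: "nat \<Rightarrow> (nat \<Rightarrow> nat) \<Rightarrow> nat option" where
  "column_move m c =
     (if \<exists>j\<le>m. c j = 1 \<and> (\<forall>i\<le>m. i \<noteq> j \<longrightarrow> c i = 0) then Some (SOME j. j \<le> m \<and> c j = 1) else None)"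

lemma column_move_eq_Some:
  "column_move m c = Some j \<longleftrightarrow> j \<le> m \<and> c j = 1 \<and> (\<forall>i\<le>m. i \<noteq> j \<longrightarrow> c i = 0)"
proof (cases "\<exists>j\<le>m. c j = 1 \<and> (\<forall>i\<le>m. i \<noteq> j \<longrightarrow> c i = 0)")
  case True
  then obtain k where k: "k \<le> m" "c k = 1" "\<And>i. i \<le> m \<Longrightarrow> i \<noteq> k \<Longrightarrow> c i = 0" by auto
  have "(SOME j. j \<le> m \<and> c j = 1) = k"
  proof (rule some_equality)
    fix i assume "i \<le> m \<and> c i = 1"
    then show "i = k" using k(3)[of i] by (cases "i = k") auto
  qed (use k in simp)
  then have eq: "column_move m c = Some k" using True by (simp add: column_move_def)
  show ?thesis
  proof (cases "j = k")
    case False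
    then show ?thesis using eq k(1,2) by (auto intro!: exI[of _ k])
  qed (use eq k in simp)
next
  case False
  then show ?thesis by (auto simp: column_move_def)
qed

lemma column_move_in: "column_move m c \<in> insert None (Some ` {..m})"
  using column_move_eq_Some[of m c] by (cases "column_move m c") auto

lemma column_move_None:
  assumes "(\<Sum>j\<le>m. c j) \<le> 1" "column_move m c = None" "j \<le> m"
  shows "c j = 0"
proof (rule ccontr)
  assume "c j \<noteq> 0"
  moreover have "(\<Sum>j\<le>m. c j) = c j + (\<Sum>i\<in>{..m} - {j}. c i)"
    using assms(3) by (intro sum.remove) auto
  ultimately have "c j = 1 \<and> (\<Sum>i\<in>{..m} - {j}. c i) = 0" using assms(1) by linarith
  moreover then have "c i = 0" if "i \<le> m" "i \<noteq> j" for i using that by simp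
  ultimately have "column_move m c = Some j" using assms(3) by (simp add: column_move_eq_Some)
  then show False using assms(2) by simp
qed

lemma slab_le_iff:
  assumes "0 < e" "1 \<le> j" "v \<in> slab e j"
  shows "v \<le> e * real r \<longleftrightarrow> j \<le> r"
proof
  assume "v \<le> e * real r"
  then have "e * real (j - 1) < e * real r" using assms(3) by (auto simp: slab_def)
  then show "j \<le> r" using assms(1,2) by (simp add: mult_less_cancel_left_pos)
next
  assume "j \<le> r"
  then have "e * real j \<le> e * real r" using assms(1) by simp
  then show "v \<le> e * real r" using assms(3) by (auto simp: slab_def)
qed

lemma slab_cover:
  assumes "0 < e" "0 < v" "v \<le> e * real m"
  obtains j where "1 \<le> j" "j \<le> m" "v \<in> slab e j"
proof -
  define j where "j = (LEAST j. v \<le> e * real j)"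
  have a: "v \<le> e * real j" unfolding j_def by (rule LeastI[of _ m]) (rule assms)
  have b: "j \<le> m" unfolding j_def by (rule Least_le) (rule assms)
  have c: "1 \<le> j" using a assms(2) by (cases j) auto
  have "\<not> v \<le> e * real (j - 1)" using not_less_Least[of "j - 1" "\<lambda>j. v \<le> e * real j"] c
    unfolding j_def by simp
  then show thesis using that[of j] a b c by (auto simp: slab_def)
qed

definition grid_good :: "real set \<Rightarrow> (real \<times> real) set \<Rightarrow> real \<Rightarrow> real \<Rightarrow> real \<Rightarrow> nat \<Rightarrow> nat \<Rightarrow> bool" where
  "grid_good N P a d e n m \<longleftrightarrow>
     (\<forall>i<n. (\<Sum>j\<le>m. cell_count N P a d e i j) \<le> 1) \<and>
     (\<forall>j\<in>{1..m}. card (P \<inter> ({a<..a + d * real n} \<times> slab e j)) \<le> 1)"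

definition grid_moves :: "real set \<Rightarrow> (real \<times> real) set \<Rightarrow> real \<Rightarrow> real \<Rightarrow> real \<Rightarrow> nat \<Rightarrow> nat \<Rightarrow> nat option list" where
  "grid_moves N P a d e n m = map (\<lambda>i. column_move m (cell_count N P a d e i)) [0..<n]"

text \<open>
  The chain is an exact encoding of the excess levels for all times on the grid: after \<open>i\<close> columns
  the level at the top of row \<open>r\<close> is the number of occupied sites up to \<open>r\<close>.
\<close>

lemma excess_level_grid:
  assumes d: "0 < d" and e: "0 < e"
    and finN: "finite (N \<inter> {a<..a + d * real n})"
    and finP: "finite (P \<inter> ({a<..a + d * real n} \<times> {0<..e * real m}))"
    and good: "grid_good N P a d e n m"
    and i: "i \<le> n" and r: "r \<le> m"
  shows "excess_level N P a (a + d * real i) (e * real r) (cnt (run (grid_moves N P a d e i m) {}) r)"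
  using i r
proof (induction i arbitrary: r)
  case 0
  then show ?case by (simp add: grid_moves_def excess_level_start)
next
  case (Suc i)
  let ?x = "a + d * real i" and ?x' = "a + d * real (Suc i)"
  let ?c = "cell_count N P a d e i"
  let ?s = "run (grid_moves N P a d e i m) {}"
  have IH: "excess_level N P a ?x (e * real r) (cnt ?s r)" if "r \<le> m" for r
    using Suc.IH[of r] Suc.prems that by simp
  have s: "finite ?s" "0 \<notin> ?s" using run_finite_zero[of "{}"] by auto
  have step: "run (grid_moves N P a d e (Suc i) m) {} = chain_step (column_move m ?c) ?s"
    by (simp add: grid_moves_def run_append)
  have x: "a \<le> ?x" "?x \<le> ?x'" "?x' \<le> a + d * real n"
    using d Suc.prems by (auto intro!: mult_left_mono simp del: of_nat_Suc)
  have strip: "strip a d i = {?x<..?x'}" by (simp add: strip_def)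
  have sum1: "(\<Sum>j\<le>m. ?c j) \<le> 1" using good Suc.prems by (auto simp: grid_good_def)
  have er: "e * real r \<le> e * real m" if "r \<le> m" for r using that e by simp
  have finN': "finite (N \<inter> {a<..?x'})" by (rule finite_subset[OF _ finN]) (use x in auto)
  have finP': "finite (P \<inter> ({a<..?x'} \<times> {0<..e * real r}))" if "r \<le> m" for r
    by (rule finite_subset[OF _ finP]) (use x er[OF that] in auto)
  have finNs: "finite (N \<inter> strip a d i)" unfolding strip by (rule finite_subset[OF _ finN']) (use x in auto)
  have slab_sub: "slab e j \<subseteq> {0<..e * real m}" if "j \<le> m" "1 \<le> j" for j
  proof
    fix v assume v: "v \<in> slab e j"
    have "0 \<le> e * real (j - 1)" using e by simp
    then show "v \<in> {0<..e * real m}" using v er[OF that(1)] by (auto simp: slab_def)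
  qed
  have finPs: "finite (P \<inter> (strip a d i \<times> slab e j))" if "j \<le> m" "1 \<le> j" for j
    unfolding strip by (rule finite_subset[OF _ finP'[of m]]) (use x slab_sub[OF that] in auto)
  have N0: "N \<inter> {?x<..?x'} = {}" if "?c 0 = 0"
    using that finNs by (simp add: cell_count_def strip)
  have P0: "P \<inter> (strip a d i \<times> slab e j) = {}" if "?c j = 0" "1 \<le> j" "j \<le> m" for j
    using that finPs[of j] by (simp add: cell_count_def)
  have Pr: "\<exists>j. 1 \<le> j \<and> j \<le> r \<and> j \<le> m \<and> v \<in> slab e j" if vr: "0 < v" "v \<le> e * real r" "r \<le> m" for v r
  proof -
    have "v \<le> e * real m" using er[OF vr(3)] vr by simp
    then obtain j where j: "1 \<le> j" "j \<le> m" "v \<in> slab e j" using slab_cover[OF e vr(1)] by metis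
    then show ?thesis using slab_le_iff[OF e j(1,3), of r] vr by auto
  qed
  show ?case
  proof (cases "column_move m ?c")
    case None
    have z: "?c j = 0" if "j \<le> m" for j using column_move_None[OF sum1 None that] .
    have "P \<inter> ({?x<..?x'} \<times> {0<..e * real r}) = {}"
    proof (safe, goal_cases)
      case (1 u v)
      then obtain j where "1 \<le> j" "j \<le> m" "v \<in> slab e j" using Pr[of v r] Suc.prems by auto
      then show ?case using P0[of j] z[of j] 1 by (auto simp: strip)
    qed
    then show ?thesis
      using excess_level_idle[OF IH[OF Suc.prems(2)] x(2) N0[OF z]] step None by simp
  next
    case (Some j)
    then have j: "j \<le> m" "?c j = 1" and z: "\<And>i. i \<le> m \<Longrightarrow> i \<noteq> j \<Longrightarrow> ?c i = 0"
      using column_move_eq_Some[of m ?c j] by auto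
    show ?thesis
    proof (cases "j = 0")
      case True
      have "card (N \<inter> {?x<..?x'}) = 1" using j True by (simp add: cell_count_def strip)
      then obtain p where p: "N \<inter> {?x<..?x'} = {p}" by (rule card_1_singletonE)
      have "P \<inter> ({?x<..?x'} \<times> {0<..e * real r}) = {}"
      proof (safe, goal_cases)
        case (1 u v)
        then obtain j where "1 \<le> j" "j \<le> m" "v \<in> slab e j" using Pr[of v r] Suc.prems by auto
        then show ?case using P0[of j] z[of j] 1 True by (auto simp: strip)
      qed
      then have "excess_level N P a ?x' (e * real r) (cnt ?s r - 1)"
        using excess_level_service[OF IH[OF Suc.prems(2)] x(1,2) finN' p] by simp
      then show ?thesis using step Some True cnt_hop_zero[OF s, of r] by simp
    next
      case False
      then have j1: "1 \<le> j" by simp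
      have "card (P \<inter> (strip a d i \<times> slab e j)) = 1" using j False by (simp add: cell_count_def)
      then obtain p where "P \<inter> (strip a d i \<times> slab e j) = {p}" by (rule card_1_singletonE)
      then obtain u v where uv: "P \<inter> (strip a d i \<times> slab e j) = {(u, v)}" by (cases p) auto
      then have uvP: "(u, v) \<in> P" "u \<in> strip a d i" "v \<in> slab e j" by auto
      have v0: "0 < v" using slab_sub[OF j(1) j1] uvP by auto
      have Nz: "N \<inter> {?x<..?x'} = {}" using N0 z[of 0] False by simp
      have only: "p = (u, v)" if pin: "p \<in> P \<inter> ({?x<..?x'} \<times> {0<..e * real r})" for p
      proof -
        obtain u' v' where p: "p = (u', v')" by (cases p)
        then obtain k where k: "1 \<le> k" "k \<le> m" "v' \<in> slab e k" using Pr[of v' r] pin Suc.prems by auto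
        then have "p \<in> P \<inter> (strip a d i \<times> slab e k)" using pin p by (auto simp: strip)
        then have "?c k \<noteq> 0" using P0[of k] k(1,2) by (metis empty_iff)
        then have "k = j" using z[of k] k(2) by metis
        then have "p \<in> P \<inter> (strip a d i \<times> slab e j)" using pin p k by (auto simp: strip)
        then show ?thesis using uv by simp
      qed
      show ?thesis
      proof (cases "r < j")
        case True
        then have "\<not> v \<le> e * real r" using slab_le_iff[OF e j1 uvP(3), of r] by simp
        then have "P \<inter> ({?x<..?x'} \<times> {0<..e * real r}) = {}" using only by fastforce
        then show ?thesis
          using excess_level_idle[OF IH[OF Suc.prems(2)] x(2) Nz] step Some True False
            cnt_hop_pos[OF s, of j r] by simp
      next
        case rj: False
        then have "v \<le> e * real r" using slab_le_iff[OF e j1 uvP(3), of r] by simp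
        then have new: "P \<inter> ({?x<..?x'} \<times> {0<..e * real r}) = {(u, v)}"
        proof (intro antisym subsetI)
          fix p assume "p \<in> {(u, v)}"
          then show "p \<in> P \<inter> ({?x<..?x'} \<times> {0<..e * real r})"
            using uvP v0 \<open>v \<le> e * real r\<close> by (simp add: strip)
        qed (use only in blast)
        \<comment> \<open>here the condition on rows enters: the earlier columns have no point in row \<open>j\<close>\<close>
        have gap: "P \<inter> ({a<..?x} \<times> {e * real (j - 1)<..e * real j}) = {}"
        proof (rule ccontr)
          let ?R = "P \<inter> ({a<..a + d * real n} \<times> slab e j)"
          assume "\<not> ?thesis"
          then obtain p where p: "p \<in> P" "p \<in> {a<..?x} \<times> slab e j" unfolding slab_def by auto
          have "fst p \<noteq> u" using p uvP by (auto simp: strip)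
          have "finite ?R" by (rule finite_subset[OF _ finP]) (use slab_sub[OF j(1) j1] in auto)
          moreover have "card ?R \<le> 1" using good j(1) j1 by (auto simp: grid_good_def)
          moreover have "p \<in> ?R" "(u, v) \<in> ?R" using p x uvP by (auto simp: strip)
          ultimately have "p = (u, v)" by (metis card_le_Suc0_iff_eq One_nat_def)
          then show False using \<open>fst p \<noteq> u\<close> by simp
        qed
        have "excess_level N P a ?x' (e * real r) (max (cnt ?s r) (Suc (cnt ?s (j - 1))))"
        proof (rule excess_level_arrival[OF IH[OF Suc.prems(2)] IH x(1,2) finP'[OF Suc.prems(2)] Nz new gap])
          show "e * real j \<le> e * real r" using rj e by simp
        qed (use uvP j e in \<open>auto simp: slab_def\<close>)
        then show ?thesis using step Some rj False cnt_hop_pos[OF s, of j r] by simp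
      qed
    qed
  qed
qed

section \<open>The path of the tagged particle\<close>

text \<open>
  Continuous induction. Trajectories are locally constant on either side of each time, which is
  what the two induction steps ask for; there is no next jump time to induct on, since the jump
  times of all particles together are dense.
\<close>

lemma real_time_induct [consumes 2, case_names start right left]:
  fixes Q :: "real \<Rightarrow> bool"
  assumes t: "0 \<le> t" "t \<le> T"
    and start: "Q 0"
    and right: "\<And>s. 0 \<le> s \<Longrightarrow> s < T \<Longrightarrow> Q s \<Longrightarrow> eventually Q (at_right s)"
    and left: "\<And>s. 0 < s \<Longrightarrow> s \<le> T \<Longrightarrow> (\<And>u. 0 \<le> u \<Longrightarrow> u < s \<Longrightarrow> Q u) \<Longrightarrow> Q s"
  shows "Q t"
proof (rule ccontr)
  assume nt: "\<not> Q t"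
  define S where "S = {s. 0 \<le> s \<and> s \<le> t \<and> \<not> Q s}"
  define i where "i = Inf S"
  have bdd: "bdd_below S" by (auto simp: S_def intro!: bdd_belowI[of _ 0])
  have tS: "t \<in> S" using nt t by (simp add: S_def)
  have lower: "i \<le> s" if "s \<in> S" for s unfolding i_def using that bdd by (rule cInf_lower)
  have "0 \<le> i" unfolding i_def
  proof (rule cInf_greatest)
    show "S \<noteq> {}" using tS by blast
    show "0 \<le> s" if "s \<in> S" for s using that by (simp add: S_def)
  qed
  with lower[OF tS] have i: "0 \<le> i" "i \<le> t" by auto
  have below: "Q u" if "0 \<le> u" "u < i" for u
  proof (rule ccontr)
    assume "\<not> Q u"
    then have "u \<in> S" using that i by (simp add: S_def)
    then show False using lower[of u] that by simp
  qed
  have Qi: "Q i"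
  proof (cases "i = 0")
    case False
    show ?thesis
    proof (rule left)
      show "0 < i" "i \<le> T" using False i t by auto
    qed (rule below)
  qed (use start in simp)
  then have "i < t" using nt i by (cases "i = t") auto
  then have "eventually Q (at_right i)" using i t by (intro right Qi) auto
  then obtain b where b: "i < b" "\<And>u. i < u \<Longrightarrow> u < b \<Longrightarrow> Q u"
    unfolding eventually_at_right_field by blast
  have "b \<le> s" if "s \<in> S" for s
  proof (rule ccontr)
    assume "\<not> b \<le> s"
    moreover have "i \<le> s" using that by (rule lower)
    ultimately have "Q s" using b(2)[of s] Qi by (cases "s = i") auto
    then show False using that by (simp add: S_def)
  qed
  then have "b \<le> i" unfolding i_def using tS by (intro cInf_greatest) auto
  then show False using b by simp
qed

locale hammersley_path =
  fixes \<nu> :: "real set" and P :: "(real \<times> real) set" and X :: "real \<Rightarrow> real \<Rightarrow> real"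
  assumes process: "hammersley_process \<nu> P X"
begin

lemma at_zero: "z \<in> \<nu> \<Longrightarrow> X z 0 = z"
  using process[unfolded hammersley_process_def, THEN conjunct1] by blast

lemma eventually_right: "z \<in> \<nu> \<Longrightarrow> 0 \<le> s \<Longrightarrow> eventually (\<lambda>u. X z u = X z s) (at_right s)"
  using process[unfolded hammersley_process_def, THEN conjunct2, THEN conjunct1] by blast

lemma eventually_left:
  assumes "z \<in> \<nu>" "0 < s"
  shows "eventually (\<lambda>u. X z u = position_before X z s) (at_left s)"
proof -
  obtain a where a: "eventually (\<lambda>u. X z u = a) (at_left s)"
    using process[unfolded hammersley_process_def, THEN conjunct2, THEN conjunct2, THEN conjunct1] assms by blast
  then have "((X z) \<longlongrightarrow> a) (at_left s)" by (rule tendsto_eventually)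
  then have "position_before X z s = a"
    unfolding position_before_def by (intro tendsto_Lim) auto
  then show ?thesis using a by simp
qed

lemma jump: "z \<in> \<nu> \<Longrightarrow> 0 < s \<Longrightarrow> (x, s) \<in> P \<Longrightarrow> nearest_right_before \<nu> X x s z \<Longrightarrow> X z s = x"
  using process[unfolded hammersley_process_def, THEN conjunct2, THEN conjunct2, THEN conjunct2, THEN conjunct1] by blast

lemma no_jump: "z \<in> \<nu> \<Longrightarrow> 0 < s \<Longrightarrow> (\<nexists>x. (x, s) \<in> P \<and> nearest_right_before \<nu> X x s z) \<Longrightarrow>
    X z s = position_before X z s"
  using process[unfolded hammersley_process_def, THEN conjunct2, THEN conjunct2, THEN conjunct2, THEN conjunct2, THEN conjunct1] by blast

lemma count_finite: "0 \<le> s \<Longrightarrow> x < y \<Longrightarrow> finite {z \<in> \<nu>. X z s \<in> {x<..y}}"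
  using process[unfolded hammersley_process_def, THEN conjunct2, THEN conjunct2, THEN conjunct2, THEN conjunct2, THEN conjunct2] by blast

lemma count_eq: "0 \<le> s \<Longrightarrow> x < y \<Longrightarrow> ereal (of_nat (card {z \<in> \<nu>. X z s \<in> {x<..y}})) =
     last_passage_from \<nu> P y s - last_passage_from \<nu> P x s"
  using process[unfolded hammersley_process_def, THEN conjunct2, THEN conjunct2, THEN conjunct2, THEN conjunct2, THEN conjunct2] by blast

lemma jump_left: "z \<in> \<nu> \<Longrightarrow> 0 < s \<Longrightarrow> X z s \<le> position_before X z s"
  using jump[of z s] no_jump[of z s] unfolding nearest_right_before_def
  by (metis less_imp_le order_refl)

lemma left_time:
  fixes s :: real
  assumes "0 < s" "eventually R (at_left s)"
  obtains u where "0 \<le> u" "u < s" "R u"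
proof -
  obtain b where b: "b < s" "\<forall>y>b. y < s \<longrightarrow> R y"
    using assms(2) unfolding eventually_at_left_field by blast
  define u where "u = (max b 0 + s) / 2"
  have "max b 0 < s" using b assms by simp
  then have "max b 0 < u" "u < s" unfolding u_def by (simp_all add: field_simps)
  then show thesis using that[of u] b by auto
qed

lemma moves_left:
  assumes "z \<in> \<nu>" "0 \<le> t"
  shows "X z t \<le> z"
  using assms(2) order_refl
proof (induction rule: real_time_induct)
  case start
  then show ?case using at_zero assms by simp
next
  case (right s)
  show ?case using eventually_right[OF assms(1) right(1)] right(3) by (auto elim: eventually_mono)
next
  case (left s)
  obtain u where "0 \<le> u" "u < s" "X z u = position_before X z s"
    using left_time[OF left(1) eventually_left[OF assms(1) left(1)]] by metis
  then show ?case using left(3)[of u] jump_left[OF assms(1) left(1)] by simp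
qed

lemma order_preserved:
  assumes "z \<in> \<nu>" "w \<in> \<nu>" "z \<le> w" "0 \<le> t"
  shows "X z t \<le> X w t"
  using assms(4) order_refl
proof (induction rule: real_time_induct)
  case start
  then show ?case using at_zero assms by simp
next
  case (right s)
  have "eventually (\<lambda>u. X z u = X z s \<and> X w u = X w s) (at_right s)"
    using eventually_right assms right(1) by (intro eventually_conj) auto
  then show ?case by (rule eventually_mono) (use right(3) in simp)
next
  case (left s)
  let ?p = "position_before X z s" and ?q = "position_before X w s"
  have "eventually (\<lambda>u. X z u = ?p \<and> X w u = ?q) (at_left s)"
    using eventually_left assms left(1) by (intro eventually_conj) auto
  then obtain u where "0 \<le> u" "u < s" "X z u = ?p \<and> X w u = ?q"
    using left_time[OF left(1)] by blast
  then have pq: "?p \<le> ?q" using left(3)[of u] by simp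
  show ?case
  proof (cases "\<exists>x. (x, s) \<in> P \<and> nearest_right_before \<nu> X x s w")
    case False
    then have "X w s = ?q" using no_jump[OF assms(2) left(1)] by blast
    then show ?thesis using jump_left[OF assms(1) left(1)] pq by simp
  next
    case True
    then obtain x where x: "(x, s) \<in> P" "nearest_right_before \<nu> X x s w" by blast
    have w: "X w s = x" using jump[OF assms(2) left(1) x] .
    show ?thesis
    proof (cases "?p \<le> x")
      case True
      then show ?thesis using jump_left[OF assms(1) left(1)] w by simp
    next
      case False
      then have "?q \<le> ?p" using x(2) assms(1) unfolding nearest_right_before_def by auto
      then have "?p = ?q" using pq by simp
      then have "nearest_right_before \<nu> X x s z"
        using x(2) assms(1) unfolding nearest_right_before_def by simp
      then have "X z s = x" using jump[OF assms(1) left(1) x(1)] by blast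
      then show ?thesis using w by simp
    qed
  qed
qed

end

lemma signed_count_split:
  assumes "z \<le> x" "x < 0" "finite (\<nu> \<inter> {z<..0})"
  shows "signed_count \<nu> x = signed_count \<nu> z + int (card (\<nu> \<inter> {z<..x}))"
proof -
  have "\<nu> \<inter> {z<..0} = (\<nu> \<inter> {z<..x}) \<union> (\<nu> \<inter> {x<..0})" using assms by auto
  moreover have "finite (\<nu> \<inter> {z<..x})" "finite (\<nu> \<inter> {x<..0})"
    by (rule finite_subset[OF _ assms(3)]; use assms in auto)+
  ultimately have "card (\<nu> \<inter> {z<..0}) = card (\<nu> \<inter> {z<..x}) + card (\<nu> \<inter> {x<..0})"
    by (metis (no_types, lifting) card_Un_disjoint disjoint_iff Int_iff greaterThanAtMost_iff not_le)
  then show ?thesis using assms by (simp add: signed_count_def)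
qed

text \<open>
  At the point \<open>x\<close> the assumption \<open>quiet\<close> says that the variational formula predicts no crossing up
  to time \<open>t\<close>. Then indeed no particle crosses \<open>x\<close>: as the level at \<open>x\<close> is constant in time, the
  number of particles in \<open>(u', x]\<close> can only decrease, whereas a particle jumping over \<open>x\<close> to
  \<open>u \<le> x\<close> would increase it for \<open>u'\<close> slightly below \<open>u\<close>. Given this, the particles in \<open>(x, y]\<close> at
  time \<open>t\<close> started to the right of \<open>x\<close>. They include all particles started in \<open>(x, 0]\<close> if the tagged
  particle is among them, and only particles started in \<open>(x, 0)\<close> otherwise, so their number decides
  the question.
\<close>

lemma tagged_position_iff:
  assumes hp: "hammersley_process (insert 0 N) P X"
    and finN: "\<And>B. bounded B \<Longrightarrow> finite (N \<inter> B)"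
    and finP: "\<And>B. bounded B \<Longrightarrow> finite (P \<inter> B)"
    and dist: "\<And>u u' s. (u, s) \<in> P \<Longrightarrow> (u', s) \<in> P \<Longrightarrow> u \<le> y \<Longrightarrow> u' \<le> y \<Longrightarrow> s \<le> t \<Longrightarrow> u = u'"
    and y: "y < 0" and t: "0 \<le> t" and xy: "x \<le> y"
    and quiet: "\<And>z. z \<le> x \<Longrightarrow> last_passage P z x t \<le> card (N \<inter> {z<..x})"
  shows "X 0 t \<le> y \<longleftrightarrow> (\<exists>z\<le>y. card (N \<inter> {z<..y}) + card (N \<inter> {y<..<0}) < last_passage P z y t)"
proof -
  define \<nu> where "\<nu> = insert 0 N"
  interpret hammersley_path \<nu> P X by unfold_locales (use hp \<nu>_def in simp)
  have zero: "0 \<in> \<nu>" by (simp add: \<nu>_def)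
  have fin\<nu>: "finite (\<nu> \<inter> {a<..b})" for a b
  proof -
    have "\<nu> \<inter> {a<..b} \<subseteq> insert 0 (N \<inter> {a<..b})" by (auto simp: \<nu>_def)
    moreover have "finite (N \<inter> {a<..b})"
      by (intro finN) simp
    ultimately show ?thesis by (meson finite_insert finite_subset)
  qed
  have finbox: "finite (P \<inter> ({a<..b} \<times> {0<..s}))" for a b s
    by (intro finP bounded_Times) simp_all
  have \<nu>N: "\<nu> \<inter> {z<..w} = N \<inter> {z<..w}" if "w < 0" for z w using that by (auto simp: \<nu>_def)
  have x0: "x < 0" using xy y by simp
  have Lmono: "last_passage P z w s \<le> last_passage P z w s'" if "s \<le> s'" for z w s s'
    using finbox by (rule last_passage_mono) (use that in auto)
  have Fmono: "last_passage_from \<nu> P w s \<le> last_passage_from \<nu> P w s'" if "s \<le> s'" for w s s'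
    unfolding last_passage_from_def
    by (intro SUP_mono') (use Lmono[OF that] in auto)
  have Lx: "last_passage_from \<nu> P x s = ereal (of_int (signed_count \<nu> x))" if "s \<le> t" for s
  proof (rule antisym)
    show "last_passage_from \<nu> P x s \<le> ereal (of_int (signed_count \<nu> x))"
      unfolding last_passage_from_def
    proof (rule SUP_least)
      fix z assume z: "z \<in> {..x}"
      have "last_passage P z x s \<le> card (\<nu> \<inter> {z<..x})"
        using Lmono[OF that, of z x] quiet[of z] z \<nu>N[OF x0, of z] by simp
      moreover have "signed_count \<nu> x = signed_count \<nu> z + int (card (\<nu> \<inter> {z<..x}))"
        by (rule signed_count_split) (use z x0 fin\<nu> in auto)
      ultimately show "ereal (of_int (signed_count \<nu> z) + of_nat (last_passage P z x s))
          \<le> ereal (of_int (signed_count \<nu> x))" by simp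
    qed
    show "ereal (of_int (signed_count \<nu> x)) \<le> last_passage_from \<nu> P x s"
      unfolding last_passage_from_def by (rule SUP_upper2[of x]) auto
  qed
  have count_decr: "card {z \<in> \<nu>. X z s' \<in> {u<..x}} \<le> card {z \<in> \<nu>. X z s \<in> {u<..x}}"
    if "0 \<le> s" "s \<le> s'" "s' \<le> t" "u < x" for s s' u
  proof -
    have "ereal (of_nat (card {z \<in> \<nu>. X z s' \<in> {u<..x}})) \<le> ereal (of_nat (card {z \<in> \<nu>. X z s \<in> {u<..x}}))"
      using count_eq[of s' u x] count_eq[of s u x] that Lx[of s] Lx[of s'] Fmono[of s s' u]
      by (simp add: ereal_minus_mono)
    then show ?thesis by simp
  qed

  \<comment> \<open>particles keep their order, so it suffices to follow the leftmost one to the right of \<open>x\<close>\<close>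
  define w where "w = Min (\<nu> \<inter> {x<..0})"
  have wset: "w \<in> \<nu> \<inter> {x<..0}" unfolding w_def using fin\<nu> zero x0 by (intro Min_in) auto
  then have w: "w \<in> \<nu>" "x < w" "w \<le> 0" by auto
  have wmin: "w \<le> z" if "z \<in> \<nu>" "x < z" for z
  proof (cases "z \<le> 0")
    case True
    then show ?thesis unfolding w_def using fin\<nu> that by (intro Min_le) auto
  qed (use w in auto)
  have w_stays: "x < X w s" if "0 \<le> s" "s \<le> t" for s
    using that
  proof (induction rule: real_time_induct)
    case start
    then show ?case using at_zero w by simp
  next
    case (right s)
    show ?case using eventually_right[OF w(1) right(1)] right(3) by (auto elim: eventually_mono)
  next
    case (left s)
    let ?p = "\<lambda>z. position_before X z s"
    obtain u0 where "0 \<le> u0" "u0 < s" "X w u0 = ?p w"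
      using left_time[OF left(1) eventually_left[OF w(1) left(1)]] by metis
    then have pw: "x < ?p w" using left(3)[of u0] by simp
    show ?case
    proof (rule ccontr)
      assume cross: "\<not> x < X w s"
      then have "X w s \<noteq> ?p w" using pw by auto
      then obtain u where u: "(u, s) \<in> P" "nearest_right_before \<nu> X u s w"
        using no_jump[OF w(1) left(1)] by blast
      have wu: "X w s = u" using jump[OF w(1) left(1) u] .
      have ux: "u \<le> x" using cross wu by simp
      define S where "S = \<nu> \<inter> {u - 1<..x}"
      have finS: "finite S" unfolding S_def by (rule fin\<nu>)
      have S\<nu>: "z \<in> \<nu>" "z \<le> x" if "z \<in> S" for z using that by (auto simp: S_def)
      have pz: "?p z \<le> u" if zS: "z \<in> S" for z
      proof (rule ccontr)
        assume "\<not> ?p z \<le> u"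
        then have "?p w \<le> ?p z" using u(2) S\<nu>[OF that] unfolding nearest_right_before_def by auto
        moreover obtain r where "0 \<le> r" "r < s" "X z r = ?p z"
          using left_time[OF left(1) eventually_left[OF S\<nu>(1)[OF zS] left(1)]] by metis
        then have "?p z \<le> z" using moves_left[OF S\<nu>(1)[OF that], of r] by simp
        ultimately show False using pw S\<nu>(2)[OF that] by simp
      qed
      \<comment> \<open>just before time \<open>s\<close> no particle of \<open>S\<close> is strictly between \<open>u'\<close> and \<open>u\<close>\<close>
      define u' where "u' = Max (insert (u - 1) {?p z | z. z \<in> S \<and> ?p z < u})"
      have finM: "finite (insert (u - 1) {?p z | z. z \<in> S \<and> ?p z < u})" using finS by simp
      have u'1: "u' < u" unfolding u'_def using finM by (subst Max_less_iff) auto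
      have u'2: "u - 1 \<le> u'" unfolding u'_def using finM by (intro Max_ge) auto
      have u'3: "?p z \<le> u'" if "z \<in> S" "?p z < u" for z
        unfolding u'_def using finM that by (intro Max_ge) auto
      \<comment> \<open>particles already sitting at \<open>u\<close> cannot move at time \<open>s\<close>, as \<open>P\<close> has no second point of that time to the left of \<open>y\<close>\<close>
      define T where "T = {z \<in> S. ?p z = u}"
      have "eventually (\<lambda>r. \<forall>z\<in>S. X z r = ?p z) (at_left s)"
        using eventually_left[OF _ left(1)] S\<nu> finS by (intro eventually_ball_finite) auto
      then obtain r where r: "0 \<le> r" "r < s" "\<forall>z\<in>S. X z r = ?p z"
        using left_time[OF left(1)] by blast
      have before: "{z \<in> \<nu>. X z r \<in> {u'<..x}} \<subseteq> T"
      proof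
        fix z assume "z \<in> {z \<in> \<nu>. X z r \<in> {u'<..x}}"
        then have z: "z \<in> \<nu>" "u' < X z r" "X z r \<le> x" by auto
        have "z \<le> x"
        proof (rule ccontr)
          assume "\<not> z \<le> x"
          then have "X w r \<le> X z r" using order_preserved[OF w(1) z(1) wmin[OF z(1)]] r by simp
          then show False using left(3)[OF r(1,2)] z by simp
        qed
        moreover have "u - 1 < z" using moves_left[OF z(1) r(1)] z u'2 by simp
        ultimately have zS: "z \<in> S" using z by (simp add: S_def)
        then have "u' < ?p z" using r z by auto
        then show "z \<in> T" using pz[OF zS] u'3[OF zS] zS by (force simp: T_def)
      qed
      have after: "insert w T \<subseteq> {z \<in> \<nu>. X z s \<in> {u'<..x}}"
      proof -
        have "X z s = u" if "z \<in> T" for z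
        proof (rule ccontr)
          assume ne: "X z s \<noteq> u"
          have zS: "z \<in> S" "?p z = u" using that by (auto simp: T_def)
          then obtain v where v: "(v, s) \<in> P" "nearest_right_before \<nu> X v s z"
            using no_jump[OF S\<nu>(1) left(1)] ne by metis
          then have "v < u" using zS unfolding nearest_right_before_def by simp
          moreover have "v = u"
            by (rule dist[OF v(1) u(1)]) (use calculation ux xy left(2) in auto)
          ultimately show False by simp
        qed
        then show ?thesis using wu ux u'1 w S\<nu> by (auto simp: T_def)
      qed
      have "w \<notin> T" using w(2) S\<nu>(2)[of w] by (auto simp: T_def)
      moreover have "finite T" using finS by (simp add: T_def)
      ultimately have "Suc (card T) = card (insert w T)" by simp
      also have "\<dots> \<le> card {z \<in> \<nu>. X z s \<in> {u'<..x}}"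
        using after left(1) ux u'1 by (intro card_mono count_finite) auto
      also have "\<dots> \<le> card {z \<in> \<nu>. X z r \<in> {u'<..x}}"
        using r left ux u'1 by (intro count_decr) auto
      also have "\<dots> \<le> card T" using before \<open>finite T\<close> by (intro card_mono)
      finally show False by simp
    qed
  qed
  have stays: "x < X z t" if "z \<in> \<nu>" "x < z" for z
    using order_preserved[OF w(1) that(1) wmin[OF that] t] w_stays[OF t order_refl] by simp

  have level: "X 0 t \<le> y \<longleftrightarrow> 0 \<le> last_passage_from \<nu> P y t"
  proof (cases "x = y")
    case True
    have "card (\<nu> \<inter> {x<..0}) > 0" using fin\<nu> zero x0 by (auto simp: card_gt_0_iff)
    then have "\<not> 0 \<le> last_passage_from \<nu> P y t"
      using Lx[OF order_refl] True x0 by (simp add: signed_count_def)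
    then show ?thesis using stays[OF zero x0] True by simp
  next
    case False
    then have xy': "x < y" using xy by simp
    let ?C = "{z \<in> \<nu>. X z t \<in> {x<..y}}"
    have Ly: "ereal (of_nat (card ?C)) = last_passage_from \<nu> P y t - ereal (of_int (signed_count \<nu> x))"
      using count_eq[OF t xy'] Lx[OF order_refl] by simp
    have sx: "of_int (signed_count \<nu> x) = - real (card (\<nu> \<inter> {x<..0}))"
      using x0 by (simp add: signed_count_def)
    have "0 \<le> last_passage_from \<nu> P y t \<longleftrightarrow> card (\<nu> \<inter> {x<..0}) \<le> card ?C"
      using Ly unfolding sx by (cases "last_passage_from \<nu> P y t") auto
    moreover have "X 0 t \<le> y \<longleftrightarrow> card (\<nu> \<inter> {x<..0}) \<le> card ?C"
    proof
      assume le: "X 0 t \<le> y"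
      have "\<nu> \<inter> {x<..0} \<subseteq> ?C"
      proof
        fix z assume "z \<in> \<nu> \<inter> {x<..0}"
        then have z: "z \<in> \<nu>" "x < z" "z \<le> 0" by auto
        have "X z t \<le> X 0 t" using order_preserved[OF z(1) zero z(3) t] .
        then show "z \<in> ?C" using stays[OF z(1,2)] le z(1) by simp
      qed
      then show "card (\<nu> \<inter> {x<..0}) \<le> card ?C" using count_finite[OF t xy'] by (intro card_mono)
    next
      assume c: "card (\<nu> \<inter> {x<..0}) \<le> card ?C"
      show "X 0 t \<le> y"
      proof (rule ccontr)
        assume gt: "\<not> X 0 t \<le> y"
        have "?C \<subseteq> \<nu> \<inter> {x<..0} - {0}"
        proof
          fix z assume "z \<in> ?C"
          then have z: "z \<in> \<nu>" "x < X z t" "X z t \<le> y" by auto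
          have "x < z" using moves_left[OF z(1) t] z by simp
          moreover have "z < 0"
            using order_preserved[OF zero z(1) _ t] z gt by (meson le_less_trans not_le)
          ultimately show "z \<in> \<nu> \<inter> {x<..0} - {0}" using z by auto
        qed
        then have "card ?C \<le> card (\<nu> \<inter> {x<..0} - {0})" using fin\<nu> by (intro card_mono) auto
        also have "\<dots> < card (\<nu> \<inter> {x<..0})" using fin\<nu> zero x0 by (intro card_Diff1_less) auto
        finally show False using c by simp
      qed
    qed
    ultimately show ?thesis by simp
  qed
  also have "\<dots> \<longleftrightarrow> (\<exists>z\<le>y. 0 \<le> signed_count \<nu> z + int (last_passage P z y t))"
  proof
    assume "\<exists>z\<le>y. 0 \<le> signed_count \<nu> z + int (last_passage P z y t)"
    then obtain z where z: "z \<le> y" "0 \<le> signed_count \<nu> z + int (last_passage P z y t)" by blast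
    then have "0 \<le> real_of_int (signed_count \<nu> z + int (last_passage P z y t))" by (simp only: of_int_0_le_iff)
    then show "0 \<le> last_passage_from \<nu> P y t"
      unfolding last_passage_from_def using z(1) by (intro SUP_upper2[of z]) auto
  next
    assume L: "0 \<le> last_passage_from \<nu> P y t"
    show "\<exists>z\<le>y. 0 \<le> signed_count \<nu> z + int (last_passage P z y t)"
    proof (rule ccontr)
      assume none: "\<not> ?thesis"
      have "last_passage_from \<nu> P y t \<le> ereal (- 1)"
        unfolding last_passage_from_def
      proof (rule SUP_least)
        fix z assume "z \<in> {..y}"
        then have "signed_count \<nu> z + int (last_passage P z y t) \<le> - 1" using none by force
        then have "real_of_int (signed_count \<nu> z + int (last_passage P z y t)) \<le> real_of_int (- 1)"
          by (simp only: of_int_le_iff)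
        then show "ereal (of_int (signed_count \<nu> z) + of_nat (last_passage P z y t)) \<le> ereal (- 1)"
          by simp
      qed
      from order_trans[OF L this] show False by simp
    qed
  qed
  also have "\<dots> \<longleftrightarrow> (\<exists>z\<le>y. card (N \<inter> {z<..y}) + card (N \<inter> {y<..<0}) < last_passage P z y t)"
  proof -
    have sc: "signed_count \<nu> z = - int (Suc (card (N \<inter> {z<..y}) + card (N \<inter> {y<..<0})))" if "z \<le> y" for z
    proof -
      have "\<nu> \<inter> {y<..0} = insert 0 (N \<inter> {y<..<0})" using y by (auto simp: \<nu>_def)
      moreover have "finite (N \<inter> {y<..<0})"
        by (intro finN) simp
      ultimately have "card (\<nu> \<inter> {y<..0}) = Suc (card (N \<inter> {y<..<0}))" by simp
      then have "signed_count \<nu> y = - int (Suc (card (N \<inter> {y<..<0})))"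
        using y by (simp add: signed_count_def)
      moreover have "signed_count \<nu> y = signed_count \<nu> z + int (card (\<nu> \<inter> {z<..y}))"
        using that y fin\<nu> by (intro signed_count_split) auto
      ultimately show ?thesis using \<nu>N[OF y, of z] by simp
    qed
    have "0 \<le> signed_count \<nu> z + int (last_passage P z y t) \<longleftrightarrow>
        card (N \<inter> {z<..y}) + card (N \<inter> {y<..<0}) < last_passage P z y t" if "z \<le> y" for z
      unfolding sc[OF that] by linarith
    then show ?thesis by blast
  qed
  finally show ?thesis .
qed

section \<open>Poisson points on a grid\<close>

lemma poisson_two_points_le:
  fixes x :: real
  assumes "0 \<le> x"
  shows "1 - (exp (- x) + x * exp (- x)) \<le> x\<^sup>2"
proof -
  have "1 - x \<le> exp (- x)" using exp_ge_add_one_self[of "- x"] by simp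
  then have "(1 + x) * (1 - x) \<le> (1 + x) * exp (- x)" using assms by (intro mult_left_mono) auto
  then show ?thesis by (simp add: algebra_simps power2_eq_square)
qed

lemma measure_lborel_Times:
  fixes A B :: "real set"
  assumes [measurable]: "A \<in> sets borel" "B \<in> sets borel"
  shows "measure lborel (A \<times> B) = measure lborel A * measure lborel B"
proof -
  have "emeasure (lborel :: (real \<times> real) measure) (A \<times> B) = emeasure lborel A * emeasure lborel B"
    unfolding lborel_prod[symmetric] by (rule lborel.emeasure_pair_measure_Times) auto
  then show ?thesis by (simp add: measure_def enn2real_mult)
qed

locale poisson_input = prob_space M for M :: "'a measure" +
  fixes N :: "'a \<Rightarrow> real set" and P :: "'a \<Rightarrow> (real \<times> real) set" and lam :: real
  assumes lam: "0 < lam"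
    and poisson_N: "poisson_point_process M lam UNIV N"
    and poisson_P: "poisson_point_process M 1 (UNIV \<times> {0<..}) P"
    and indep_NP: "indep_point_processes M UNIV N (UNIV \<times> {0<..}) P"
begin

lemma AE_N_finite: "AE \<omega> in M. \<forall>B. bounded B \<longrightarrow> finite (N \<omega> \<inter> B)"
  using poisson_N unfolding poisson_point_process_def by (auto elim: eventually_mono)

lemma AE_P_finite: "AE \<omega> in M. \<forall>B. bounded B \<longrightarrow> finite (P \<omega> \<inter> B)"
  using poisson_P[unfolded poisson_point_process_def, THEN conjunct1] by (auto elim: eventually_mono)

lemma N_count_measurable:
  "B \<in> sets borel \<Longrightarrow> bounded B \<Longrightarrow> (\<lambda>\<omega>. card (N \<omega> \<inter> B)) \<in> measurable M (count_space UNIV)"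
  using poisson_N[unfolded poisson_point_process_def, THEN conjunct2, THEN conjunct1] by blast

lemma P_count_measurable:
  "B \<in> sets borel \<Longrightarrow> bounded B \<Longrightarrow> B \<subseteq> UNIV \<times> {0<..} \<Longrightarrow>
    (\<lambda>\<omega>. card (P \<omega> \<inter> B)) \<in> measurable M (count_space UNIV)"
  using poisson_P[unfolded poisson_point_process_def, THEN conjunct2, THEN conjunct1] by blast

lemma N_count_prob:
  assumes "B \<in> sets borel" "bounded B"
  shows "prob {\<omega> \<in> space M. card (N \<omega> \<inter> B) = k} =
     (lam * measure lborel B) ^ k / fact k * exp (- (lam * measure lborel B))"
  using poisson_N[unfolded poisson_point_process_def, THEN conjunct2, THEN conjunct1] assms by blast

lemma P_count_prob:
  assumes "B \<in> sets borel" "bounded B" "B \<subseteq> UNIV \<times> {0<..}"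
  shows "prob {\<omega> \<in> space M. card (P \<omega> \<inter> B) = k} =
     (measure lborel B) ^ k / fact k * exp (- (measure lborel B))"
  using poisson_P[unfolded poisson_point_process_def, THEN conjunct2, THEN conjunct1] assms by fastforce

lemma N_counts_indep:
  fixes A :: "nat \<Rightarrow> real set"
  assumes "\<And>i. i < k \<Longrightarrow> A i \<in> sets borel \<and> bounded (A i)" "disjoint_family_on A {..<k}"
  shows "indep_vars (\<lambda>_. count_space UNIV) (\<lambda>i \<omega>. card (N \<omega> \<inter> A i)) {..<k}"
  using poisson_N[unfolded poisson_point_process_def, THEN conjunct2, THEN conjunct2,
      rule_format, of k A] assms by auto

lemma P_counts_indep:
  fixes A :: "nat \<Rightarrow> (real \<times> real) set"
  assumes "\<And>i. i < k \<Longrightarrow> A i \<in> sets borel \<and> bounded (A i) \<and> A i \<subseteq> UNIV \<times> {0<..}"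
    "disjoint_family_on A {..<k}"
  shows "indep_vars (\<lambda>_. count_space UNIV) (\<lambda>i \<omega>. card (P \<omega> \<inter> A i)) {..<k}"
  using poisson_P[unfolded poisson_point_process_def, THEN conjunct2, THEN conjunct2,
      rule_format, of k A] assms by auto

end

lemma sigma_algebra_point_process_events: "sigma_algebra (space M) (point_process_events M S \<eta>)"
  unfolding point_process_events_def by (rule sigma_algebra_sigma_sets) auto

lemma count_event_in_point_process_events:
  assumes "B \<in> sets borel" "bounded B" "B \<subseteq> S"
  shows "(\<lambda>\<omega>. card (\<eta> \<omega> \<inter> B)) -` A \<inter> space M \<in> point_process_events M S \<eta>"
proof -
  have "(\<lambda>\<omega>. card (\<eta> \<omega> \<inter> B)) -` A \<inter> space M = \<Union> ((\<lambda>k. {\<omega> \<in> space M. card (\<eta> \<omega> \<inter> B) = k}) ` A)"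
    by auto
  also have "\<dots> \<in> point_process_events M S \<eta>"
    unfolding point_process_events_def
  proof (rule sigma_sets_UNION)
    fix b assume "b \<in> (\<lambda>k. {\<omega> \<in> space M. card (\<eta> \<omega> \<inter> B) = k}) ` A"
    then show "b \<in> sigma_sets (space M)
       {{\<omega> \<in> space M. card (\<eta> \<omega> \<inter> B) = k} | B k. B \<in> sets borel \<and> bounded B \<and> B \<subseteq> S}"
      using assms by (intro sigma_sets.Basic) auto
  qed auto
  finally show ?thesis .
qed

lemma (in prob_space) indep_vars_Plus:
  fixes U :: "'i \<Rightarrow> 'a \<Rightarrow> 'c" and V :: "'j \<Rightarrow> 'a \<Rightarrow> 'c"
  assumes U: "indep_vars (\<lambda>_. R) U I" and V: "indep_vars (\<lambda>_. R) V J"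
    and FG: "indep_set F G" "sigma_algebra (space M) F" "sigma_algebra (space M) G"
    and UF: "\<And>i A. i \<in> I \<Longrightarrow> A \<in> sets R \<Longrightarrow> U i -` A \<inter> space M \<in> F"
    and VG: "\<And>j A. j \<in> J \<Longrightarrow> A \<in> sets R \<Longrightarrow> V j -` A \<inter> space M \<in> G"
  shows "indep_vars (\<lambda>_. R) (case_sum U V) (I <+> J)"
proof -
  interpret F: sigma_algebra "space M" F by fact
  interpret G: sigma_algebra "space M" G by fact
  let ?W = "case_sum U V"
  let ?E = "\<lambda>X i. {X i -` A \<inter> space M | A. A \<in> sets R}"
  have U1: "\<And>i. i \<in> I \<Longrightarrow> random_variable R (U i)" and U2: "indep_sets (?E U) I"
    using U unfolding indep_vars_def2 by auto
  have V1: "\<And>i. i \<in> J \<Longrightarrow> random_variable R (V i)" and V2: "indep_sets (?E V) J"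
    using V unfolding indep_vars_def2 by auto
  have W1: "random_variable R (?W i)" if "i \<in> I <+> J" for i
    using that U1 V1 by (auto simp: Plus_def)
  have "indep_sets (?E ?W) (I <+> J)"
  proof (rule indep_setsI)
    fix i assume "i \<in> I <+> J"
    then show "?E ?W i \<subseteq> events" using W1[of i] by (auto intro: measurable_sets)
  next
    fix A K assume K: "K \<noteq> {}" "K \<subseteq> I <+> J" "finite K" and A: "\<forall>j\<in>K. A j \<in> ?E ?W j"
    define K1 K2 where "K1 = Inl -` K" and "K2 = Inr -` K"
    have K12: "K = K1 <+> K2" unfolding K1_def K2_def Plus_def
    proof (intro set_eqI iffI)
      fix x assume "x \<in> K" then show "x \<in> Inl ` Inl -` K \<union> Inr ` Inr -` K" by (cases x) auto
    qed auto
    have sub: "K1 \<subseteq> I" "K2 \<subseteq> J" using K(2) by (auto simp: K1_def K2_def)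
    have fin: "finite K1" "finite K2" using K(3) by (auto simp: K1_def K2_def finite_vimageI)
    have "A (Inl j) \<in> ?E U j" if "j \<in> K1" for j
      using A[rule_format, of "Inl j"] that by (simp add: K1_def)
    then have A1: "\<forall>j\<in>K1. A (Inl j) \<in> ?E U j" by blast
    have "A (Inr j) \<in> ?E V j" if "j \<in> K2" for j
      using A[rule_format, of "Inr j"] that by (simp add: K2_def)
    then have A2: "\<forall>j\<in>K2. A (Inr j) \<in> ?E V j" by blast
    have p1: "prob (\<Inter>j\<in>K1. A (Inl j)) = (\<Prod>j\<in>K1. prob (A (Inl j)))" if "K1 \<noteq> {}"
      by (rule indep_setsD[OF U2 sub(1) that fin(1) A1])
    have p2: "prob (\<Inter>j\<in>K2. A (Inr j)) = (\<Prod>j\<in>K2. prob (A (Inr j)))" if "K2 \<noteq> {}"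
      by (rule indep_setsD[OF V2 sub(2) that fin(2) A2])
    have prod: "(\<Prod>j\<in>K. prob (A j)) = (\<Prod>j\<in>K1. prob (A (Inl j))) * (\<Prod>j\<in>K2. prob (A (Inr j)))"
      unfolding K12 using fin by (simp add: prod.Plus)
    have int: "(\<Inter>j\<in>K. A j) = (\<Inter>j\<in>K1. A (Inl j)) \<inter> (\<Inter>j\<in>K2. A (Inr j))"
      unfolding K12 by (auto simp: Plus_def)
    show "prob (\<Inter>j\<in>K. A j) = (\<Prod>j\<in>K. prob (A j))"
    proof (cases "K1 = {} \<or> K2 = {}")
      case True
      then show ?thesis using p1 p2 prod int K(1) K12 by (cases "K1 = {}") auto
    next
      case False
      have "(\<Inter>j\<in>K1. A (Inl j)) \<in> F" using False fin A1 sub UF by (intro F.finite_INT) fastforce+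
      moreover have "(\<Inter>j\<in>K2. A (Inr j)) \<in> G" using False fin A2 sub VG by (intro G.finite_INT) fastforce+
      ultimately have "prob ((\<Inter>j\<in>K1. A (Inl j)) \<inter> (\<Inter>j\<in>K2. A (Inr j))) =
          prob (\<Inter>j\<in>K1. A (Inl j)) * prob (\<Inter>j\<in>K2. A (Inr j))"
        by (rule indep_setD[OF FG(1)])
      then show ?thesis using p1 p2 prod int False by simp
    qed
  qed
  then show ?thesis unfolding indep_vars_def2 using W1 by auto
qed

lemma strip_measurable [measurable]: "strip a d i \<in> sets borel" by (simp add: strip_def)
lemma slab_measurable [measurable]: "slab e j \<in> sets borel" by (simp add: slab_def)
lemma bounded_strip: "bounded (strip a d i)" by (simp add: strip_def)
lemma bounded_slab: "bounded (slab e j)" by (simp add: slab_def)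
lemma cell_measurable [measurable]: "strip a d i \<times> slab e j \<in> sets borel"
  unfolding borel_prod[symmetric] by measurable
lemma measure_strip: "0 < d \<Longrightarrow> measure lborel (strip a d i) = d"
  by (simp add: strip_def algebra_simps)
lemma measure_slab: "0 < e \<Longrightarrow> 1 \<le> j \<Longrightarrow> measure lborel (slab e j) = e"
  by (simp add: slab_def algebra_simps of_nat_diff)
lemma slab_pos: "0 < e \<Longrightarrow> slab e j \<subseteq> {0<..}"
proof
  fix v assume "0 < e" "v \<in> slab e j"
  then have "0 \<le> e * real (j - 1)" "e * real (j - 1) < v" unfolding slab_def by simp_all
  then have "0 < v" by (rule le_less_trans)
  then show "v \<in> {0<..}" by simp
qed

lemma strip_disjoint:
  assumes "0 < d" "i \<noteq> j" shows "strip a d i \<inter> strip a d j = {}"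
proof -
  have *: "strip a d i \<inter> strip a d j = {}" if "i < j" for i j
  proof -
    have "d * real (Suc i) \<le> d * real j" using assms(1) that by (intro mult_left_mono) auto
    then show ?thesis by (auto simp: strip_def)
  qed
  show ?thesis using assms(2) *[of i j] *[of j i] by (cases "i < j") auto
qed

lemma slab_disjoint_family:
  assumes "0 < e" "1 \<le> i" "1 \<le> j" "i \<noteq> j" shows "slab e i \<inter> slab e j = {}"
proof -
  have *: "slab e i \<inter> slab e j = {}" if "i < j" for i j
  proof -
    have "e * real i \<le> e * real (j - 1)" using assms(1) that by (intro mult_left_mono) auto
    then show ?thesis by (auto simp: slab_def)
  qed
  show ?thesis using assms(4) *[of i j] *[of j i] by (cases "i < j") auto
qed

text \<open>
  The window \<open>(a, a + d * n] \<times> (0, e * m]\<close> is cut into \<open>n\<close> columns of width \<open>d\<close> and \<open>m\<close> rows of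
  height \<open>e\<close>. The gap between the window and the origin contains the particles that have to
  cross the right end of the window before the tagged one does.
\<close>

locale poisson_grid = poisson_input +
  fixes a d e :: real and n m :: nat
  assumes d: "0 < d" and e: "0 < e" and right_end: "a + d * real n < 0"
begin

abbreviation cell :: "'a \<Rightarrow> nat \<Rightarrow> nat \<Rightarrow> nat" where
  "cell \<omega> \<equiv> cell_count (N \<omega>) (P \<omega>) a d e"

definition window_N :: "nat \<Rightarrow> real set" where
  "window_N i = (if i < n then strip a d i else {a + d * real n<..<0})"

definition window_P :: "nat \<Rightarrow> (real \<times> real) set" where
  "window_P l = strip a d (l div m) \<times> slab e (Suc (l mod m))"

definition counts :: "nat + nat \<Rightarrow> 'a \<Rightarrow> nat" where
  "counts = case_sum (\<lambda>i \<omega>. card (N \<omega> \<inter> window_N i)) (\<lambda>l \<omega>. card (P \<omega> \<inter> window_P l))"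

text \<open>
  The index sets of the counts that belong to one column; the last group, of index \<open>n\<close>, consists of
  the gap alone.
\<close>

definition group :: "nat \<Rightarrow> (nat + nat) set" where
  "group i = {i} <+> (if i < n then {i * m..<i * m + m} else {})"

lemma window_P_props: "window_P l \<in> sets borel" "bounded (window_P l)" "window_P l \<subseteq> UNIV \<times> {0<..}"
  unfolding window_P_def using slab_pos[OF e]
  by (auto intro!: cell_measurable bounded_Times bounded_strip bounded_slab)

lemma window_N_props: "window_N i \<in> sets borel" "bounded (window_N i)"
  unfolding window_N_def by (auto intro: strip_measurable bounded_strip)

lemma strip_right: "i < n \<Longrightarrow> strip a d i \<subseteq> {..a + d * real n}"
proof
  fix x assume "i < n" "x \<in> strip a d i"
  moreover from \<open>i < n\<close> have "d * real (Suc i) \<le> d * real n" using d by (intro mult_left_mono) auto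
  ultimately show "x \<in> {..a + d * real n}" by (auto simp: strip_def)
qed

lemma counts_indep: "indep_vars (\<lambda>_. count_space UNIV) counts ({..<Suc n} <+> {..<n * m})"
  unfolding counts_def
proof (rule indep_vars_Plus)
  show "indep_vars (\<lambda>_. count_space UNIV) (\<lambda>i \<omega>. card (N \<omega> \<inter> window_N i)) {..<Suc n}"
  proof (rule N_counts_indep)
    show "disjoint_family_on window_N {..<Suc n}"
      unfolding disjoint_family_on_def
    proof (intro ballI impI)
      fix i j assume "i \<in> {..<Suc n}" "j \<in> {..<Suc n}" "i \<noteq> j"
      then consider "i < n" "j < n" | "i < n" "j = n" | "i = n" "j < n" by fastforce
      then show "window_N i \<inter> window_N j = {}"
      proof cases
        case 1
        then show ?thesis using strip_disjoint[OF d \<open>i \<noteq> j\<close>] by (simp add: window_N_def)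
      next
        case 2
        then show ?thesis using strip_right[of i] by (fastforce simp: window_N_def)
      next
        case 3
        then show ?thesis using strip_right[of j] by (fastforce simp: window_N_def)
      qed
    qed
  qed (use window_N_props in blast)
  show "indep_vars (\<lambda>_. count_space UNIV) (\<lambda>l \<omega>. card (P \<omega> \<inter> window_P l)) {..<n * m}"
  proof (rule P_counts_indep)
    show "disjoint_family_on window_P {..<n * m}"
      unfolding disjoint_family_on_def
    proof (intro ballI impI)
      fix i j :: nat assume "i \<noteq> j"
      then have "i div m \<noteq> j div m \<or> i mod m \<noteq> j mod m" by (metis div_mult_mod_eq)
      then show "window_P i \<inter> window_P j = {}"
        using strip_disjoint[OF d, of "i div m" "j div m" a]
          slab_disjoint_family[OF e, of "Suc (i mod m)" "Suc (j mod m)"]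
        unfolding window_P_def by auto
    qed
  qed (use window_P_props in blast)
  show "indep_set (point_process_events M UNIV N) (point_process_events M (UNIV \<times> {0<..}) P)"
    using indep_NP unfolding indep_point_processes_def .
qed (auto intro!: sigma_algebra_point_process_events count_event_in_point_process_events
      window_N_props window_P_props(1,2) window_P_props(3)[THEN subsetD])

lemma counts_measurable: "counts k \<in> measurable M (count_space UNIV)"
  unfolding counts_def
  by (cases k) (auto intro!: N_count_measurable P_count_measurable window_N_props window_P_props(1,2)
     window_P_props(3)[THEN subsetD])

lemma Inl_in_group: "Inl i \<in> group i"
  by (auto simp: group_def)

lemma group_sub: "i < Suc n \<Longrightarrow> group i \<subseteq> {..<Suc n} <+> {..<n * m}"
proof
  fix k assume "i < Suc n" "k \<in> group i"
  moreover have "l < n * m" if "i < n" "l < i * m + m" for l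
  proof -
    have "Suc i * m \<le> n * m" using that(1) by (intro mult_le_mono1) simp
    then show ?thesis using that(2) by simp
  qed
  ultimately show "k \<in> {..<Suc n} <+> {..<n * m}" by (auto simp: group_def split: if_splits)
qed

lemma group_disjoint: "disjoint_family_on group {..<Suc n}"
  unfolding disjoint_family_on_def
proof (intro ballI impI)
  fix i j :: nat assume "i \<noteq> j"
  have div: "l div m = i" if "i * m \<le> l" "l < i * m + m" for l i
    using that by (metis add.commute div_nat_eqI mult.commute mult_Suc)
  have "\<not> (i * m \<le> l \<and> l < i * m + m \<and> j * m \<le> l \<and> l < j * m + m)" for l
    using div[of i l] div[of j l] \<open>i \<noteq> j\<close> by blast
  then show "group i \<inter> group j = {}" using \<open>i \<noteq> j\<close> by (auto simp: group_def split: if_splits)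
qed

definition column :: "nat \<Rightarrow> (nat + nat \<Rightarrow> nat) \<Rightarrow> nat \<Rightarrow> nat" where
  "column i f j = (if j = 0 then f (Inl i) else f (Inr (i * m + (j - 1))))"

text \<open>
  The count of the gap is wrapped into \<open>Some\<close> so that it has the type of a move and the readings
  form a single independent family.
\<close>

definition readout :: "nat \<Rightarrow> (nat + nat \<Rightarrow> nat) \<Rightarrow> nat option" where
  "readout i f = (if i < n then column_move m (column i f) else Some (f (Inl i)))"

lemma column_counts:
  assumes "i < n" "j \<le> m"
  shows "column i (\<lambda>k. counts k \<omega>) j = cell \<omega> i j"
proof (cases "j = 0")
  case True
  then show ?thesis using assms by (simp add: column_def counts_def cell_count_def window_N_def)
next
  case False
  then obtain l where l: "j = Suc l" by (cases j) auto
  then have "(i * m + l) div m = i" "(i * m + l) mod m = l" using assms by auto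
  then show ?thesis using l by (simp add: column_def counts_def cell_count_def window_P_def)
qed

lemma column_move_cong: "(\<And>j. j \<le> m \<Longrightarrow> c j = c' j) \<Longrightarrow> column_move m c = column_move m c'"
proof -
  assume *: "\<And>j. j \<le> m \<Longrightarrow> c j = c' j"
  have "column_move m c = Some j \<longleftrightarrow> column_move m c' = Some j" for j
    unfolding column_move_eq_Some using * by auto
  then show ?thesis by (metis not_Some_eq)
qed

lemma readout_measurable:
  assumes "i < Suc n"
  shows "readout i \<in> measurable (PiM (group i) (\<lambda>_. count_space UNIV)) (count_space UNIV)"
proof (cases "i < n")
  case False
  then have eq: "readout i = (\<lambda>f. Some (f (Inl i)))" by (auto simp: readout_def fun_eq_iff)
  have comp: "(\<lambda>f. f (Inl i)) \<in> measurable (PiM (group i) (\<lambda>_. count_space UNIV)) (count_space UNIV)"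
    by (rule measurable_component_singleton) (rule Inl_in_group)
  show ?thesis unfolding eq by (rule measurable_compose[OF comp]) simp
next
  case True
  let ?R = "PiM (group i) (\<lambda>_. count_space UNIV) :: (nat + nat \<Rightarrow> nat) measure"
  have comp: "(\<lambda>f. column i f j) \<in> measurable ?R (count_space UNIV)" if "j \<le> m" for j
  proof (cases "j = 0")
    case True
    then show ?thesis unfolding column_def by (simp add: Inl_in_group measurable_component_singleton)
  next
    case False
    then have "Inr (i * m + (j - 1)) \<in> group i" using that \<open>i < n\<close> by (auto simp: group_def)
    then show ?thesis unfolding column_def using False by (simp add: measurable_component_singleton)
  qed
  have S: "{f \<in> space ?R. column_move m (column i f) = Some j} \<in> sets ?R" for j
  proof (cases "j \<le> m")
    case True
    have [measurable]: "Measurable.pred ?R (\<lambda>f. column i f k = v)" if "k \<le> m" for k v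
      using comp[OF that] by measurable
    have "{f \<in> space ?R. column_move m (column i f) = Some j} =
      {f \<in> space ?R. column i f j = 1} \<inter> (\<Inter>k\<in>{..m}. {f \<in> space ?R. k \<noteq> j \<longrightarrow> column i f k = 0})"
      using True by (auto simp: column_move_eq_Some)
    also have "\<dots> \<in> sets ?R"
    proof (intro sets.Int sets.finite_INT)
      show "{f \<in> space ?R. column i f j = 1} \<in> sets ?R" using True by measurable
      fix k assume k: "k \<in> {..m}"
      show "{f \<in> space ?R. k \<noteq> j \<longrightarrow> column i f k = 0} \<in> sets ?R"
        using k by (cases "k = j") (auto intro: predE)
    qed auto
    finally show ?thesis .
  qed (simp add: column_move_eq_Some)
  have "readout i -` {v} \<inter> space ?R \<in> sets ?R" for v
  proof (cases v)
    case (Some j)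
    then have "readout i -` {v} \<inter> space ?R = {f \<in> space ?R. column_move m (column i f) = Some j}"
      using True by (auto simp: readout_def)
    then show ?thesis using S by simp
  next
    case None
    then have "readout i -` {v} \<inter> space ?R =
        space ?R - (\<Union>j. {f \<in> space ?R. column_move m (column i f) = Some j})"
      using True by (auto simp: readout_def)
    then show ?thesis using S by auto
  qed
  then show ?thesis by (subst measurable_count_space_eq_countable) auto
qed

definition readings :: "nat \<Rightarrow> 'a \<Rightarrow> nat option" where
  "readings i \<omega> = readout i (\<lambda>k\<in>group i. counts k \<omega>)"

lemma readings_indep: "indep_vars (\<lambda>_. count_space UNIV) readings {..<Suc n}"
  unfolding readings_def
  by (rule indep_vars_compose2[OF indep_vars_restrict[OF counts_indep group_sub group_disjoint]])
     (auto intro: readout_measurable)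

lemma readings_last: "readings n \<omega> = Some (card (N \<omega> \<inter> {a + d * real n<..<0}))"
  by (simp add: readings_def readout_def Inl_in_group counts_def window_N_def)

lemma readings_move:
  assumes "i < n" shows "readings i \<omega> = column_move m (cell \<omega> i)"
proof -
  have "column i (\<lambda>k\<in>group i. counts k \<omega>) j = column i (\<lambda>k. counts k \<omega>) j" if "j \<le> m" for j
    using that assms by (auto simp: column_def group_def)
  then show ?thesis using column_counts[OF assms] assms
    by (auto simp: readings_def readout_def intro!: column_move_cong)
qed

definition rate :: real where "rate = lam * d + real m * (e * d)"

lemma rate_nonneg: "0 \<le> rate" using lam d e by (simp add: rate_def)

lemma cell_prob:
  assumes "i < n" "j \<le> m"
  shows "prob {\<omega> \<in> space M. cell \<omega> i j = k} =
    (if j = 0 then lam * d else e * d) ^ k / fact k * exp (- (if j = 0 then lam * d else e * d))"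
proof (cases "j = 0")
  case True
  then show ?thesis
    using N_count_prob[OF strip_measurable bounded_strip, of a d i k] d
    by (simp add: cell_count_def measure_strip)
next
  case False
  have "prob {\<omega> \<in> space M. card (P \<omega> \<inter> (strip a d i \<times> slab e j)) = k} =
     (d * e) ^ k / fact k * exp (- (d * e))"
    using P_count_prob[of "strip a d i \<times> slab e j" k] slab_pos[OF e, of j] False d e
    by (auto simp: measure_lborel_Times measure_strip measure_slab cell_measurable
        bounded_Times bounded_strip bounded_slab)
  then show ?thesis using False by (simp add: cell_count_def mult.commute)
qed

lemma column_prob:
  assumes i: "i < n"
  shows "{\<omega> \<in> space M. \<forall>j\<le>m. cell \<omega> i j = v j} \<in> events"
    and "prob {\<omega> \<in> space M. \<forall>j\<le>m. cell \<omega> i j = v j} =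
     (\<Prod>j\<le>m. (if j = 0 then lam * d else e * d) ^ v j / fact (v j) * exp (- (if j = 0 then lam * d else e * d)))"
proof -
  \<comment> \<open>\<open>h\<close> lists the windows of column \<open>i\<close> by rows\<close>
  define h where "h = (\<lambda>j. if j = 0 then Inl i else Inr (i * m + (j - 1)) :: nat + nat)"
  have inj: "inj_on h {..m}" by (auto simp: inj_on_def h_def split: if_splits)
  have cnt: "counts (h j) \<omega> = cell \<omega> i j" if "j \<le> m" for j \<omega>
    using column_counts[OF i that] by (auto simp: column_def h_def)
  have "h j \<in> group i" if "j \<le> m" for j using that i by (auto simp: h_def group_def)
  then have sub: "h ` {..m} \<subseteq> {..<Suc n} <+> {..<n * m}" using group_sub[of i] i by fastforce
  define g where "g = the_inv_into {..m} h"
  have g: "g (h j) = j" if "j \<le> m" for j unfolding g_def using inj that by (intro the_inv_into_f_f) auto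
  have ev: "{\<omega> \<in> space M. \<forall>j\<le>m. cell \<omega> i j = v j} =
     (\<Inter>k\<in>h ` {..m}. counts k -` {v (g k)} \<inter> space M)"
    using g cnt by auto
  show "{\<omega> \<in> space M. \<forall>j\<le>m. cell \<omega> i j = v j} \<in> events"
    unfolding ev using counts_measurable by (intro sets.finite_INT) (auto intro: measurable_sets)
  have "prob (\<Inter>k\<in>h ` {..m}. counts k -` {v (g k)} \<inter> space M) =
      (\<Prod>k\<in>h ` {..m}. prob (counts k -` {v (g k)} \<inter> space M))"
    using sub by (intro indep_varsD[OF counts_indep]) auto
  also have "\<dots> = (\<Prod>j\<le>m. prob (counts (h j) -` {v (g (h j))} \<inter> space M))"
    by (subst prod.reindex[OF inj]) simp
  also have "\<dots> = (\<Prod>j\<le>m. prob {\<omega> \<in> space M. cell \<omega> i j = v j})"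
  proof (rule prod.cong[OF refl])
    fix j assume j: "j \<in> {..m}"
    then have "counts (h j) -` {v (g (h j))} \<inter> space M = {\<omega> \<in> space M. cell \<omega> i j = v j}"
      using g cnt by auto
    then show "prob (counts (h j) -` {v (g (h j))} \<inter> space M) =
       prob {\<omega> \<in> space M. cell \<omega> i j = v j}" by simp
  qed
  also have "\<dots> = (\<Prod>j\<le>m. (if j = 0 then lam * d else e * d) ^ v j / fact (v j) *
      exp (- (if j = 0 then lam * d else e * d)))"
    using i by (intro prod.cong refl cell_prob) auto
  finally show "prob {\<omega> \<in> space M. \<forall>j\<le>m. cell \<omega> i j = v j} =
     (\<Prod>j\<le>m. (if j = 0 then lam * d else e * d) ^ v j / fact (v j) * exp (- (if j = 0 then lam * d else e * d)))"
    using ev by simp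
qed

lemma prod_exp_rate: "(\<Prod>j\<le>m. exp (- (if j = 0 then lam * d else e * d))) = exp (- rate)"
proof -
  have "(\<Sum>j\<le>m. - (if j = 0 then lam * d else e * d)) = - rate"
  proof -
    have "{..m} = insert 0 {1..m}" by auto
    then show ?thesis by (simp add: rate_def sum_negf) 
  qed
  then show ?thesis by (simp add: exp_sum[symmetric])
qed

lemma column_empty_prob:
  assumes "i < n"
  shows "prob {\<omega> \<in> space M. \<forall>j\<le>m. cell \<omega> i j = 0} = exp (- rate)"
  using column_prob(2)[OF assms, of "\<lambda>_. 0"] prod_exp_rate by simp

lemma readings_measurable: "i < Suc n \<Longrightarrow> readings i \<in> measurable M (count_space UNIV)"
  using readings_indep unfolding indep_vars_def by auto

lemma move_Some_prob:
  assumes "i < n" "j \<le> m"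
  shows "prob {\<omega> \<in> space M. readings i \<omega> = Some j} = (if j = 0 then lam * d else e * d) * exp (- rate)"
proof -
  let ?v = "\<lambda>k. if k = j then 1 else 0 :: nat"
  have "{\<omega> \<in> space M. readings i \<omega> = Some j} =
     {\<omega> \<in> space M. \<forall>k\<le>m. cell \<omega> i k = ?v k}"
    using assms by (auto simp: readings_move column_move_eq_Some)
  then have "prob {\<omega> \<in> space M. readings i \<omega> = Some j} =
     prob {\<omega> \<in> space M. \<forall>k\<le>m. cell \<omega> i k = ?v k}"
    by simp
  also have "\<dots> = (\<Prod>k\<le>m. (if k = 0 then lam * d else e * d) ^ ?v k * exp (- (if k = 0 then lam * d else e * d)))"
    unfolding column_prob(2)[OF assms(1), of ?v] by (intro prod.cong) auto
  also have "\<dots> = (\<Prod>k\<le>m. (if k = 0 then lam * d else e * d) ^ ?v k) * exp (- rate)"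
    by (simp only: prod.distrib prod_exp_rate)
  also have "(\<Prod>k\<le>m. (if k = 0 then lam * d else e * d) ^ ?v k) = (if j = 0 then lam * d else e * d)"
  proof -
    have "(\<Prod>k\<le>m. (if k = 0 then lam * d else e * d) ^ ?v k) =
       (\<Prod>k\<le>m. if k = j then (if j = 0 then lam * d else e * d) else 1)"
      by (rule prod.cong) auto
    then show ?thesis using assms(2) by (simp add: prod.delta)
  qed
  finally show ?thesis .
qed

end

section \<open>The chain of a Poisson environment\<close>

lemma (in iid_columns) stat_card_mean: "stat (\<lambda>s. real (card s)) \<le> m * r"
proof -
  have "(\<Sum>k\<le>m. (of_nat k * of_nat (m choose k)) * r ^ (k - 1) * 1 ^ (m - k)) = real m * (r + 1) ^ (m - 1)"
    by (rule binomial_deriv1)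
  then have "r * (\<Sum>k\<le>m. (of_nat k * of_nat (m choose k)) * r ^ (k - 1)) = m * r * (1 + r) ^ (m - 1)"
    by (simp add: add.commute)
  also have "r * (\<Sum>k\<le>m. (of_nat k * of_nat (m choose k)) * r ^ (k - 1)) =
      (\<Sum>k\<le>m. real (m choose k) * (r ^ k * real k))"
    unfolding sum_distrib_left
  proof (rule sum.cong[OF refl])
    fix k show "r * (of_nat k * of_nat (m choose k) * r ^ (k - 1)) = real (m choose k) * (r ^ k * real k)"
      by (cases k) (auto simp: algebra_simps)
  qed
  finally have "stat (\<lambda>s. real (card s)) = m * r * (1 + r) ^ (m - 1) / (1 + r) ^ m"
    by (simp add: stat_card[of real])
  also have "\<dots> \<le> m * r * (1 + r) ^ m / (1 + r) ^ m"
    using r_pos by (intro divide_right_mono mult_left_mono power_increasing) auto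
  finally show ?thesis using r_pos by simp
qed

lemma (in iid_columns) stat_card_tail: "stat (\<lambda>s. of_bool (d < card s)) \<le> m * r / real (Suc d)"
proof -
  have "stat (\<lambda>s. of_bool (d < card s)) \<le> stat (\<lambda>s. (1 / real (Suc d)) * real (card s))"
    by (intro stat_mono) (auto simp: field_simps)
  also have "\<dots> = (1 / real (Suc d)) * stat (\<lambda>s. real (card s))" by (rule stat_cmult)
  also have "\<dots> \<le> (1 / real (Suc d)) * (m * r)" by (intro mult_left_mono stat_card_mean) auto
  finally show ?thesis by simp
qed

text \<open>
  The Poisson limit of the binomial law with odds \<open>\<mu> / m\<close>, tested against a bounded function. The
  terms are dominated by those of the exponential series, so that limit and sum can be
  interchanged.
\<close>

lemma tendsto_binomial_poisson:
  fixes h :: "nat \<Rightarrow> real"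
  assumes mu: "0 < \<mu>" and h: "\<And>k. 0 \<le> h k" "\<And>k. h k \<le> 1"
  shows "(\<lambda>m. (\<Sum>k\<le>m. real (m choose k) * ((\<mu> / real m) ^ k * h k)) / (1 + \<mu> / real m) ^ m)
     \<longlonglongrightarrow> (\<Sum>k. \<mu> ^ k / fact k * h k) / exp \<mu>"
proof (intro tendsto_divide tendsto_exp_limit_sequentially)
  define f where "f k m = (if k \<le> m then real (m choose k) * ((\<mu> / real m) ^ k * h k) else 0)" for k m
  have prodform: "real (m choose k) * (\<mu> / real m) ^ k = (\<Prod>i<k. (real (m - i) / real m) * (\<mu> / real (k - i)))"
    if "k \<le> m" for k m
  proof -
    have "real (m choose k) * (\<mu> / real m) ^ k = (\<Prod>i=0..<k. real (m - i) / real (k - i)) * (\<Prod>i=0..<k. \<mu> / real m)"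
      using that by (simp add: binomial_altdef_of_nat)
    also have "\<dots> = (\<Prod>i=0..<k. (real (m - i) / real m) * (\<mu> / real (k - i)))"
      unfolding prod.distrib[symmetric] by (rule prod.cong) auto
    finally show ?thesis by (simp add: atLeast0LessThan)
  qed
  have factform: "(\<Prod>i<k. \<mu> / real (k - i)) = \<mu> ^ k / fact k" for k
    by (simp add: prod_dividef fact_prod_rev atLeast0LessThan)
  have lim: "(\<lambda>m. f k m) \<longlonglongrightarrow> \<mu> ^ k / fact k * h k" for k
  proof -
    have "(\<lambda>m. real (m - i) / real m) \<longlonglongrightarrow> 1" for i
    proof -
      have "(\<lambda>m. 1 - real i / real m) \<longlonglongrightarrow> 1 - 0"
        by (intro tendsto_diff tendsto_const tendsto_divide_0[OF tendsto_const] filterlim_real_sequentially[THEN filterlim_at_top_imp_at_infinity])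
      moreover have "eventually (\<lambda>m. 1 - real i / real m = real (m - i) / real m) sequentially"
        using eventually_gt_at_top[of i] by eventually_elim (auto simp: field_simps of_nat_diff)
      ultimately show ?thesis by (simp add: tendsto_cong)
    qed
    then have "(\<lambda>m. \<Prod>i<k. (real (m - i) / real m) * (\<mu> / real (k - i))) \<longlonglongrightarrow> (\<Prod>i<k. 1 * (\<mu> / real (k - i)))"
      by (intro tendsto_prod tendsto_mult tendsto_const)
    then have "(\<lambda>m. (\<Prod>i<k. (real (m - i) / real m) * (\<mu> / real (k - i))) * h k) \<longlonglongrightarrow> \<mu> ^ k / fact k * h k"
      using factform[of k] by (intro tendsto_mult tendsto_const) simp
    moreover have "eventually (\<lambda>m. (\<Prod>i<k. (real (m - i) / real m) * (\<mu> / real (k - i))) * h k = f k m) sequentially"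
      using eventually_ge_at_top[of k]
    proof eventually_elim
      case (elim m)
      show ?case unfolding prodform[OF elim, symmetric] f_def using elim by (simp add: mult.assoc)
    qed
    ultimately show ?thesis by (rule Lim_transform_eventually)
  qed
  have bound: "norm (f k m) \<le> \<mu> ^ k / fact k" for k m
  proof (cases "k \<le> m")
    case True
    have "real (m choose k) * (\<mu> / real m) ^ k \<le> (\<Prod>i<k. \<mu> / real (k - i))"
      unfolding prodform[OF True]
    proof (rule prod_mono)
      fix i assume "i \<in> {..<k}"
      have "real (m - i) / real m \<le> 1" by (cases "m = 0") (auto simp: divide_le_eq_1)
      then have "(real (m - i) / real m) * (\<mu> / real (k - i)) \<le> 1 * (\<mu> / real (k - i))"
        using mu by (intro mult_right_mono) auto
      then show "0 \<le> (real (m - i) / real m) * (\<mu> / real (k - i)) \<and>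
         (real (m - i) / real m) * (\<mu> / real (k - i)) \<le> \<mu> / real (k - i)" using mu by simp
    qed
    then have "real (m choose k) * (\<mu> / real m) ^ k * h k \<le> \<mu> ^ k / fact k * 1"
      unfolding factform using h mu by (intro mult_mono) auto
    then show ?thesis using True h mu by (simp add: f_def abs_mult mult.assoc)
  next
    case False
    then show ?thesis using mu by (simp add: f_def)
  qed
  have summ: "summable (\<lambda>k. \<mu> ^ k / fact k)"
    using summable_exp[of \<mu>] by (simp add: field_simps)
  have "((\<lambda>m. \<Sum>k. f k m) \<longlongrightarrow> (\<Sum>k. \<mu> ^ k / fact k * h k)) sequentially"
  proof (rule tannerys_theorem[THEN conjunct2, THEN conjunct2, OF lim _ summ])
    show "\<forall>\<^sub>F (k, m) in at_top \<times>\<^sub>F sequentially. norm (f k m) \<le> \<mu> ^ k / fact k"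
      using bound by (intro always_eventually) auto
  qed simp
  moreover have "(\<Sum>k. f k m) = (\<Sum>k\<le>m. real (m choose k) * ((\<mu> / real m) ^ k * h k))" for m
  proof -
    have "(\<Sum>k. f k m) = (\<Sum>k\<le>m. f k m)" by (rule suminf_finite) (auto simp: f_def)
    then show ?thesis by (simp add: f_def)
  qed
  ultimately show "(\<lambda>m. \<Sum>k\<le>m. real (m choose k) * ((\<mu> / real m) ^ k * h k)) \<longlonglongrightarrow> (\<Sum>k. \<mu> ^ k / fact k * h k)"
    by simp
qed simp

context poisson_grid
begin

lemma columns_params: "iid_columns m (lam * d * exp (- rate)) (e / lam)"
proof
  have "lam * d * exp (- rate) * (1 + m * (e / lam)) = rate * exp (- rate)"
    using lam by (simp add: rate_def field_simps)
  also have "rate \<le> exp rate" using exp_ge_add_one_self[of rate] by linarith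
  then have "rate * exp (- rate) \<le> exp rate * exp (- rate)" by (intro mult_right_mono) auto
  also have "\<dots> = 1" by (simp add: exp_minus_inverse)
  finally show "lam * d * exp (- rate) * (1 + m * (e / lam)) \<le> 1" .
qed (use lam d e in auto)

sublocale cols: iid_columns m "lam * d * exp (- rate)" "e / lam"
  by (rule columns_params)

lemma move_prob_vals:
  "cols.move_prob (Some 0) = lam * d * exp (- rate)"
  "0 < j \<Longrightarrow> cols.move_prob (Some j) = e * d * exp (- rate)"
  "cols.move_prob None = 1 - rate * exp (- rate)"
proof -
  show "cols.move_prob (Some 0) = lam * d * exp (- rate)"
    unfolding cols.move_prob_def by simp
  show "cols.move_prob (Some j) = e * d * exp (- rate)" if "0 < j"
    unfolding cols.move_prob_def using that lam by simp
  have "lam * d * exp (- rate) * (1 + m * (e / lam)) = rate * exp (- rate)"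
    using lam by (simp add: rate_def field_simps)
  then show "cols.move_prob None = 1 - rate * exp (- rate)"
    unfolding cols.move_prob_def by simp
qed

text \<open>
  The probabilities of the moves sum to one on both sides, so that the empty reading needs no
  computation of its own.
\<close>

lemma readings_prob:
  assumes i: "i < n" and x: "x \<in> cols.moves"
  shows "prob {\<omega> \<in> space M. readings i \<omega> = x} = cols.move_prob x"
proof -
  have meas: "{\<omega> \<in> space M. readings i \<omega> = x} \<in> events" for x
  proof -
    have "{\<omega> \<in> space M. readings i \<omega> = x} = readings i -` {x} \<inter> space M" by auto
    then show ?thesis using readings_measurable[of i] i by (auto intro: measurable_sets)
  qed
  have some: "prob {\<omega> \<in> space M. readings i \<omega> = Some j} = cols.move_prob (Some j)" if "j \<le> m" for j
    using move_Some_prob[OF i that] move_prob_vals by (cases "j = 0") auto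
  have "1 = prob (\<Union>x\<in>cols.moves. {\<omega> \<in> space M. readings i \<omega> = x})"
  proof -
    have "(\<Union>x\<in>cols.moves. {\<omega> \<in> space M. readings i \<omega> = x}) = space M"
      using readings_move[OF i] column_move_in by (auto simp: cols.moves_def)
    then show ?thesis using prob_space by simp
  qed
  also have "\<dots> = (\<Sum>x\<in>cols.moves. prob {\<omega> \<in> space M. readings i \<omega> = x})"
    using meas by (intro finite_measure_finite_Union cols.finite_moves) (auto simp: disjoint_family_on_def)
  finally have "prob {\<omega> \<in> space M. readings i \<omega> = None} + (\<Sum>j\<le>m. cols.move_prob (Some j)) = 1"
    by (simp add: cols.sum_moves some)
  moreover have "cols.move_prob None + (\<Sum>j\<le>m. cols.move_prob (Some j)) = 1"
    using cols.sum_move_prob by (simp add: cols.sum_moves)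
  ultimately have none: "prob {\<omega> \<in> space M. readings i \<omega> = None} = cols.move_prob None" by simp
  show ?thesis using x none some by (auto simp: cols.moves_def)
qed

abbreviation "moves_of \<omega> \<equiv> grid_moves (N \<omega>) (P \<omega>) a d e n m"
abbreviation "gap_count \<omega> \<equiv> card (N \<omega> \<inter> {a + d * real n<..<0})"

lemma moves_of_eq: "moves_of \<omega> = map (\<lambda>i. readings i \<omega>) [0..<n]"
  by (simp add: grid_moves_def readings_move)

lemma moves_of_in: "length (moves_of \<omega>) = n" "set (moves_of \<omega>) \<subseteq> cols.moves"
  using column_move_in by (auto simp: grid_moves_def cols.moves_def)

lemma atom_prob:
  assumes xs: "length xs = n" "set xs \<subseteq> cols.moves"
  shows "{\<omega> \<in> space M. moves_of \<omega> = xs \<and> gap_count \<omega> \<in> S} \<in> events"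
    and "prob {\<omega> \<in> space M. moves_of \<omega> = xs \<and> gap_count \<omega> \<in> S} =
      prod_list (map cols.move_prob xs) * prob {\<omega> \<in> space M. gap_count \<omega> \<in> S}"
proof -
  define A where "A i = (if i < n then {xs ! i} else Some ` S)" for i
  have ev: "{\<omega> \<in> space M. moves_of \<omega> = xs \<and> gap_count \<omega> \<in> S} =
      (\<Inter>i\<in>{..<Suc n}. readings i -` A i \<inter> space M)"
  proof (rule set_eqI)
    fix \<omega>
    have "moves_of \<omega> = xs \<longleftrightarrow> (\<forall>i<n. readings i \<omega> = xs ! i)"
      unfolding moves_of_eq list_eq_iff_nth_eq using xs(1) by simp
    also have "\<dots> \<longleftrightarrow> (\<forall>i\<in>{..<n}. readings i \<omega> \<in> A i)" by (auto simp: A_def)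
    finally have 1: "moves_of \<omega> = xs \<longleftrightarrow> (\<forall>i\<in>{..<n}. readings i \<omega> \<in> A i)" .
    have 2: "gap_count \<omega> \<in> S \<longleftrightarrow> readings n \<omega> \<in> A n" by (simp add: A_def readings_last image_iff)
    show "\<omega> \<in> {\<omega> \<in> space M. moves_of \<omega> = xs \<and> gap_count \<omega> \<in> S} \<longleftrightarrow>
        \<omega> \<in> (\<Inter>i\<in>{..<Suc n}. readings i -` A i \<inter> space M)"
      unfolding mem_Collect_eq 1 2 lessThan_Suc by auto
  qed
  show "{\<omega> \<in> space M. moves_of \<omega> = xs \<and> gap_count \<omega> \<in> S} \<in> events"
    unfolding ev using readings_measurable by (intro sets.finite_INT) (auto intro: measurable_sets)
  have "prob {\<omega> \<in> space M. moves_of \<omega> = xs \<and> gap_count \<omega> \<in> S} =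
      (\<Prod>i\<in>{..<Suc n}. prob (readings i -` A i \<inter> space M))"
    unfolding ev by (intro indep_varsD[OF readings_indep]) auto
  also have "\<dots> = (\<Prod>i<n. prob (readings i -` A i \<inter> space M)) * prob (readings n -` A n \<inter> space M)"
    by (simp add: mult.commute)
  also have "readings n -` A n \<inter> space M = {\<omega> \<in> space M. gap_count \<omega> \<in> S}"
    by (auto simp: A_def readings_last)
  also have "(\<Prod>i<n. prob (readings i -` A i \<inter> space M)) = (\<Prod>i<n. cols.move_prob (xs ! i))"
  proof (rule prod.cong[OF refl])
    fix i assume "i \<in> {..<n}"
    then have i: "i < n" by simp
    have "readings i -` A i \<inter> space M = {\<omega> \<in> space M. readings i \<omega> = xs ! i}"
      using i by (auto simp: A_def)
    moreover have "xs ! i \<in> cols.moves" using xs i by auto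
    ultimately show "prob (readings i -` A i \<inter> space M) = cols.move_prob (xs ! i)"
      using readings_prob[OF i] by simp
  qed
  also have "\<dots> = prod_list (map cols.move_prob xs)"
    by (simp add: prod.list_conv_set_nth xs(1) atLeast0LessThan)
  finally show "prob {\<omega> \<in> space M. moves_of \<omega> = xs \<and> gap_count \<omega> \<in> S} =
      prod_list (map cols.move_prob xs) * prob {\<omega> \<in> space M. gap_count \<omega> \<in> S}" .
qed

text \<open>
  Since the gap is independent of the moves, an event that compares the two can be averaged over
  the moves first, as if the set \<open>S\<close> were deterministic.
\<close>

lemma moves_law:
  shows "{\<omega> \<in> space M. gap_count \<omega> \<in> S (moves_of \<omega>)} \<in> events"
    and "prob {\<omega> \<in> space M. gap_count \<omega> \<in> S (moves_of \<omega>)} =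
      cols.mean n (\<lambda>xs. prob {\<omega> \<in> space M. gap_count \<omega> \<in> S xs})"
proof -
  let ?L = "{xs. set xs \<subseteq> cols.moves \<and> length xs = n}"
  let ?E = "\<lambda>xs. {\<omega> \<in> space M. moves_of \<omega> = xs \<and> gap_count \<omega> \<in> S xs}"
  have ev: "{\<omega> \<in> space M. gap_count \<omega> \<in> S (moves_of \<omega>)} = (\<Union>xs\<in>?L. ?E xs)"
    using moves_of_in by auto
  have fin: "finite ?L" by (intro finite_lists_length_eq cols.finite_moves)
  show "{\<omega> \<in> space M. gap_count \<omega> \<in> S (moves_of \<omega>)} \<in> events"
    unfolding ev using fin atom_prob(1) by (intro sets.finite_UN) auto
  have "prob {\<omega> \<in> space M. gap_count \<omega> \<in> S (moves_of \<omega>)} = (\<Sum>xs\<in>?L. prob (?E xs))"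
    unfolding ev using fin atom_prob(1)
    by (intro finite_measure_finite_Union) (auto simp: disjoint_family_on_def)
  also have "\<dots> = (\<Sum>xs\<in>?L. prod_list (map cols.move_prob xs) * prob {\<omega> \<in> space M. gap_count \<omega> \<in> S xs})"
    by (intro sum.cong refl atom_prob(2)) auto
  also have "\<dots> = cols.mean n (\<lambda>xs. prob {\<omega> \<in> space M. gap_count \<omega> \<in> S xs})"
    by (rule iid_mean_sum_lists[OF cols.finite_moves, symmetric])
  finally show "prob {\<omega> \<in> space M. gap_count \<omega> \<in> S (moves_of \<omega>)} =
      cols.mean n (\<lambda>xs. prob {\<omega> \<in> space M. gap_count \<omega> \<in> S xs})" .
qed

lemma moves_event:
  shows "{\<omega> \<in> space M. R (moves_of \<omega>)} \<in> events"
    and "prob {\<omega> \<in> space M. R (moves_of \<omega>)} = cols.mean n (\<lambda>xs. of_bool (R xs))"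
proof -
  let ?S = "\<lambda>xs. if R xs then UNIV else {} :: nat set"
  have ev: "{\<omega> \<in> space M. R (moves_of \<omega>)} = {\<omega> \<in> space M. gap_count \<omega> \<in> ?S (moves_of \<omega>)}"
    by (rule Collect_cong) (simp split: if_split)
  show "{\<omega> \<in> space M. R (moves_of \<omega>)} \<in> events" unfolding ev by (rule moves_law(1))
  have eq: "(\<lambda>xs. prob {\<omega> \<in> space M. gap_count \<omega> \<in> ?S xs}) = (\<lambda>xs. of_bool (R xs))"
    by (auto simp: fun_eq_iff prob_space)
  show "prob {\<omega> \<in> space M. R (moves_of \<omega>)} = cols.mean n (\<lambda>xs. of_bool (R xs))"
    unfolding ev moves_law(2)[of ?S] eq ..
qed

lemma column_crowded_prob:
  assumes i: "i < n"
  shows "{\<omega> \<in> space M. \<not> (\<Sum>j\<le>m. cell \<omega> i j) \<le> 1} \<in> events"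
    and "prob {\<omega> \<in> space M. \<not> (\<Sum>j\<le>m. cell \<omega> i j) \<le> 1} \<le> rate\<^sup>2"
proof -
  let ?s = "\<lambda>\<omega>. \<Sum>j\<le>m. cell \<omega> i j"
  let ?Z = "{\<omega> \<in> space M. \<forall>j\<le>m. cell \<omega> i j = 0}"
  let ?U = "\<lambda>j. {\<omega> \<in> space M. readings i \<omega> = Some j}"
  have Zev: "?Z \<in> events" by (rule column_prob(1)[OF i, of "\<lambda>_. 0"])
  have Uev: "?U j \<in> events" for j
  proof -
    have "?U j = readings i -` {Some j} \<inter> space M" by auto
    then show ?thesis using readings_measurable[of i] i by (auto intro: measurable_sets)
  qed
  have good: "{\<omega> \<in> space M. ?s \<omega> \<le> 1} = ?Z \<union> (\<Union>j\<in>{..m}. ?U j)"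
  proof (intro set_eqI iffI)
    fix \<omega> assume w: "\<omega> \<in> {\<omega> \<in> space M. ?s \<omega> \<le> 1}"
    show "\<omega> \<in> ?Z \<union> (\<Union>j\<in>{..m}. ?U j)"
    proof (cases "readings i \<omega>")
      case None
      then have "column_move m (cell \<omega> i) = None" using readings_move[OF i] by simp
      then show ?thesis using column_move_None[of "cell \<omega> i" m] w by auto
    next
      case (Some j)
      then show ?thesis using w readings_move[OF i] column_move_eq_Some by auto
    qed
  next
    fix \<omega> assume "\<omega> \<in> ?Z \<union> (\<Union>j\<in>{..m}. ?U j)"
    then show "\<omega> \<in> {\<omega> \<in> space M. ?s \<omega> \<le> 1}"
    proof
      assume "\<omega> \<in> (\<Union>j\<in>{..m}. ?U j)"
      then obtain j where j: "\<omega> \<in> space M" "j \<le> m" "cell \<omega> i j = 1"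
        "\<forall>k\<le>m. k \<noteq> j \<longrightarrow> cell \<omega> i k = 0"
        using readings_move[OF i] by (auto simp: column_move_eq_Some)
      have "?s \<omega> = (\<Sum>k\<le>m. if k = j then 1 else 0)" by (rule sum.cong) (use j in auto)
      then show ?thesis using j by simp
    qed auto
  qed
  have Gev: "{\<omega> \<in> space M. ?s \<omega> \<le> 1} \<in> events"
    unfolding good by (intro sets.Un Zev sets.finite_UN Uev) auto
  have compl: "{\<omega> \<in> space M. \<not> ?s \<omega> \<le> 1} = space M - {\<omega> \<in> space M. ?s \<omega> \<le> 1}" by blast
  show "{\<omega> \<in> space M. \<not> ?s \<omega> \<le> 1} \<in> events" unfolding compl by (rule sets.compl_sets[OF Gev])
  have disj: "?Z \<inter> (\<Union>j\<in>{..m}. ?U j) = {}"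
  proof -
    have "\<omega> \<notin> ?Z" if "j \<le> m" "\<omega> \<in> ?U j" for j \<omega>
    proof -
      have "cell \<omega> i j = 1"
        using that readings_move[OF i, of \<omega>] column_move_eq_Some[of m "cell \<omega> i" j] by simp
      then show ?thesis using that(1) by force
    qed
    then show ?thesis by blast
  qed
  have "prob (?Z \<union> (\<Union>j\<in>{..m}. ?U j)) = prob ?Z + prob (\<Union>j\<in>{..m}. ?U j)"
    by (rule finite_measure_Union[OF Zev _ disj]) (intro sets.finite_UN Uev, simp)
  also have "prob (\<Union>j\<in>{..m}. ?U j) = (\<Sum>j\<le>m. prob (?U j))"
  proof (rule finite_measure_finite_Union)
    show "?U ` {..m} \<subseteq> events" using Uev by blast
    show "disjoint_family_on ?U {..m}" unfolding disjoint_family_on_def by auto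
  qed simp
  also have "(\<Sum>j\<le>m. prob (?U j)) = (\<Sum>j\<le>m. (if j = 0 then lam * d else e * d)) * exp (- rate)"
    unfolding sum_distrib_right using move_Some_prob[OF i] by (intro sum.cong) auto
  also have "(\<Sum>j\<le>m. (if j = 0 then lam * d else e * d)) = rate"
    using cols.sum_atMost_if by (simp add: rate_def)
  finally have "prob {\<omega> \<in> space M. ?s \<omega> \<le> 1} = exp (- rate) + rate * exp (- rate)"
    unfolding good using column_empty_prob[OF i] by simp
  then have "prob {\<omega> \<in> space M. \<not> ?s \<omega> \<le> 1} = 1 - (exp (- rate) + rate * exp (- rate))"
    unfolding compl using prob_compl[OF Gev] by simp
  then show "prob {\<omega> \<in> space M. \<not> ?s \<omega> \<le> 1} \<le> rate\<^sup>2"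
    using poisson_two_points_le[OF rate_nonneg] by simp
qed

lemma row_crowded_prob:
  assumes j: "1 \<le> j"
  shows "{\<omega> \<in> space M. \<not> card (P \<omega> \<inter> ({a<..a + d * real n} \<times> slab e j)) \<le> 1} \<in> events"
    and "prob {\<omega> \<in> space M. \<not> card (P \<omega> \<inter> ({a<..a + d * real n} \<times> slab e j)) \<le> 1} \<le> (real n * d * e)\<^sup>2"
proof -
  let ?B = "{a<..a + d * real n} \<times> slab e j"
  let ?c = "\<lambda>\<omega>. card (P \<omega> \<inter> ?B)"
  have B: "?B \<in> sets borel" "bounded ?B" "?B \<subseteq> UNIV \<times> {0<..}"
    using slab_pos[OF e, of j] unfolding borel_prod[symmetric]
    by (auto intro!: bounded_Times bounded_slab pair_measureI)
  have mB: "measure lborel ?B = real n * d * e"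
    using d measure_slab[OF e j] by (simp add: measure_lborel_Times mult.commute)
  have cm: "?c \<in> measurable M (count_space UNIV)" using B by (rule P_count_measurable)
  have ev: "{\<omega> \<in> space M. ?c \<omega> = k} \<in> events" for k
  proof -
    have "{\<omega> \<in> space M. ?c \<omega> = k} = ?c -` {k} \<inter> space M" by auto
    then show ?thesis using cm by (auto intro: measurable_sets)
  qed
  have eq: "{\<omega> \<in> space M. \<not> ?c \<omega> \<le> 1} = space M - ({\<omega> \<in> space M. ?c \<omega> = 0} \<union> {\<omega> \<in> space M. ?c \<omega> = 1})"
    by auto
  show "{\<omega> \<in> space M. \<not> ?c \<omega> \<le> 1} \<in> events" unfolding eq using ev by auto
  have "prob ({\<omega> \<in> space M. ?c \<omega> = 0} \<union> {\<omega> \<in> space M. ?c \<omega> = 1}) =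
      prob {\<omega> \<in> space M. ?c \<omega> = 0} + prob {\<omega> \<in> space M. ?c \<omega> = 1}"
    using ev by (intro finite_measure_Union) auto
  also have "\<dots> = exp (- (real n * d * e)) + real n * d * e * exp (- (real n * d * e))"
    using P_count_prob[OF B, of 0] P_count_prob[OF B, of 1] by (simp add: mB)
  finally have "prob {\<omega> \<in> space M. \<not> ?c \<omega> \<le> 1} =
      1 - (exp (- (real n * d * e)) + real n * d * e * exp (- (real n * d * e)))"
    unfolding eq using ev by (subst prob_compl) auto
  then show "prob {\<omega> \<in> space M. \<not> ?c \<omega> \<le> 1} \<le> (real n * d * e)\<^sup>2"
    using poisson_two_points_le[of "real n * d * e"] d e by simp
qed

lemma grid_bad_prob:
  shows "{\<omega> \<in> space M. \<not> grid_good (N \<omega>) (P \<omega>) a d e n m} \<in> events"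
    and "prob {\<omega> \<in> space M. \<not> grid_good (N \<omega>) (P \<omega>) a d e n m} \<le> n * rate\<^sup>2 + m * (real n * d * e)\<^sup>2"
proof -
  let ?C = "\<lambda>i. {\<omega> \<in> space M. \<not> (\<Sum>j\<le>m. cell \<omega> i j) \<le> 1}"
  let ?R = "\<lambda>j. {\<omega> \<in> space M. \<not> card (P \<omega> \<inter> ({a<..a + d * real n} \<times> slab e j)) \<le> 1}"
  have eq: "{\<omega> \<in> space M. \<not> grid_good (N \<omega>) (P \<omega>) a d e n m} = (\<Union>i\<in>{..<n}. ?C i) \<union> (\<Union>j\<in>{1..m}. ?R j)"
    by (auto simp: grid_good_def)
  have C: "?C i \<in> events" "prob (?C i) \<le> rate\<^sup>2" if "i < n" for i
    using column_crowded_prob[OF that] by auto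
  have R: "?R j \<in> events" "prob (?R j) \<le> (real n * d * e)\<^sup>2" if "1 \<le> j" for j
    using row_crowded_prob[OF that] by auto
  show "{\<omega> \<in> space M. \<not> grid_good (N \<omega>) (P \<omega>) a d e n m} \<in> events"
    unfolding eq using C(1) R(1) by (intro sets.Un sets.finite_UN) auto
  have "prob ((\<Union>i\<in>{..<n}. ?C i) \<union> (\<Union>j\<in>{1..m}. ?R j)) \<le> prob (\<Union>i\<in>{..<n}. ?C i) + prob (\<Union>j\<in>{1..m}. ?R j)"
    using C(1) R(1) by (intro measure_Un_le sets.finite_UN) auto
  also have "prob (\<Union>i\<in>{..<n}. ?C i) \<le> (\<Sum>i\<in>{..<n}. prob (?C i))"
    using C(1) by (intro finite_measure_subadditive_finite) auto
  also have "\<dots> \<le> (\<Sum>i\<in>{..<n}. rate\<^sup>2)" using C(2) by (intro sum_mono) auto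
  also have "prob (\<Union>j\<in>{1..m}. ?R j) \<le> (\<Sum>j\<in>{1..m}. prob (?R j))"
    using R(1) by (intro finite_measure_subadditive_finite) auto
  also have "\<dots> \<le> (\<Sum>j\<in>{1..m}. (real n * d * e)\<^sup>2)" using R(2) by (intro sum_mono) auto
  finally show "prob {\<omega> \<in> space M. \<not> grid_good (N \<omega>) (P \<omega>) a d e n m} \<le> n * rate\<^sup>2 + m * (real n * d * e)\<^sup>2"
    unfolding eq by simp
qed

text \<open>
  Since \<open>b * rate\<close> does not depend on the mesh for columns of width \<open>1 / b\<close>, a unit length of space
  contains exactly one deletion and no insertion with a probability bounded below uniformly.
\<close>

lemma block_drains:
  assumes b: "0 < b" "real b * d = 1"
  shows "lam * exp (- (real b * rate)) \<le> cols.mean b (\<lambda>ys. of_bool (cols.drains 1 ys))"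
proof -
  have "exp (- rate) \<le> cols.move_prob None"
  proof -
    have "(1 + rate) * exp (- rate) \<le> exp rate * exp (- rate)"
      using exp_ge_add_one_self[of rate] by (intro mult_right_mono) auto
    moreover have "exp rate * exp (- rate) = 1" by (simp add: exp_minus_inverse)
    ultimately show ?thesis unfolding move_prob_vals by (simp add: algebra_simps)
  qed
  then have "exp (- rate) ^ (b - 1) \<le> cols.move_prob None ^ (b - 1)" by (intro power_mono) auto
  then have "real b * (lam * d * exp (- rate)) * exp (- rate) ^ (b - 1) \<le>
      real b * (lam * d * exp (- rate)) * cols.move_prob None ^ (b - 1)"
    using lam d by (intro mult_left_mono) auto
  also have "\<dots> \<le> cols.mean b (\<lambda>ys. of_bool (cols.drains 1 ys))" by (rule cols.mean_drains_one)
  also have "real b * (lam * d * exp (- rate)) * exp (- rate) ^ (b - 1) =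
      lam * (real b * d) * (exp (- rate) * exp (- rate) ^ (b - 1))" by (simp add: mult_ac)
  also have "exp (- rate) * exp (- rate) ^ (b - 1) = exp (- rate) ^ b"
    using b(1) by (simp add: power_eq_if)
  also have "exp (- rate) ^ b = exp (- (real b * rate))" by (simp add: exp_of_nat_mult[symmetric])
  finally show ?thesis using b(2) by simp
qed

end

section \<open>The law of the tagged particle\<close>

text \<open>
  Fix a level \<open>y < 0\<close> and a time \<open>t > 0\<close>. The window of index \<open>K\<close> is \<open>(y - K, y] \<times> (0, t]\<close>, cut into
  \<open>mesh K\<close> columns per unit length and \<open>mesh K\<close> rows. The fourth power makes the probabilities of
  two points in a column or in a row summable over \<open>K\<close>.
\<close>

locale poisson_half_line = poisson_input +
  fixes y t :: real
  assumes y: "y < 0" and t: "0 < t"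
begin

definition mesh :: "nat \<Rightarrow> nat" where "mesh K = (K + 1) ^ 4"

lemma mesh_pos: "0 < mesh K" by (simp add: mesh_def)

definition window_moves :: "nat \<Rightarrow> 'a \<Rightarrow> nat option list" where
  "window_moves K \<omega> = grid_moves (N \<omega>) (P \<omega>) (y - real K) (1 / real (mesh K)) (t / real (mesh K)) (K * mesh K) (mesh K)"

definition window_good :: "nat \<Rightarrow> 'a \<Rightarrow> bool" where
  "window_good K \<omega> = grid_good (N \<omega>) (P \<omega>) (y - real K) (1 / real (mesh K)) (t / real (mesh K)) (K * mesh K) (mesh K)"

text \<open>
  \<open>state K i \<omega>\<close> is the state of the chain at \<open>y - K + i\<close> when it is started empty at \<open>y - K\<close>.
\<close>

definition state :: "nat \<Rightarrow> nat \<Rightarrow> 'a \<Rightarrow> nat set" where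
  "state K i \<omega> = run (take (i * mesh K) (window_moves K \<omega>)) {}"

definition block_bound :: real where "block_bound = lam * exp (- (lam + t))"

lemma right_edge: "y - real K + 1 / real (mesh K) * real (K * mesh K) = y"
  using mesh_pos[of K] by simp

lemma grid: "poisson_grid M N P lam (y - real K) (1 / real (mesh K)) (t / real (mesh K)) (K * mesh K)"
proof
  show "y - real K + 1 / real (mesh K) * real (K * mesh K) < 0" unfolding right_edge by (rule y)
qed (use mesh_pos[of K] t in auto)

lemma grid_rate:
  "poisson_grid.rate lam (1 / real (mesh K)) (t / real (mesh K)) (mesh K) = (lam + t) / real (mesh K)"
proof -
  interpret G: poisson_grid M N P lam "y - real K" "1 / real (mesh K)" "t / real (mesh K)" "K * mesh K" "mesh K"
    by (rule grid)
  show ?thesis unfolding G.rate_def using mesh_pos[of K] by (simp add: field_simps)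
qed

lemma AE_eventually_good: "AE \<omega> in M. eventually (\<lambda>K. window_good K \<omega>) sequentially"
proof -
  let ?A = "\<lambda>K. {\<omega> \<in> space M. \<not> window_good K \<omega>}"
  let ?C = "(lam + t)\<^sup>2 + t\<^sup>2"
  have A: "?A K \<in> events" "prob (?A K) \<le> ?C * inverse (real (Suc K) ^ 2)" for K
  proof -
    interpret G: poisson_grid M N P lam "y - real K" "1 / real (mesh K)" "t / real (mesh K)" "K * mesh K" "mesh K"
      by (rule grid)
    show "?A K \<in> events" unfolding window_good_def by (rule G.grid_bad_prob)
    have b: "real (mesh K) = real (Suc K) ^ 4" by (simp add: mesh_def)
    have "prob (?A K) \<le> real (K * mesh K) * ((lam + t) / real (mesh K))\<^sup>2 +
        real (mesh K) * (real (K * mesh K) * (1 / real (mesh K)) * (t / real (mesh K)))\<^sup>2"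
      unfolding window_good_def using G.grid_bad_prob(2) unfolding grid_rate .
    also have "\<dots> = (real K * (lam + t)\<^sup>2 + (real K)\<^sup>2 * t\<^sup>2) / real (mesh K)"
      using mesh_pos[of K] by (simp add: power2_eq_square field_simps)
    also have "\<dots> \<le> ((real (Suc K))\<^sup>2 * (lam + t)\<^sup>2 + (real (Suc K))\<^sup>2 * t\<^sup>2) / real (mesh K)"
    proof (intro divide_right_mono add_mono mult_right_mono)
      show "real K \<le> (real (Suc K))\<^sup>2" by (simp add: power2_eq_square algebra_simps)
      show "(real K)\<^sup>2 \<le> (real (Suc K))\<^sup>2" by (intro power_mono) auto
    qed auto
    also have "\<dots> = (real (Suc K))\<^sup>2 * ?C / ((real (Suc K))\<^sup>2 * (real (Suc K))\<^sup>2)"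
      unfolding b by (simp add: algebra_simps power4_eq_xxxx power2_eq_square)
    also have "\<dots> = ?C * inverse (real (Suc K) ^ 2)"
    proof -
      have *: "L * c / (L * L) = c * inverse L" if "L \<noteq> 0" for L c :: real
        using that by (simp add: field_simps)
      show ?thesis by (rule *) simp
    qed
    finally show "prob (?A K) \<le> ?C * inverse (real (Suc K) ^ 2)" .
  qed
  have "summable (\<lambda>K. ?C * inverse (real (Suc K) ^ 2))"
    using inverse_power_summable[of 2, where 'a = real]
    by (intro summable_mult) (subst summable_Suc_iff[of "\<lambda>K. inverse (real K ^ 2)"], simp)
  then have "summable (\<lambda>K. prob (?A K))"
    by (rule summable_comparison_test') (use A(2) in auto)
  then have "AE \<omega> in M. eventually (\<lambda>K. \<omega> \<in> space M - ?A K) sequentially"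
    using A(1) by (intro borel_cantelli_AE1) (auto simp: emeasure_eq_measure)
  then show ?thesis by (rule AE_mp) (auto elim: eventually_mono)
qed

lemma state_level:
  assumes finN: "\<And>B. bounded B \<Longrightarrow> finite (N \<omega> \<inter> B)" and finP: "\<And>B. bounded B \<Longrightarrow> finite (P \<omega> \<inter> B)"
    and good: "window_good K \<omega>" and i: "i \<le> K"
  shows "excess_level (N \<omega>) (P \<omega>) (y - real K) (y - real K + real i) t (card (state K i \<omega>))"
proof -
  let ?b = "mesh K"
  let ?s = "run (grid_moves (N \<omega>) (P \<omega>) (y - real K) (1 / real ?b) (t / real ?b) (i * ?b) ?b) {}"
  have b: "0 < real ?b" using mesh_pos[of K] by simp
  have "take (i * ?b) [0..<K * ?b] = [0..<i * ?b]" using i by (simp add: take_upt)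
  then have st: "state K i \<omega> = ?s"
    unfolding state_def window_moves_def grid_moves_def by (simp add: take_map)
  have "excess_level (N \<omega>) (P \<omega>) (y - real K) (y - real K + 1 / real ?b * real (i * ?b)) (t / real ?b * real ?b) (cnt ?s ?b)"
  proof (rule excess_level_grid)
    show "finite (N \<omega> \<inter> {y - real K<..y - real K + 1 / real ?b * real (K * ?b)})"
      by (intro finN) simp
    show "finite (P \<omega> \<inter> ({y - real K<..y - real K + 1 / real ?b * real (K * ?b)} \<times> {0<..t / real ?b * real ?b}))"
      by (intro finP bounded_Times) simp_all
  qed (use b t i good window_good_def in auto)
  moreover have "?s \<subseteq> {1..?b}"
    by (rule run_in_Pow) (use column_move_in in \<open>auto simp: grid_moves_def\<close>)
  then have "?s \<inter> {..?b} = ?s" by auto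
  ultimately show ?thesis using b st by simp
qed

lemma window_stat_tail:
  shows "iid_columns.stat (mesh K) ((t / real (mesh K)) / lam) (\<lambda>s. of_bool (d < card s)) \<le> t / lam / real (Suc d)"
proof -
  interpret G: poisson_grid M N P lam "y - real K" "1 / real (mesh K)" "t / real (mesh K)" "K * mesh K" "mesh K"
    by (rule grid)
  have "real (mesh K) * (t / real (mesh K) / lam) = t / lam" using mesh_pos[of K] by simp
  then show ?thesis using G.cols.stat_card_tail[of d] by simp
qed

lemma block_bound_pos: "0 < block_bound" using lam by (simp add: block_bound_def)

lemma block_bound_le: "block_bound \<le> 1"
proof -
  have "lam \<le> exp (lam + t)" using exp_ge_add_one_self[of "lam + t"] t by linarith
  then have "lam * exp (- (lam + t)) \<le> exp (lam + t) * exp (- (lam + t))" by (intro mult_right_mono) auto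
  also have "\<dots> = 1" by (simp only: exp_minus_inverse)
  finally show ?thesis by (simp add: block_bound_def)
qed

lemma state_persists:
  assumes "k * d \<le> q" "q \<le> K"
  shows "{\<omega> \<in> space M. \<forall>i\<le>q. state K (K - i) \<omega> \<noteq> {}} \<in> events"
    and "prob {\<omega> \<in> space M. \<forall>i\<le>q. state K (K - i) \<omega> \<noteq> {}} \<le> (1 - block_bound ^ d) ^ k + t / lam / real (Suc d)"
proof -
  let ?b = "mesh K"
  interpret G: poisson_grid M N P lam "y - real K" "1 / real ?b" "t / real ?b" "K * ?b" "?b"
    by (rule grid)
  have rate: "real ?b * G.rate = lam + t" unfolding grid_rate using mesh_pos[of K] by simp
  have c: "block_bound \<le> G.cols.mean ?b (\<lambda>ys. of_bool (G.cols.drains 1 ys))"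
    using G.block_drains[of ?b] mesh_pos[of K] unfolding rate block_bound_def by simp
  let ?R = "\<lambda>xs. \<forall>i\<le>q. run (take ((K - i) * ?b) xs) {} \<noteq> {}"
  have ev: "{\<omega> \<in> space M. \<forall>i\<le>q. state K (K - i) \<omega> \<noteq> {}} = {\<omega> \<in> space M. ?R (G.moves_of \<omega>)}"
    by (simp add: state_def window_moves_def)
  show "{\<omega> \<in> space M. \<forall>i\<le>q. state K (K - i) \<omega> \<noteq> {}} \<in> events" unfolding ev by (rule G.moves_event(1))
  have len: "K * ?b = (K - k * d) * ?b + k * (d * ?b)"
    using assms by (simp add: algebra_simps diff_mult_distrib)
  have "prob {\<omega> \<in> space M. ?R (G.moves_of \<omega>)} = G.cols.mean (K * ?b) (\<lambda>xs. of_bool (?R xs))"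
    by (rule G.moves_event(2))
  also have "\<dots> \<le> G.cols.mean (K * ?b) (\<lambda>xs. of_bool (\<forall>j\<le>k. run (take ((K - k * d) * ?b + j * (d * ?b)) xs) {} \<noteq> {}))"
  proof (rule G.cols.mean_mono)
    fix xs :: "nat option list"
    have "run (take ((K - k * d) * ?b + j * (d * ?b)) xs) {} \<noteq> {}" if "?R xs" "j \<le> k" for j
    proof -
      have "j * d \<le> k * d" using that(2) by simp
      then have "(K - k * d) * ?b + j * (d * ?b) = (K - (k * d - j * d)) * ?b"
        using assms by (simp add: algebra_simps diff_mult_distrib)
      moreover have "k * d - j * d \<le> q" using assms by simp
      ultimately show ?thesis using that(1) by metis
    qed
    then show "of_bool (?R xs) \<le> (of_bool (\<forall>j\<le>k. run (take ((K - k * d) * ?b + j * (d * ?b)) xs) {} \<noteq> {}) :: real)"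
      by auto
  qed
  also have "\<dots> \<le> (1 - block_bound ^ d) ^ k + t / lam / real (Suc d)"
    unfolding len using c block_bound_pos window_stat_tail by (intro G.cols.nonempty_persistent) auto
  finally show "prob {\<omega> \<in> space M. \<forall>i\<le>q. state K (K - i) \<omega> \<noteq> {}} \<le> (1 - block_bound ^ d) ^ k + t / lam / real (Suc d)"
    unfolding ev .
qed

lemma small_coupling:
  assumes "0 < \<epsilon>"
  obtains d k where "(1 - block_bound ^ d) ^ k + t / lam / real (Suc d) \<le> \<epsilon>"
proof -
  \<comment> \<open>choose \<open>d\<close> first to make crowded states rare, then \<open>k\<close> to see a good block\<close>
  obtain d :: nat where d: "2 * (t / lam) / \<epsilon> < real d" using reals_Archimedean2 by blast
  then have "2 * (t / lam) < real d * \<epsilon>" using pos_divide_less_eq[OF assms] by blast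
  also have "real d * \<epsilon> \<le> real (Suc d) * \<epsilon>" using assms by (intro mult_right_mono) auto
  finally have "2 * (t / lam) < real (Suc d) * \<epsilon>" .
  moreover have half: "u / v \<le> \<epsilon> / 2" if "2 * u < v * \<epsilon>" "0 < v" for u v :: real
    using that by (simp add: field_simps)
  ultimately have "t / lam / real (Suc d) \<le> \<epsilon> / 2" by (intro half) auto
  moreover have "0 \<le> 1 - block_bound ^ d" "1 - block_bound ^ d < 1"
    using block_bound_pos block_bound_le by (auto intro: power_le_one)
  then obtain k where "(1 - block_bound ^ d) ^ k < \<epsilon> / 2"
    using real_arch_pow_inv[of "\<epsilon> / 2" "1 - block_bound ^ d"] assms by auto
  ultimately have "(1 - block_bound ^ d) ^ k + t / lam / real (Suc d) \<le> \<epsilon>" by linarith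
  then show thesis by (rule that)
qed

text \<open>
  By the variational formula no particle crosses \<open>x\<close> up to time \<open>t\<close>.
\<close>

definition quiet :: "'a \<Rightarrow> real \<Rightarrow> bool" where
  "quiet \<omega> x \<longleftrightarrow> (\<forall>z\<le>x. last_passage (P \<omega>) z x t \<le> card (N \<omega> \<inter> {z<..x}))"

text \<open>
  If every \<open>y - i\<close> is crossed, then for every \<open>q\<close> and all large \<open>K\<close> the chain started at \<open>y - K\<close> is
  nonempty at \<open>y - i\<close> for all \<open>i \<le> q\<close>. By \<open>state_persists\<close> the probability of this is arbitrarily
  small for suitable \<open>q\<close>, uniformly in \<open>K\<close>.
\<close>

lemma AE_quiet: "AE \<omega> in M. \<exists>i::nat. quiet \<omega> (y - real i)"
proof -
  let ?D = "\<lambda>q K. {\<omega> \<in> space M. \<forall>i\<le>q. state K (K - i) \<omega> \<noteq> {}}"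
  let ?F = "\<lambda>q J. \<Inter>K\<in>{J..}. ?D q (q + K)"
  define bad where "bad = (\<Inter>q. \<Union>J. ?F q J)"
  have D: "?D q (q + K) \<in> events" for q K by (rule state_persists(1)[of 0 0]) auto
  have F: "?F q J \<in> events" for q J
  proof (rule sets.countable_INT')
    show "(\<lambda>K. ?D q (q + K)) ` {J..} \<subseteq> events" using D by blast
  qed auto
  have U: "(\<Union>J. ?F q J) \<in> events" for q
    by (rule sets.countable_UN) (use F in blast)
  have bad: "bad \<in> events" unfolding bad_def
    by (rule sets.countable_INT) (use U in blast, simp)
  have "prob bad \<le> 0 + \<epsilon>" if eps: "0 < \<epsilon>" for \<epsilon>
  proof -
    obtain d k where dk: "(1 - block_bound ^ d) ^ k + t / lam / real (Suc d) \<le> \<epsilon>"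
      using small_coupling[OF eps] .
    \<comment> \<open>\<open>k\<close> blocks of \<open>d\<close> unit lengths each\<close>
    define q where "q = k * d"
    have Fle: "prob (?F q J) \<le> \<epsilon>" for J
    proof -
      have "prob (?F q J) \<le> prob (?D q (q + J))" by (intro finite_measure_mono D) blast
      also have "\<dots> \<le> \<epsilon>" using state_persists(2)[of k d q "q + J"] dk by (simp add: q_def)
      finally show ?thesis .
    qed
    have "incseq (?F q)" by (intro incseq_SucI INF_superset_mono order_refl) auto
    then have "(\<lambda>J. prob (?F q J)) \<longlonglongrightarrow> prob (\<Union>J. ?F q J)"
      using F by (intro finite_Lim_measure_incseq) blast
    then have "prob (\<Union>J. ?F q J) \<le> \<epsilon>" by (rule LIMSEQ_le_const2) (use Fle in blast)
    moreover have "prob bad \<le> prob (\<Union>J. ?F q J)"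
      by (rule finite_measure_mono[OF _ U]) (simp only: bad_def, blast)
    ultimately show ?thesis by simp
  qed
  then have "prob bad \<le> 0" by (rule field_le_epsilon)
  then have "prob bad = 0" using measure_nonneg[of M bad] by linarith
  then have "bad \<in> null_sets M" using bad by (simp add: null_sets_def emeasure_eq_measure)
  then have notbad: "AE \<omega> in M. \<omega> \<notin> bad" by (rule AE_not_in)
  show ?thesis
    using notbad AE_N_finite AE_P_finite AE_eventually_good AE_space
  proof eventually_elim
    case (elim \<omega>)
    have finN: "\<And>B. bounded B \<Longrightarrow> finite (N \<omega> \<inter> B)" and finP: "\<And>B. bounded B \<Longrightarrow> finite (P \<omega> \<inter> B)"
      using elim by auto
    obtain G where G: "\<And>K. G \<le> K \<Longrightarrow> window_good K \<omega>"
      using elim(4) unfolding eventually_sequentially by blast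
    show ?case
    proof (rule ccontr)
      assume none: "\<not> (\<exists>i. quiet \<omega> (y - real i))"
      have "\<exists>J. \<forall>K\<ge>J. state K (K - i) \<omega> \<noteq> {}" for i
      proof -
        obtain z where z: "z \<le> y - real i" "card (N \<omega> \<inter> {z<..y - real i}) < last_passage (P \<omega>) z (y - real i) t"
          using none unfolding quiet_def by (meson not_le)
        obtain J :: nat where J: "y - z \<le> real J" using real_arch_simple by blast
        have "state K (K - i) \<omega> \<noteq> {}" if K: "K \<ge> max (max J i) G" for K
        proof -
          have "excess_level (N \<omega>) (P \<omega>) (y - real K) (y - real K + real (K - i)) t (card (state K (K - i) \<omega>))"
            using K G by (intro state_level finN finP) auto
          moreover have "y - real K + real (K - i) = y - real i" using K by (simp add: of_nat_diff)
          moreover have "real J \<le> real K" using K by simp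
          then have "y - real K \<le> z" using J by linarith
          ultimately have "last_passage (P \<omega>) z (y - real i) t \<le> card (N \<omega> \<inter> {z<..y - real i}) + card (state K (K - i) \<omega>)"
            using z(1) unfolding excess_level_def by auto
          then show ?thesis using z(2) by auto
        qed
        then show ?thesis by blast
      qed
      then obtain J where J: "\<And>i K. J i \<le> K \<Longrightarrow> state K (K - i) \<omega> \<noteq> {}" by metis
      have "\<omega> \<in> ?F q (Max (J ` {..q}))" for q
      proof -
        have "state (q + K) (q + K - i) \<omega> \<noteq> {}" if "K \<ge> Max (J ` {..q})" "i \<le> q" for K i
        proof -
          have "J i \<le> Max (J ` {..q})" using that(2) by (intro Max_ge) auto
          also have "\<dots> \<le> q + K" using that(1) by (rule trans_le_add2)
          finally show ?thesis by (rule J)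
        qed
        then show ?thesis using elim(5) by auto
      qed
      then have "\<omega> \<in> bad" unfolding bad_def by blast
      then show False using elim(1) by blast
    qed
  qed
qed

lemma AE_distinct_times:
  "AE \<omega> in M. \<forall>u u' s. (u, s) \<in> P \<omega> \<longrightarrow> (u', s) \<in> P \<omega> \<longrightarrow> u \<le> y \<longrightarrow> u' \<le> y \<longrightarrow> s \<le> t \<longrightarrow> u = u'"
proof -
  have "AE \<omega> in M. P \<omega> \<subseteq> UNIV \<times> {0<..}"
    using poisson_P[unfolded poisson_point_process_def, THEN conjunct1] by (auto elim: eventually_mono)
  then show ?thesis
    using AE_P_finite AE_eventually_good
  proof eventually_elim
    case (elim \<omega>)
    show ?case
    proof (intro allI impI)
      fix u u' s assume us: "(u, s) \<in> P \<omega>" "(u', s) \<in> P \<omega>" "u \<le> y" "u' \<le> y" "s \<le> t"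
      have s0: "0 < s" using us(1) elim(1) by auto
      obtain G where G: "\<And>K. G \<le> K \<Longrightarrow> window_good K \<omega>"
        using elim(3) unfolding eventually_sequentially by blast
      \<comment> \<open>two points of equal time would share a row of every large window\<close>
      obtain J :: nat where J: "max (y - u) (y - u') < real J" using reals_Archimedean2 by blast
      define K where "K = max G J"
      have JK: "real J \<le> real K" by (simp add: K_def)
      let ?b = "mesh K"
      have b: "0 < real ?b" using mesh_pos[of K] by simp
      obtain j where j: "1 \<le> j" "j \<le> ?b" "s \<in> slab (t / real ?b) j"
        using slab_cover[of "t / real ?b" s ?b] b t s0 us(5) by auto
      let ?R = "P \<omega> \<inter> ({y - real K<..y} \<times> slab (t / real ?b) j)"
      have "window_good K \<omega>" by (intro G) (simp add: K_def)
      then have "card ?R \<le> 1" using j unfolding window_good_def grid_good_def right_edge by auto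
      moreover have "bounded ({y - real K<..y} \<times> slab (t / real ?b) j)"
        by (intro bounded_Times bounded_slab) simp
      then have "finite ?R" using elim(2) by blast
      moreover have "(u, s) \<in> ?R" "(u', s) \<in> ?R" using us J JK j by auto
      ultimately show "u = u'" by (metis One_nat_def card_le_Suc0_iff_eq prod.inject)
    qed
  qed
qed

abbreviation gap :: "'a \<Rightarrow> nat" where "gap \<omega> \<equiv> card (N \<omega> \<inter> {y<..<0})"

text \<open>
  Enlarging the window increases the level at \<open>y\<close> to the full supremum, and almost surely all
  large windows are read off correctly.
\<close>

lemma tagged_position_AE:
  assumes "AE \<omega> in M. hammersley_process (insert 0 (N \<omega>)) (P \<omega>) (X \<omega>)"
  shows "AE \<omega> in M. eventually (\<lambda>K. gap \<omega> < card (state K K \<omega>) \<longleftrightarrow> X \<omega> 0 t \<le> y) sequentially"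
  using assms AE_quiet AE_distinct_times AE_N_finite AE_P_finite AE_eventually_good
proof eventually_elim
  case (elim \<omega>)
  have finN: "\<And>B. bounded B \<Longrightarrow> finite (N \<omega> \<inter> B)" and finP: "\<And>B. bounded B \<Longrightarrow> finite (P \<omega> \<inter> B)"
    using elim by auto
  obtain i where i: "quiet \<omega> (y - real i)" using elim(2) by blast
  have iff: "X \<omega> 0 t \<le> y \<longleftrightarrow> (\<exists>z\<le>y. card (N \<omega> \<inter> {z<..y}) + gap \<omega> < last_passage (P \<omega>) z y t)"
    by (rule tagged_position_iff[OF elim(1) finN finP _ y, of t "y - real i"])
       (use i elim(3) t in \<open>auto simp: quiet_def\<close>)
  obtain G where G: "\<And>K. G \<le> K \<Longrightarrow> window_good K \<omega>"
    using elim(6) unfolding eventually_sequentially by blast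
  have lev: "excess_level (N \<omega>) (P \<omega>) (y - real K) y t (card (state K K \<omega>))" if "G \<le> K" for K
    using state_level[OF finN finP G[OF that] order_refl] by simp
  show ?case
  proof (cases "X \<omega> 0 t \<le> y")
    case True
    then obtain z where z: "z \<le> y" "card (N \<omega> \<inter> {z<..y}) + gap \<omega> < last_passage (P \<omega>) z y t"
      using iff by blast
    obtain J :: nat where J: "y - z \<le> real J" using real_arch_simple by blast
    have "gap \<omega> < card (state K K \<omega>)" if "max G J \<le> K" for K
    proof -
      have "real J \<le> real K" using that by simp
      then have "y - real K \<le> z" using J by linarith
      then have "last_passage (P \<omega>) z y t \<le> card (N \<omega> \<inter> {z<..y}) + card (state K K \<omega>)"
        using lev[of K] that z(1) unfolding excess_level_def by auto
      then show ?thesis using z(2) by simp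
    qed
    then show ?thesis using True unfolding eventually_sequentially by blast
  next
    case False
    have "\<not> gap \<omega> < card (state K K \<omega>)" if GK: "G \<le> K" for K
    proof -
      obtain z where "z \<in> {y - real K..y}" "last_passage (P \<omega>) z y t = card (N \<omega> \<inter> {z<..y}) + card (state K K \<omega>)"
        using lev[OF GK] unfolding excess_level_def by blast
      moreover then have "\<not> card (N \<omega> \<inter> {z<..y}) + gap \<omega> < last_passage (P \<omega>) z y t"
        using False iff by auto
      ultimately show ?thesis by simp
    qed
    then show ?thesis using False unfolding eventually_sequentially by blast
  qed
qed

definition gap_cdf :: "nat \<Rightarrow> real" where "gap_cdf k = prob {\<omega> \<in> space M. gap \<omega> < k}"

text \<open>
  The gap is independent of the chain, so conditioning on the chain replaces the event by
  \<open>gap_cdf (card s)\<close>. The coupling compares the chain with its stationary law, which is binomial.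
\<close>

lemma state_law_limit:
  shows "{\<omega> \<in> space M. gap \<omega> < card (state K K \<omega>)} \<in> events"
    and "(\<lambda>K. prob {\<omega> \<in> space M. gap \<omega> < card (state K K \<omega>)}) \<longlonglongrightarrow>
      (\<Sum>k. (t / lam) ^ k / fact k * gap_cdf k) / exp (t / lam)"
proof -
  define \<mu> where "\<mu> = t / lam"
  have mu: "0 < \<mu>" using t lam by (simp add: \<mu>_def)
  have cdf: "0 \<le> gap_cdf k" "gap_cdf k \<le> 1" for k by (auto simp: gap_cdf_def)
  define S where "S m = (\<Sum>k\<le>m. real (m choose k) * ((\<mu> / real m) ^ k * gap_cdf k)) / (1 + \<mu> / real m) ^ m" for m
  have facts: "{\<omega> \<in> space M. gap \<omega> < card (state K K \<omega>)} \<in> events \<and>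
     (\<forall>k d. k * d \<le> K \<longrightarrow> \<bar>prob {\<omega> \<in> space M. gap \<omega> < card (state K K \<omega>)} - S (mesh K)\<bar>
        \<le> (1 - block_bound ^ d) ^ k + t / lam / real (Suc d))" for K
  proof -
    let ?b = "mesh K"
    interpret G: poisson_grid M N P lam "y - real K" "1 / real ?b" "t / real ?b" "K * ?b" "?b"
      by (rule grid)
    have rate: "real ?b * G.rate = lam + t" unfolding grid_rate using mesh_pos[of K] by simp
    have c: "block_bound \<le> G.cols.mean ?b (\<lambda>ys. of_bool (G.cols.drains 1 ys))"
      using G.block_drains[of ?b] mesh_pos[of K] unfolding rate block_bound_def by simp
    have "state K K \<omega> = run (G.moves_of \<omega>) {}" for \<omega>
      unfolding state_def window_moves_def by (simp add: G.moves_of_in(1))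
    then have ev: "{\<omega> \<in> space M. gap \<omega> < card (state K K \<omega>)} =
        {\<omega> \<in> space M. G.gap_count \<omega> \<in> {..<card (run (G.moves_of \<omega>) {})}}"
      unfolding right_edge by simp
    have 1: "{\<omega> \<in> space M. gap \<omega> < card (state K K \<omega>)} \<in> events"
      unfolding ev by (rule G.moves_law(1))
    have p: "prob {\<omega> \<in> space M. gap \<omega> < card (state K K \<omega>)} = G.cols.mean (K * ?b) (\<lambda>xs. gap_cdf (card (run xs {})))"
      unfolding ev G.moves_law(2)[of "\<lambda>xs. {..<card (run xs {})}"] unfolding right_edge gap_cdf_def by simp
    have r: "t / real ?b / lam = \<mu> / real ?b" by (simp add: \<mu>_def)
    have s: "G.cols.stat (\<lambda>s. gap_cdf (card s)) = S ?b"
      using G.cols.stat_card[of gap_cdf] unfolding S_def r .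
    have 2: "\<bar>prob {\<omega> \<in> space M. gap \<omega> < card (state K K \<omega>)} - S ?b\<bar>
        \<le> (1 - block_bound ^ d) ^ k + t / lam / real (Suc d)" if kd: "k * d \<le> K" for k d
    proof -
      have len: "K * ?b = (K - k * d) * ?b + k * (d * ?b)"
        using kd by (simp add: algebra_simps diff_mult_distrib)
      show ?thesis
        unfolding p s[symmetric] unfolding len
        using c block_bound_pos window_stat_tail cdf by (intro G.cols.coupling_empty_start) auto
    qed
    show ?thesis using 1 2 by blast
  qed
  then show "{\<omega> \<in> space M. gap \<omega> < card (state K K \<omega>)} \<in> events" by blast
  have "filterlim mesh at_top sequentially"
  proof (rule filterlim_at_top_mono[OF filterlim_ident])
    have "K \<le> mesh K" for K
      using self_le_power[of "K + 1" 4] by (simp add: mesh_def)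
    then show "\<forall>\<^sub>F K in sequentially. K \<le> mesh K" by simp
  qed
  then have Slim: "(\<lambda>K. S (mesh K)) \<longlonglongrightarrow> (\<Sum>k. \<mu> ^ k / fact k * gap_cdf k) / exp \<mu>"
    using tendsto_binomial_poisson[of \<mu> gap_cdf, OF mu cdf]
    unfolding S_def by (rule filterlim_compose[rotated])
  have "(\<lambda>K. prob {\<omega> \<in> space M. gap \<omega> < card (state K K \<omega>)} - S (mesh K)) \<longlonglongrightarrow> 0"
  proof (rule LIMSEQ_I)
    fix \<epsilon> :: real assume "0 < \<epsilon>"
    then obtain d k where dk: "(1 - block_bound ^ d) ^ k + t / lam / real (Suc d) \<le> \<epsilon> / 2"
      using small_coupling[of "\<epsilon> / 2"] by auto
    have "norm (prob {\<omega> \<in> space M. gap \<omega> < card (state K K \<omega>)} - S (mesh K) - 0) < \<epsilon>" if "k * d \<le> K" for K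
    proof -
      have "\<bar>prob {\<omega> \<in> space M. gap \<omega> < card (state K K \<omega>)} - S (mesh K)\<bar> \<le> \<epsilon> / 2"
        using facts[of K] that dk by (meson order_trans)
      then show ?thesis using \<open>0 < \<epsilon>\<close> by simp
    qed
    then show "\<exists>no. \<forall>K\<ge>no. norm (prob {\<omega> \<in> space M. gap \<omega> < card (state K K \<omega>)} - S (mesh K) - 0) < \<epsilon>" by blast
  qed
  from tendsto_add[OF this Slim]
  show "(\<lambda>K. prob {\<omega> \<in> space M. gap \<omega> < card (state K K \<omega>)}) \<longlonglongrightarrow>
      (\<Sum>k. (t / lam) ^ k / fact k * gap_cdf k) / exp (t / lam)"
    by (simp add: \<mu>_def)
qed

lemma gap_cdf_eq: "gap_cdf k = (\<Sum>j<k. (lam * - y) ^ j / fact j * exp (- (lam * - y)))"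
proof -
  let ?E = "\<lambda>j. {\<omega> \<in> space M. gap \<omega> = j}"
  have B: "{y<..<0} \<in> sets borel" "bounded {y<..<0}" by auto
  have ev: "?E j \<in> events" for j
  proof -
    have "?E j = gap -` {j} \<inter> space M" by auto
    then show ?thesis using N_count_measurable[OF B] by (auto intro: measurable_sets)
  qed
  have "{\<omega> \<in> space M. gap \<omega> < k} = (\<Union>j\<in>{..<k}. ?E j)" by auto
  then have "gap_cdf k = prob (\<Union>j\<in>{..<k}. ?E j)" by (simp add: gap_cdf_def)
  also have "\<dots> = (\<Sum>j<k. prob (?E j))"
    using ev by (intro finite_measure_finite_Union) (auto simp: disjoint_family_on_def)
  also have "\<dots> = (\<Sum>j<k. (lam * - y) ^ j / fact j * exp (- (lam * - y)))"
    using N_count_prob[OF B] y by simp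
  finally show ?thesis .
qed

text \<open>
  With \<open>u = - y\<close> this is \<open>P(- X \<ge> u) = P(A < F)\<close> for independent Poisson variables \<open>F\<close> of mean
  \<open>t / lam\<close> and \<open>A\<close> of mean \<open>lam * u\<close>.
\<close>

lemma tagged_position_cdf:
  assumes hp: "AE \<omega> in M. hammersley_process (insert 0 (N \<omega>)) (P \<omega>) (X \<omega>)"
    and meas: "(\<lambda>\<omega>. X \<omega> 0 t) \<in> borel_measurable M"
  shows "prob {\<omega> \<in> space M. X \<omega> 0 t \<le> y} =
    (\<Sum>k. (t / lam) ^ k / fact k * (\<Sum>j<k. (lam * - y) ^ j / fact j * exp (- (lam * - y)))) / exp (t / lam)"
proof -
  let ?E = "\<lambda>K. {\<omega> \<in> space M. gap \<omega> < card (state K K \<omega>)}"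
  let ?X = "{\<omega> \<in> space M. X \<omega> 0 t \<le> y}"
  have Xev: "?X \<in> events" using meas by measurable
  have "(\<lambda>K. integral\<^sup>L M (indicator (?E K) :: 'a \<Rightarrow> real)) \<longlonglongrightarrow> integral\<^sup>L M (indicator ?X :: 'a \<Rightarrow> real)"
  proof (rule integral_dominated_convergence[where w = "\<lambda>_. 1"])
    show "AE \<omega> in M. (\<lambda>K. indicator (?E K) \<omega> :: real) \<longlonglongrightarrow> indicator ?X \<omega>"
      using tagged_position_AE[OF hp]
    proof eventually_elim
      case (elim \<omega>)
      then have "eventually (\<lambda>K. indicator (?E K) \<omega> = (indicator ?X \<omega> :: real)) sequentially"
        by (rule eventually_mono) (auto simp: indicator_def)
      then show ?case by (rule tendsto_eventually)
    qed
  qed (use state_law_limit(1) Xev in \<open>auto simp: indicator_def\<close>)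
  then have "(\<lambda>K. prob (?E K)) \<longlonglongrightarrow> prob ?X"
    using state_law_limit(1) Xev by simp
  from LIMSEQ_unique[OF this state_law_limit(2)] show ?thesis by (simp add: gap_cdf_eq)
qed

end

section \<open>Moments\<close>

lemma (in prob_space) nn_integral_tail:
  fixes Y :: "'a \<Rightarrow> real" and g G :: "real \<Rightarrow> real"
  assumes Y[measurable]: "Y \<in> borel_measurable M" and Y0: "\<And>\<omega>. 0 \<le> Y \<omega>"
    and g[measurable]: "g \<in> borel_measurable borel"
    and G: "\<And>x. DERIV G x :> g x" "\<And>x. 0 \<le> x \<Longrightarrow> 0 \<le> g x" "G 0 = 0"
  shows "(\<integral>\<^sup>+\<omega>. ennreal (G (Y \<omega>)) \<partial>M) =
     (\<integral>\<^sup>+u. ennreal (g u * prob {\<omega> \<in> space M. u \<le> Y \<omega>}) * indicator {0<..} u \<partial>lborel)"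
proof -
  interpret pair_sigma_finite M lborel
    by (intro pair_sigma_finite.intro sigma_finite_measure_axioms lborel.sigma_finite_measure_axioms)
  let ?f = "\<lambda>\<omega> u. ennreal (g u) * indicator {0..Y \<omega>} u"
  have ind: "?f \<omega> u = ennreal (g u) * (if 0 \<le> u \<and> u \<le> Y \<omega> then 1 else 0)" for \<omega> u
    by (auto simp: indicator_def)
  have meas: "case_prod ?f \<in> borel_measurable (M \<Otimes>\<^sub>M lborel)"
    unfolding ind by measurable
  have "(\<integral>\<^sup>+\<omega>. ennreal (G (Y \<omega>)) \<partial>M) = (\<integral>\<^sup>+\<omega>. (\<integral>\<^sup>+u. ?f \<omega> u \<partial>lborel) \<partial>M)"
  proof (rule nn_integral_cong)
    fix \<omega>
    have "(\<integral>\<^sup>+u. ?f \<omega> u \<partial>lborel) = ennreal (G (Y \<omega>) - G 0)"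
      using G(1,2) Y0 by (intro nn_integral_FTC_Icc) (auto simp: has_real_derivative_iff_has_vector_derivative intro: has_field_derivative_at_within)
    then show "ennreal (G (Y \<omega>)) = (\<integral>\<^sup>+u. ?f \<omega> u \<partial>lborel)" using G(3) by simp
  qed
  also have "\<dots> = (\<integral>\<^sup>+u. (\<integral>\<^sup>+\<omega>. ?f \<omega> u \<partial>M) \<partial>lborel)"
    by (rule Fubini'[symmetric, OF meas])
  also have "\<dots> = (\<integral>\<^sup>+u. ennreal (g u * prob {\<omega> \<in> space M. u \<le> Y \<omega>}) * indicator {0<..} u \<partial>lborel)"
  proof (rule nn_integral_cong_AE)
    have "AE u in lborel. u \<noteq> (0::real)" by (rule AE_lborel_singleton)
    then show "AE u in lborel. (\<integral>\<^sup>+\<omega>. ?f \<omega> u \<partial>M) =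
       ennreal (g u * prob {\<omega> \<in> space M. u \<le> Y \<omega>}) * indicator {0<..} u"
    proof eventually_elim
      case (elim u)
      show ?case
      proof (cases "0 < u")
        case True
        have "(\<integral>\<^sup>+\<omega>. ?f \<omega> u \<partial>M) = (\<integral>\<^sup>+\<omega>. ennreal (g u) * indicator {\<omega> \<in> space M. u \<le> Y \<omega>} \<omega> \<partial>M)"
          using True by (intro nn_integral_cong) (auto simp: indicator_def)
        also have "\<dots> = ennreal (g u) * emeasure M {\<omega> \<in> space M. u \<le> Y \<omega>}"
          by (rule nn_integral_cmult_indicator) measurable
        also have "\<dots> = ennreal (g u * prob {\<omega> \<in> space M. u \<le> Y \<omega>})"
          using G(2)[of u] True by (simp add: emeasure_eq_measure ennreal_mult)
        finally show ?thesis using True by simp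
      next
        case False
        then have "u < 0" using elim by simp
        then have "(\<integral>\<^sup>+\<omega>. ?f \<omega> u \<partial>M) = (\<integral>\<^sup>+\<omega>. 0 \<partial>M)" by (intro nn_integral_cong) (auto simp: indicator_def)
        then show ?thesis using False by simp
      qed
    qed
  qed
  finally show ?thesis .
qed

text \<open>
  As a function of \<open>u\<close>, the Poisson probability of \<open>j\<close> points in an interval of length \<open>u\<close> is
  \<open>1 / l\<close> times an Erlang density, whose moments are known.
\<close>

lemma nn_integral_poisson_power:
  fixes l :: real
  assumes l: "0 < l"
  shows "(\<integral>\<^sup>+u. ennreal (u ^ i * ((l * u) ^ j / fact j * exp (- (l * u)))) * indicator {0<..} u \<partial>lborel) =
     ennreal (fact (j + i) / (fact j * l ^ Suc i))"
proof -
  have "(\<integral>\<^sup>+u. ennreal (u ^ i * ((l * u) ^ j / fact j * exp (- (l * u)))) * indicator {0<..} u \<partial>lborel) =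
     (\<integral>\<^sup>+u. ennreal (1 / l) * ennreal (erlang_density j l u * u ^ i) \<partial>lborel)"
  proof (rule nn_integral_cong_AE)
    have "AE u in lborel. u \<noteq> (0::real)" by (rule AE_lborel_singleton)
    then show "AE u in lborel. ennreal (u ^ i * ((l * u) ^ j / fact j * exp (- (l * u)))) * indicator {0<..} u =
      ennreal (1 / l) * ennreal (erlang_density j l u * u ^ i)"
    proof eventually_elim
      case (elim u)
      show ?case
      proof (cases "0 < u")
        case True
        have "u ^ i * ((l * u) ^ j / fact j * exp (- (l * u))) = 1 / l * (erlang_density j l u * u ^ i)"
          using True l by (simp add: erlang_density_def power_mult_distrib field_simps)
        moreover have "0 \<le> erlang_density j l u * u ^ i" using True l by simp
        ultimately show ?thesis using True l by (simp add: ennreal_mult[symmetric])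
      next
        case False
        then show ?thesis using elim by (simp add: erlang_density_def)
      qed
    qed
  qed
  also have "\<dots> = ennreal (1 / l) * (\<integral>\<^sup>+u. ennreal (erlang_density j l u * u ^ i) \<partial>lborel)"
    by (rule nn_integral_cmult) measurable
  also have "\<dots> = ennreal (1 / l) * ennreal (fact (j + i) / (fact j * l ^ i))"
    using l by (subst nn_integral_erlang_ith_moment) auto
  also have "\<dots> = ennreal (fact (j + i) / (fact j * l ^ Suc i))"
    using l by (simp add: ennreal_mult[symmetric] field_simps)
  finally show ?thesis .
qed

lemma nn_integral_poisson_cdf_power:
  fixes l :: real
  assumes l: "0 < l"
  shows "(\<integral>\<^sup>+u. ennreal (u ^ i * (\<Sum>j<k. (l * u) ^ j / fact j * exp (- (l * u)))) * indicator {0<..} u \<partial>lborel) =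
     ennreal (\<Sum>j<k. fact (j + i) / (fact j * l ^ Suc i))"
proof -
  have "(\<integral>\<^sup>+u. ennreal (u ^ i * (\<Sum>j<k. (l * u) ^ j / fact j * exp (- (l * u)))) * indicator {0<..} u \<partial>lborel) =
     (\<integral>\<^sup>+u. (\<Sum>j<k. ennreal (u ^ i * ((l * u) ^ j / fact j * exp (- (l * u)))) * indicator {0<..} u) \<partial>lborel)"
  proof (rule nn_integral_cong)
    fix u :: real
    show "ennreal (u ^ i * (\<Sum>j<k. (l * u) ^ j / fact j * exp (- (l * u)))) * indicator {0<..} u =
       (\<Sum>j<k. ennreal (u ^ i * ((l * u) ^ j / fact j * exp (- (l * u)))) * indicator {0<..} u)"
    proof (cases "0 < u")
      case True
      then show ?thesis using l by (subst sum_distrib_left) (simp add: sum_ennreal)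
    qed simp
  qed
  also have "\<dots> = (\<Sum>j<k. ennreal (fact (j + i) / (fact j * l ^ Suc i)))"
    by (subst nn_integral_sum) (simp_all only: nn_integral_poisson_power[OF l], measurable)
  also have "\<dots> = ennreal (\<Sum>j<k. fact (j + i) / (fact j * l ^ Suc i))"
    using l by (intro sum_ennreal) auto
  finally show ?thesis .
qed

lemma poisson_mean_sums: "(\<lambda>k. (\<mu>::real) ^ k / fact k * real k) sums (\<mu> * exp \<mu>)"
proof -
  have "(\<lambda>k. \<mu> * (\<mu> ^ k / fact k)) sums (\<mu> * exp \<mu>)"
    using exp_converges[of \<mu>] by (intro sums_mult) (simp add: divide_inverse mult.commute)
  moreover have "\<mu> * (\<mu> ^ k / fact k) = \<mu> ^ Suc k / fact (Suc k) * real (Suc k)" for k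
    by (simp add: field_simps del: of_nat_Suc)
  ultimately have "(\<lambda>k. \<mu> ^ Suc k / fact (Suc k) * real (Suc k)) sums (\<mu> * exp \<mu>)" by simp
  then show ?thesis by (subst (asm) sums_Suc_iff) simp
qed

lemma poisson_second_sums: "(\<lambda>k. (\<mu>::real) ^ k / fact k * (real k * (real k + 1))) sums ((\<mu>\<^sup>2 + 2 * \<mu>) * exp \<mu>)"
proof -
  have "(\<lambda>k. \<mu> * (\<mu> ^ k / fact k * real k) + 2 * \<mu> * (\<mu> ^ k / fact k)) sums (\<mu> * (\<mu> * exp \<mu>) + 2 * \<mu> * exp \<mu>)"
    using exp_converges[of \<mu>] by (intro sums_add sums_mult poisson_mean_sums) (simp add: divide_inverse mult.commute)
  moreover have "\<mu> * (\<mu> ^ k / fact k * real k) + 2 * \<mu> * (\<mu> ^ k / fact k) =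
      \<mu> ^ Suc k / fact (Suc k) * (real (Suc k) * (real (Suc k) + 1))" for k
  proof -
    have eq: "\<mu> ^ Suc k / fact (Suc k) * (real (Suc k) * (real (Suc k) + 1)) = \<mu> * (\<mu> ^ k / fact k) * (real (Suc k) + 1)"
      by (simp add: field_simps del: of_nat_Suc)
    show ?thesis unfolding eq by (simp add: algebra_simps add_divide_distrib)
  qed
  ultimately have "(\<lambda>k. \<mu> ^ Suc k / fact (Suc k) * (real (Suc k) * (real (Suc k) + 1))) sums
      (\<mu> * (\<mu> * exp \<mu>) + 2 * \<mu> * exp \<mu>)" by simp
  then have "(\<lambda>k. \<mu> ^ k / fact k * (real k * (real k + 1))) sums (\<mu> * (\<mu> * exp \<mu>) + 2 * \<mu> * exp \<mu>)"
    by (subst (asm) sums_Suc_iff) simp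
  then show ?thesis by (simp add: algebra_simps power2_eq_square)
qed

text \<open>
  The function \<open>H\<close> is a Poisson mixture of the tails of Erlang laws, and the integral may be taken
  term by term because all terms are nonnegative.
\<close>

lemma nn_integral_compound_poisson_tail:
  fixes l \<mu> :: real and i :: nat
  assumes l: "0 < l" and mu: "0 < \<mu>" and H: "\<And>u. 0 < u \<Longrightarrow>
      H u = (\<Sum>k. \<mu> ^ k / fact k * (\<Sum>j<k. (l * u) ^ j / fact j * exp (- (l * u)))) / exp \<mu>"
    and S: "(\<lambda>k. \<mu> ^ k / fact k * (\<Sum>j<k. fact (j + i) / (fact j * l ^ Suc i))) sums (c * exp \<mu>)"
  shows "(\<integral>\<^sup>+u. ennreal (u ^ i * H u) * indicator {0<..} u \<partial>lborel) = ennreal c"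
proof -
  let ?h = "\<lambda>k u. \<Sum>j<k. (l * u) ^ j / fact j * exp (- (l * u))"
  let ?a = "\<lambda>k. \<mu> ^ k / fact k / exp \<mu>"
  have a0: "0 \<le> ?a k" for k using mu by simp
  have h0: "0 \<le> ?h k u" if "0 < u" for k u using that l by (intro sum_nonneg) auto
  have h1: "?h k u \<le> 1" if "0 < u" for k u
  proof -
    have "(\<Sum>j<k. (l * u) ^ j / fact j) \<le> exp (l * u)"
      using exp_converges[of "l * u"] that l
      by (intro sum_le_suminf[THEN order_trans, where f1 = "\<lambda>j. (l * u) ^ j / fact j"])
         (auto simp: sums_iff divide_inverse mult.commute)
    then have "(\<Sum>j<k. (l * u) ^ j / fact j) * exp (- (l * u)) \<le> exp (l * u) * exp (- (l * u))"
      by (intro mult_right_mono) auto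
    then show ?thesis by (simp add: sum_distrib_right exp_minus_inverse)
  qed
  have summ: "summable (\<lambda>k. ?a k * (u ^ i * ?h k u))" if "0 < u" for u
  proof (rule summable_comparison_test')
    show "summable (\<lambda>k. (\<mu> ^ k / fact k) * (u ^ i / exp \<mu>))"
      using exp_converges[of \<mu>] by (intro summable_mult2) (auto simp: sums_iff divide_inverse mult.commute)
    fix k
    have "?a k * (u ^ i * ?h k u) \<le> ?a k * (u ^ i * 1)"
      using that mu h1 by (intro mult_left_mono) auto
    then show "norm (?a k * (u ^ i * ?h k u)) \<le> (\<mu> ^ k / fact k) * (u ^ i / exp \<mu>)"
      using that mu a0[of k] h0[OF that, of k] by (simp add: abs_mult)
  qed
  have "(\<integral>\<^sup>+u. ennreal (u ^ i * H u) * indicator {0<..} u \<partial>lborel) =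
      (\<integral>\<^sup>+u. (\<Sum>k. ennreal (?a k) * (ennreal (u ^ i * ?h k u) * indicator {0<..} u)) \<partial>lborel)"
  proof (rule nn_integral_cong)
    fix u :: real
    show "ennreal (u ^ i * H u) * indicator {0<..} u =
        (\<Sum>k. ennreal (?a k) * (ennreal (u ^ i * ?h k u) * indicator {0<..} u))"
    proof (cases "0 < u")
      case True
      have summ0: "summable (\<lambda>k. \<mu> ^ k / fact k * ?h k u)"
      proof (rule summable_comparison_test')
        show "summable (\<lambda>k. \<mu> ^ k / fact k)"
          using exp_converges[of \<mu>] by (auto simp: sums_iff divide_inverse mult.commute)
        fix k show "norm (\<mu> ^ k / fact k * ?h k u) \<le> \<mu> ^ k / fact k"
          using mu h0[OF True, of k] h1[OF True, of k] by (simp add: abs_mult divide_right_mono mult_left_le)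
      qed
      have "u ^ i * H u = (\<Sum>k. (u ^ i / exp \<mu>) * (\<mu> ^ k / fact k * ?h k u))"
        unfolding H[OF True] using summ0 by (subst suminf_mult) auto
      also have "\<dots> = (\<Sum>k. ?a k * (u ^ i * ?h k u))"
        by (rule arg_cong[where f = suminf]) (simp add: fun_eq_iff mult_ac)
      finally have "ennreal (u ^ i * H u) = ennreal (\<Sum>k. ?a k * (u ^ i * ?h k u))" by simp
      also have "\<dots> = (\<Sum>k. ennreal (?a k * (u ^ i * ?h k u)))"
        using summ[OF True] a0 h0[OF True] True
        by (intro suminf_ennreal2[symmetric] mult_nonneg_nonneg) auto
      also have "\<dots> = (\<Sum>k. ennreal (?a k) * ennreal (u ^ i * ?h k u))"
        using a0 h0[OF True] True by (intro arg_cong[where f = suminf] ext ennreal_mult mult_nonneg_nonneg) auto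
      finally show ?thesis using True by simp
    qed simp
  qed
  also have "\<dots> = (\<Sum>k. \<integral>\<^sup>+u. ennreal (?a k) * (ennreal (u ^ i * ?h k u) * indicator {0<..} u) \<partial>lborel)"
    by (rule nn_integral_suminf) measurable
  also have "\<dots> = (\<Sum>k. ennreal (?a k) * ennreal (\<Sum>j<k. fact (j + i) / (fact j * l ^ Suc i)))"
    by (subst nn_integral_cmult) (measurable, simp only: nn_integral_poisson_cdf_power[OF l])
  also have "\<dots> = (\<Sum>k. ennreal (?a k * (\<Sum>j<k. fact (j + i) / (fact j * l ^ Suc i))))"
    using a0 l by (intro arg_cong[where f = suminf] ext ennreal_mult[symmetric] sum_nonneg) auto
  also have "\<dots> = ennreal c"
  proof -
    have "(\<lambda>k. (\<mu> ^ k / fact k * (\<Sum>j<k. fact (j + i) / (fact j * l ^ Suc i))) / exp \<mu>) sums (c * exp \<mu> / exp \<mu>)"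
      by (rule sums_divide[OF S])
    then have s: "(\<lambda>k. ?a k * (\<Sum>j<k. fact (j + i) / (fact j * l ^ Suc i))) sums c"
      by (simp add: field_simps)
    have "(\<Sum>k. ennreal (?a k * (\<Sum>j<k. fact (j + i) / (fact j * l ^ Suc i)))) =
        ennreal (\<Sum>k. ?a k * (\<Sum>j<k. fact (j + i) / (fact j * l ^ Suc i)))"
      using s a0 l by (intro suminf_ennreal2 mult_nonneg_nonneg sum_nonneg) (auto simp: sums_iff)
    then show ?thesis using s by (simp add: sums_iff)
  qed
  finally show ?thesis .
qed

context poisson_input
begin

lemma tagged_moments:
  assumes hp: "AE \<omega> in M. hammersley_process (insert 0 (N \<omega>)) (P \<omega>) (X \<omega>)"
    and meas: "(\<lambda>\<omega>. X \<omega> 0 t) \<in> borel_measurable M" and t: "0 < t"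
  shows "integrable M (\<lambda>\<omega>. X \<omega> 0 t)" "expectation (\<lambda>\<omega>. X \<omega> 0 t) = - (t / lam / lam)"
    and "integrable M (\<lambda>\<omega>. (X \<omega> 0 t)\<^sup>2)"
    and "expectation (\<lambda>\<omega>. (X \<omega> 0 t)\<^sup>2) = ((t / lam)\<^sup>2 + 2 * (t / lam)) / lam\<^sup>2"
proof -
  define \<mu> where "\<mu> = t / lam"
  have mu: "0 < \<mu>" using t lam by (simp add: \<mu>_def)
  define Y where "Y \<omega> = max 0 (- X \<omega> 0 t)" for \<omega>
  have Y[measurable]: "Y \<in> borel_measurable M" unfolding Y_def using meas by measurable
  have Y0: "0 \<le> Y \<omega>" for \<omega> by (simp add: Y_def)
  have XY: "AE \<omega> in M. X \<omega> 0 t = - Y \<omega>"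
    using hp
  proof eventually_elim
    case (elim \<omega>)
    interpret hammersley_path "insert 0 (N \<omega>)" "P \<omega>" "X \<omega>" by unfold_locales (rule elim)
    have "X \<omega> 0 t \<le> 0" using moves_left[of 0 t] t by simp
    then show ?case by (simp add: Y_def)
  qed
  define H where "H u = prob {\<omega> \<in> space M. u \<le> Y \<omega>}" for u
  have H: "H u = (\<Sum>k. \<mu> ^ k / fact k * (\<Sum>j<k. (lam * u) ^ j / fact j * exp (- (lam * u)))) / exp \<mu>"
    if u: "0 < u" for u
  proof -
    interpret L: poisson_half_line M N P lam "- u" t by unfold_locales (use u t in auto)
    have "{\<omega> \<in> space M. u \<le> Y \<omega>} = {\<omega> \<in> space M. X \<omega> 0 t \<le> - u}" using u by (auto simp: Y_def)
    then show ?thesis using L.tagged_position_cdf[OF hp meas] by (simp add: H_def \<mu>_def)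
  qed
  have sum1: "(\<lambda>k. \<mu> ^ k / fact k * (\<Sum>j<k. fact (j + 0) / (fact j * lam ^ Suc 0))) sums (\<mu> / lam * exp \<mu>)"
    using sums_divide[OF poisson_mean_sums[of \<mu>], of lam] by (simp add: field_simps)
  have E1: "(\<integral>\<^sup>+\<omega>. ennreal (Y \<omega>) \<partial>M) = ennreal (\<mu> / lam)"
  proof -
    have "(\<integral>\<^sup>+\<omega>. ennreal (Y \<omega>) \<partial>M) = (\<integral>\<^sup>+u. ennreal (1 * H u) * indicator {0<..} u \<partial>lborel)"
      unfolding H_def by (rule nn_integral_tail[OF Y Y0, where G = "\<lambda>x. x"]) auto
    also have "\<dots> = (\<integral>\<^sup>+u. ennreal (u ^ 0 * H u) * indicator {0<..} u \<partial>lborel)" by simp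
    also have "\<dots> = ennreal (\<mu> / lam)"
      by (rule nn_integral_compound_poisson_tail[OF lam mu H sum1])
    finally show ?thesis .
  qed
  have gauss: "(\<Sum>j<k. 2 * (real j + 1)) = real k * (real k + 1)" for k
    by (induction k) (auto simp: algebra_simps)
  have sum2: "(\<lambda>k. \<mu> ^ k / fact k * (\<Sum>j<k. fact (j + 1) / (fact j * lam ^ Suc 1))) sums
      ((\<mu>\<^sup>2 + 2 * \<mu>) / lam\<^sup>2 / 2 * exp \<mu>)"
  proof -
    have "(\<Sum>j<k. fact (j + 1) / (fact j * lam ^ Suc 1)) = (real k * (real k + 1)) / (2 * lam\<^sup>2)" for k
      unfolding gauss[symmetric] sum_divide_distrib using lam
      by (intro sum.cong) (auto simp: field_simps power2_eq_square)
    then show ?thesis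
      using sums_divide[OF poisson_second_sums[of \<mu>], of "2 * lam\<^sup>2"] by (simp add: field_simps)
  qed
  define c where "c = (\<mu>\<^sup>2 + 2 * \<mu>) / lam\<^sup>2"
  have c0: "0 \<le> c" using mu by (simp add: c_def)
  have E2: "(\<integral>\<^sup>+\<omega>. ennreal ((Y \<omega>)\<^sup>2) \<partial>M) = ennreal c"
  proof -
    have "(\<integral>\<^sup>+\<omega>. ennreal ((Y \<omega>)\<^sup>2) \<partial>M) = (\<integral>\<^sup>+u. ennreal (2 * u * H u) * indicator {0<..} u \<partial>lborel)"
      unfolding H_def
      by (rule nn_integral_tail[OF Y Y0, where G = "\<lambda>x. x\<^sup>2"]) (auto intro!: derivative_eq_intros)
    also have "\<dots> = (\<integral>\<^sup>+u. 2 * (ennreal (u ^ 1 * H u) * indicator {0<..} u) \<partial>lborel)"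
    proof (rule nn_integral_cong)
      fix u :: real
      show "ennreal (2 * u * H u) * indicator {0<..} u = 2 * (ennreal (u ^ 1 * H u) * indicator {0<..} u)"
      proof (cases "0 < u")
        case True
        have "ennreal (2 * (u * H u)) = ennreal 2 * ennreal (u * H u)"
          using True by (intro ennreal_mult) (auto simp: H_def)
        then show ?thesis using True by (simp add: mult.assoc)
      qed simp
    qed
    also have "\<dots> = 2 * (\<integral>\<^sup>+u. ennreal (u ^ 1 * H u) * indicator {0<..} u \<partial>lborel)"
    proof (rule nn_integral_cmult)
      have "antimono H" unfolding H_def by (intro antimonoI finite_measure_mono) auto
      then have "(\<lambda>u. - H u) \<in> borel_measurable borel"
        by (intro borel_measurable_mono) (auto simp: mono_def antimono_def)
      then have [measurable]: "H \<in> borel_measurable borel" by simp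
      show "(\<lambda>u. ennreal (u ^ 1 * H u) * indicator {0<..} u) \<in> borel_measurable lborel" by measurable
    qed
    also have "\<dots> = 2 * ennreal (c / 2)"
      using nn_integral_compound_poisson_tail[OF lam mu H sum2[folded c_def]] by simp
    also have "\<dots> = ennreal (2 * (c / 2))"
      using c0 by (subst ennreal_mult) auto
    finally show ?thesis by simp
  qed
  have I1: "integrable M Y"
    using E1 Y Y0 by (intro integrableI_nonneg) auto
  have I2: "integrable M (\<lambda>\<omega>. (Y \<omega>)\<^sup>2)"
    using E2 Y by (intro integrableI_nonneg) auto
  have V1: "expectation Y = \<mu> / lam"
    using E1 Y Y0 mu lam by (subst integral_eq_nn_integral) auto
  have V2: "expectation (\<lambda>\<omega>. (Y \<omega>)\<^sup>2) = (\<mu>\<^sup>2 + 2 * \<mu>) / lam\<^sup>2"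
    using E2 Y c0 unfolding c_def[symmetric] by (subst integral_eq_nn_integral) auto
  have meas2: "(\<lambda>\<omega>. (X \<omega> 0 t)\<^sup>2) \<in> borel_measurable M" using meas by measurable
  have XY2: "AE \<omega> in M. (X \<omega> 0 t)\<^sup>2 = (Y \<omega>)\<^sup>2" using XY by eventually_elim simp
  have negI: "integrable M (\<lambda>\<omega>. - Y \<omega>)" using I1 by simp
  show "integrable M (\<lambda>\<omega>. X \<omega> 0 t)"
    using integrable_cong_AE[OF meas _ XY] negI Y by auto
  show "expectation (\<lambda>\<omega>. X \<omega> 0 t) = - (t / lam / lam)"
    using integral_cong_AE[OF meas _ XY] Y V1 by (simp add: \<mu>_def)
  show "integrable M (\<lambda>\<omega>. (X \<omega> 0 t)\<^sup>2)"
    using integrable_cong_AE[OF meas2 _ XY2] I2 Y by auto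
  show "expectation (\<lambda>\<omega>. (X \<omega> 0 t)\<^sup>2) = ((t / lam)\<^sup>2 + 2 * (t / lam)) / lam\<^sup>2"
    using integral_cong_AE[OF meas2 _ XY2] Y V2 by (simp add: \<mu>_def)
qed

end

theorem theorem2:
  fixes M :: "'a measure"
    and N :: "'a \<Rightarrow> real set"
    and P :: "'a \<Rightarrow> (real \<times> real) set"
    and X :: "'a \<Rightarrow> real \<Rightarrow> real \<Rightarrow> real"
    and lam t :: real
  assumes "prob_space M"
    and "lam > 0"
    and "poisson_point_process M lam UNIV N"
    and "poisson_point_process M 1 (UNIV \<times> {0<..}) P"
    and "indep_point_processes M UNIV N (UNIV \<times> {0<..}) P"
    and "AE \<omega> in M. hammersley_process (insert 0 (N \<omega>)) (P \<omega>) (X \<omega>)"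
    and "\<And>s. s \<ge> 0 \<Longrightarrow> (\<lambda>\<omega>. X \<omega> 0 s) \<in> borel_measurable M"
    and "t \<ge> 0"
  shows "let \<mu>1 = - (1 / lam\<^sup>2); \<sigma>1 = sqrt (2 / lam ^ 3) in
           integrable M (\<lambda>\<omega>. X \<omega> 0 t) \<and>
           prob_space.expectation M (\<lambda>\<omega>. X \<omega> 0 t) = \<mu>1 * t \<and>
           integrable M (\<lambda>\<omega>. (X \<omega> 0 t)\<^sup>2) \<and>
           prob_space.variance M (\<lambda>\<omega>. X \<omega> 0 t) = \<sigma>1\<^sup>2 * t"
proof -
  interpret prob_space M by fact
  interpret poisson_input M N P lam by unfold_locales (use assms in auto)
  have sig: "(sqrt (2 / lam ^ 3))\<^sup>2 = 2 / lam ^ 3" using \<open>lam > 0\<close> by simp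
  have "integrable M (\<lambda>\<omega>. X \<omega> 0 t) \<and> expectation (\<lambda>\<omega>. X \<omega> 0 t) = - (1 / lam\<^sup>2) * t \<and>
      integrable M (\<lambda>\<omega>. (X \<omega> 0 t)\<^sup>2) \<and> variance (\<lambda>\<omega>. X \<omega> 0 t) = 2 / lam ^ 3 * t"
  proof (cases "t = 0")
    case True
    have zero: "AE \<omega> in M. X \<omega> 0 t = 0"
      using assms(6) unfolding True hammersley_process_def by (auto elim: eventually_mono)
    have meas: "(\<lambda>\<omega>. X \<omega> 0 t) \<in> borel_measurable M" using assms(7,8) by blast
    then have meas2: "(\<lambda>\<omega>. (X \<omega> 0 t)\<^sup>2) \<in> borel_measurable M" by measurable
    have zero2: "AE \<omega> in M. (X \<omega> 0 t)\<^sup>2 = 0" using zero by eventually_elim simp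
    have i: "integrable M (\<lambda>\<omega>. X \<omega> 0 t)" "integrable M (\<lambda>\<omega>. (X \<omega> 0 t)\<^sup>2)"
      using integrable_cong_AE[OF meas _ zero] integrable_cong_AE[OF meas2 _ zero2] by auto
    have e: "expectation (\<lambda>\<omega>. X \<omega> 0 t) = 0" "expectation (\<lambda>\<omega>. (X \<omega> 0 t)\<^sup>2) = 0"
      using integral_cong_AE[OF meas _ zero] integral_cong_AE[OF meas2 _ zero2] by auto
    show ?thesis using i e variance_eq[OF i] True by simp
  next
    case False
    then have t: "0 < t" using assms(8) by simp
    note m = tagged_moments[OF assms(6) assms(7)[OF assms(8)] t]
    have "variance (\<lambda>\<omega>. X \<omega> 0 t) = ((t / lam)\<^sup>2 + 2 * (t / lam)) / lam\<^sup>2 - (- (t / lam / lam))\<^sup>2"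
      using variance_eq[OF m(1,3)] m(2,4) by simp
    also have "\<dots> = 2 / lam ^ 3 * t"
      using \<open>lam > 0\<close> by (simp add: field_simps power2_eq_square power3_eq_cube)
    finally have "variance (\<lambda>\<omega>. X \<omega> 0 t) = 2 / lam ^ 3 * t" .
    then show ?thesis using m by (simp add: power2_eq_square)
  qed
  then show ?thesis unfolding Let_def sig .
qed

end
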